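(* Assume that $\alpha>0$ and $\rho\in(0,1)$. The function $\phi(z)=\phi(z;\alpha,\rho)$ can be analytically continued into the domain $\{z\in\mathbb C:|\arg(z)|<\pi\}$, except that it has simple poles at the points $\{-\exp(\pm\pi i(\rho-\alpha^{-1}))\}$ when $\alpha\rho>1$. The function $\phi(z)$ has a branch point at $z=0$, while the function $w\mapsto\phi(e^w)$ is meromorphic in $\mathbb C$ and quasi-periodic with periods $2\pi i$ and $2\pi i\alpha^{-1}$: $$\phi(e^{w+2\pi i})=\phi(e^w)\frac{1+e^{\alpha w+\pi i\alpha(1-\rho)}}{1+e^{\alpha w+\pi i\alpha(1+\rho)}},\qquad \phi(e^{w+2\pi i/\alpha})=\phi(e^w)\frac{1+e^{w+\pi i(\alpha^{-1}-\rho)}}{1+e^{w+\pi i(\alpha^{-1}+\rho)}}.$$ The function $\phi(e^w)$ has roots at $$\{w_{m,n}+\pi i\rho\}_{m\ge0,n\ge0}\cup\{w_{m,n}-\pi i\rho\}_{m<0,n<0}$$ and poles at $$\{w_{m,n}-\pi i\rho\}_{m\ge0,n\ge0}\cup\{w_{m,n}+\pi i\rho\}_{m<0,n<0},$$ where $w_{m,n}=\pi i\left[(2m+1)\alpha^{-1}+(2n+1)\right]$, $m,n\in\mathbb Z$. All roots and poles are simple if $\alpha$ is irrational.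
   Context: Definition of $\phi$. The admissible set is $\mathcal A=\{\alpha\in(0,1),\rho\in(0,1)\}\cup\{\alpha=1,\rho=\frac12\}\cup\{\alpha\in(1,2),\rho\in[1-\alpha^{-1},\alpha^{-1}]\}$. For $(\alpha,\rho)\in\mathcal A$, let $X_t$ be the stable Lévy process with $X_0=0$, $\mathbb E[e^{izX_t}]=e^{-t\Psi(z)}$, $z\in\mathbb R$, where $\Psi(z)=e^{\pi i\gamma/2}|z|^\alpha$ for $z>0$, $\Psi(z)=e^{-\pi i\gamma/2}|z|^\alpha$ for $z<0$, $\Psi(0)=0$, and $\gamma=\alpha(1-2\rho)$ (so that $\rho=\mathbb P(X_1>0)$). Then $\phi(z;\alpha,\rho)=\mathbb E[e^{-zS_{e(1)}}]$ for $\mathrm{Re}(z)\ge0$, where $S_t=\sup_{0\le u\le t}X_u$ and $e(1)$ is an exponential variable with parameter $1$ independent of $X$. For general $\alpha>0$, $\rho\in(0,1)$ the function is extended by analytic continuation in the parameters: for $z>0$, $$\phi(z;\alpha,\rho)=\exp\left(\int_0^z\frac{1}{2\pi iu}\left[F(\pi i\rho-\ln u;i/\alpha)-F(-\pi i\rho-\ln u;i/\alpha)\right]du\right),\quad F(w;i/\alpha)=\int_{\mathbb R}\frac{dx}{(1+e^{w-x/\alpha})(1+e^x)}\ (|\mathrm{Im}\,w|<\pi),$$ which agrees with the probabilistic definition when $(\alpha,\rho)\in\mathcal A$. The function $w\mapsto\phi(e^w)$, initially defined for real $w$, denotes its analytic continuation in $w$.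
   Formalization: Corrected: the poles in |arg z|<π are −exp(±πi(ρ−(2m+1)/α)) for all m≥0 with 2m+1<αρ (just the two listed if 1<αρ≤3); z=0 is a branch point iff αρ is not an integer; points listed both as roots and as poles cancel, counted with multiplicity. *)

theory Defs
  imports "HOL-Complex_Analysis.Complex_Analysis"
begin

(* F(w; i/\<alpha>), meaningful for |Im w| < \<pi>, where the integrand has no singularity
   on the real line. *)
definition stable_F :: "real \<Rightarrow> complex \<Rightarrow> complex" where
  "stable_F \<alpha> w = (LINT x|lborel. 1 / ((1 + exp (w - of_real (x / \<alpha>))) * (1 + exp (of_real x))))"

(* \<phi>(z; \<alpha>, \<rho>) for z > 0 and all \<alpha> > 0, 0 < \<rho> < 1.  For admissible (\<alpha>, \<rho>) this is
   the Laplace transform E[exp (- z S)] of the supremum S, at an independent Exp(1) time, of the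
   stable process with parameters (\<alpha>, \<rho>). *)
definition phi :: "real \<Rightarrow> real \<Rightarrow> real \<Rightarrow> complex" where
  "phi \<alpha> \<rho> z = exp (LBINT u=0..ereal z. 1 / (2 * pi * \<i> * of_real u) *
     (stable_F \<alpha> (pi * \<i> * \<rho> - of_real (ln u)) - stable_F \<alpha> (- pi * \<i> * \<rho> - of_real (ln u))))"

definition slit_plane :: "complex set" where
  "slit_plane = {z. z \<noteq> 0 \<and> \<bar>Arg z\<bar> < pi}"

definition simple_pole :: "(complex \<Rightarrow> complex) \<Rightarrow> complex \<Rightarrow> bool" where
  "simple_pole f z \<longleftrightarrow> is_pole f z \<and> zorder f z = -1"

definition simple_root :: "(complex \<Rightarrow> complex) \<Rightarrow> complex \<Rightarrow> bool" where
  "simple_root f z \<longleftrightarrow> \<not> is_pole f z \<and> f z = 0 \<and> zorder f z = 1"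

(* Here f is a branch on the plane slit along the half-line to the left of a.  The point a is a
   branch point if f can be continued along all paths in some punctured disc around a (g is this
   continuation in the logarithmic coordinate z = a + exp w) and a loop around a changes the
   value. *)
definition branch_point :: "(complex \<Rightarrow> complex) \<Rightarrow> complex \<Rightarrow> bool" where
  "branch_point f a \<longleftrightarrow> (\<exists>c::real. \<exists>g. g holomorphic_on {w. Re w < c} \<and>
     (\<forall>w. Re w < c \<and> \<bar>Im w\<bar> < pi \<longrightarrow> f (a + exp w) = g w) \<and>
     (\<exists>w. Re w < c \<and> g (w + 2 * pi * \<i>) \<noteq> g w))"

definition w_pt :: "real \<Rightarrow> int \<Rightarrow> int \<Rightarrow> complex" where
  "w_pt \<alpha> m n = pi * \<i> * of_real ((2 * of_int m + 1) / \<alpha> + (2 * of_int n + 1))"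

definition root_set :: "real \<Rightarrow> real \<Rightarrow> complex set" where
  "root_set \<alpha> \<rho> = {w_pt \<alpha> m n + pi * \<i> * \<rho> |m n. m \<ge> 0 \<and> n \<ge> 0}
                 \<union> {w_pt \<alpha> m n - pi * \<i> * \<rho> |m n. m < 0 \<and> n < 0}"

definition pole_set :: "real \<Rightarrow> real \<Rightarrow> complex set" where
  "pole_set \<alpha> \<rho> = {w_pt \<alpha> m n - pi * \<i> * \<rho> |m n. m \<ge> 0 \<and> n \<ge> 0}
                 \<union> {w_pt \<alpha> m n + pi * \<i> * \<rho> |m n. m < 0 \<and> n < 0}"

(* The number of index pairs (m, n) by which w is listed in root_set, respectively pole_set. *)
definition root_mult :: "real \<Rightarrow> real \<Rightarrow> complex \<Rightarrow> nat" where
  "root_mult \<alpha> \<rho> w = card {(m, n). (m \<ge> 0 \<and> n \<ge> 0 \<and> w = w_pt \<alpha> m n + pi * \<i> * \<rho>)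
                                   \<or> (m < 0 \<and> n < 0 \<and> w = w_pt \<alpha> m n - pi * \<i> * \<rho>)}"

definition pole_mult :: "real \<Rightarrow> real \<Rightarrow> complex \<Rightarrow> nat" where
  "pole_mult \<alpha> \<rho> w = card {(m, n). (m \<ge> 0 \<and> n \<ge> 0 \<and> w = w_pt \<alpha> m n - pi * \<i> * \<rho>)
                                   \<or> (m < 0 \<and> n < 0 \<and> w = w_pt \<alpha> m n + pi * \<i> * \<rho>)}"

(* The two exceptional points in the slit plane when \<alpha> \<rho> > 1. *)
definition two_poles :: "real \<Rightarrow> real \<Rightarrow> complex set" where
  "two_poles \<alpha> \<rho> = {- exp (pi * \<i> * of_real (\<rho> - 1 / \<alpha>)), - exp (- pi * \<i> * of_real (\<rho> - 1 / \<alpha>))}"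

(* All the points exp w, w in pole_set, |Im w| < \<pi>.  This set is empty for \<alpha> \<rho> \<le> 1 and equals
   two_poles for 1 < \<alpha> \<rho> \<le> 3; each further odd integer below \<alpha> \<rho> contributes another pair. *)
definition slit_poles :: "real \<Rightarrow> real \<Rightarrow> complex set" where
  "slit_poles \<alpha> \<rho> =
     (\<Union>m \<in> {m::nat. 2 * real m + 1 < \<alpha> * \<rho>}.
        {- exp (pi * \<i> * of_real (\<rho> - (2 * real m + 1) / \<alpha>)),
         - exp (- pi * \<i> * of_real (\<rho> - (2 * real m + 1) / \<alpha>))})"

end

theory Submission
  imports Defs
begin

text \<open>
  All assertions about \<open>\<phi>\<close> are assertions about one function, the double sine function (Faddeev's
  quantum dilogarithm). Let \<open>L\<close> be the primitive of \<open>F(\<cdot>; \<i>/\<alpha>)\<close> that vanishes at \<open>+\<infinity>\<close>, and put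
  \<open>S = exp (L / (2 \<pi> \<i>))\<close>. The substitution \<open>u = exp s\<close> turns the exponent in the definition of \<open>\<phi>\<close> into
  a difference of two values of \<open>L\<close>, so that
  \<open>\<phi>(exp w) = S(- \<pi> \<i> \<rho> - w) / S(\<pi> \<i> \<rho> - w)\<close> (\<open>phi_eq_sine_strip_quotient\<close>). The zeros, the poles and
  the two quasi-periods of \<open>S\<close> therefore give those of \<open>\<phi>(exp w)\<close>.

  The function \<open>F\<close> is the integral of \<open>kern \<alpha> w x = 1 / ((1 + exp (w - x/\<alpha>)) (1 + exp x))\<close> over real \<open>x\<close>.
  As long as no pole of the kernel is crossed, the line of integration may be moved to \<open>Im x = \<theta>\<close>
  (\<open>line_F_shift\<close>), and this continues \<open>F\<close> to the strip \<open>|Im w| < \<pi> + \<pi>/\<alpha>\<close>, which is wider than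
  \<open>2 \<pi>\<close>. The points \<open>w + \<pi> \<i>\<close> and \<open>w - \<pi> \<i>\<close> give the same integrand, but lines on opposite sides of its
  pole \<open>x = \<alpha> w\<close>. Hence the difference of the two values of \<open>F\<close> is a residue (\<open>F_ext_jump\<close>), and
  integration in \<open>w\<close> yields \<open>S(w + \<pi> \<i>) = (1 + exp (- \<alpha> w)) S(w - \<pi> \<i>)\<close> (\<open>sine_strip_shift\<close>).

  This relation continues \<open>S\<close> to a meromorphic function \<open>double_sine\<close> on the plane: going up, every
  period multiplies by a factor \<open>1 + exp (- \<alpha> (w - \<pi> \<i>))\<close>, and going down it divides by one. As \<open>S\<close> has
  neither zeros nor poles in the original strip, the orders of \<open>double_sine\<close> come from the simple zeros
  of these factors: it has zeros at \<open>\<pi> \<i> ((2 m + 1)/\<alpha> + (2 k + 1))\<close> with \<open>m, k \<ge> 0\<close> and poles at the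
  opposite points, counted with the number of representations (\<open>zorder_double_sine\<close>). The second
  quasi-period is the first one in disguise: substituting \<open>y = w - x/\<alpha>\<close> in \<open>F\<close> exchanges the two factors
  of the kernel and shows \<open>S\<^sub>\<alpha>(w) = S\<^bsub>1/\<alpha>\<^esub>(\<alpha> w)\<close> (\<open>double_sine_reciprocal\<close>).

  On the slit plane \<open>\<phi>\<close> is \<open>phi_log \<circ> Ln\<close>, where \<open>phi_log\<close> is the continuation of \<open>\<phi>(exp w)\<close>. Only zeros
  and poles with \<open>|Im w| < \<pi>\<close> are visible there, and the only such points are poles with \<open>k = 0\<close> and
  \<open>2 m + 1 < \<alpha> \<rho>\<close>. All zeros and poles of \<open>phi_log\<close> lie on the imaginary axis, so that \<open>\<phi>\<close> can be
  continued along any path in the punctured unit disc; a loop around 0 multiplies it by the factor in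
  the first quasi-periodicity, which has the form \<open>(1 + N) / (1 + N exp (2 \<pi> \<i> \<alpha> \<rho>))\<close> with \<open>N \<noteq> 0\<close>.
  Thus 0 is a branch point exactly if \<open>\<alpha> \<rho>\<close> is not an integer.
\<close>

section \<open>Integrals over horizontal lines\<close>

lemma tendsto_LINT_symmetric_interval:
  fixes f :: "real \<Rightarrow> 'a::{banach, second_countable_topology}"
  assumes "integrable lborel f"
  shows "((\<lambda>T. LINT x|lborel. indicator {-T..T} x *\<^sub>R f x) \<longlongrightarrow> (LINT x|lborel. f x)) at_top"
proof (rule integral_dominated_convergence_at_top[where w = "\<lambda>x. norm (f x)"])
  show "AE x in lborel. ((\<lambda>T. indicat_real {-T..T} x *\<^sub>R f x) \<longlongrightarrow> f x) at_top"
  proof (rule AE_I2)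
    fix x :: real
    have "\<forall>\<^sub>F T in at_top. indicat_real {-T..T} x *\<^sub>R f x = f x"
      using eventually_ge_at_top[of "\<bar>x\<bar>"] by eventually_elim (auto simp: indicator_def)
    then show "((\<lambda>T. indicat_real {-T..T} x *\<^sub>R f x) \<longlongrightarrow> f x) at_top"
      by (rule tendsto_eventually)
  qed
qed (use assms in \<open>auto intro!: always_eventually AE_I2 simp: indicator_def\<close>)

lemma eventually_filtercomap_Re_at_top:
  "(\<forall>\<^sub>F z in filtercomap Re at_top. P z) \<longleftrightarrow> (\<exists>X. \<forall>z. Re z \<ge> X \<longrightarrow> P z)"
  by (auto simp: eventually_filtercomap eventually_at_top_linorder)

lemma eventually_filtercomap_Re_at_bot:
  "(\<forall>\<^sub>F z in filtercomap Re at_bot. P z) \<longleftrightarrow> (\<exists>X. \<forall>z. Re z \<le> X \<longrightarrow> P z)"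
  by (auto simp: eventually_filtercomap eventually_at_bot_linorder)

abbreviation line_integral :: "(complex \<Rightarrow> complex) \<Rightarrow> real \<Rightarrow> complex" where
  "line_integral g t \<equiv> (LINT x|lborel. g (of_real x + \<i> * of_real t))"

abbreviation line_integrable :: "(complex \<Rightarrow> complex) \<Rightarrow> real \<Rightarrow> bool" where
  "line_integrable g t \<equiv> integrable lborel (\<lambda>x. g (of_real x + \<i> * of_real t))"

text \<open>
  On the strip, a convex set, \<open>g\<close> has a primitive \<open>G\<close>. The integrals over the segments
  \<open>[-T + \<i> a, T + \<i> a]\<close> and \<open>[-T + \<i> b, T + \<i> b]\<close> differ by increments of \<open>G\<close> along the two vertical
  sides at \<open>Re z = \<plusminus>T\<close>, which tend to 0 with \<open>g\<close>. The decay of \<open>g\<close> is expressed by the filters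
  \<open>filtercomap Re at_top\<close> and \<open>filtercomap Re at_bot\<close>, that is, uniformly in the imaginary part.
\<close>

lemma LINT_shift_contour:
  fixes g :: "complex \<Rightarrow> complex" and a b :: real
  assumes hol: "g holomorphic_on {z. lo < Im z \<and> Im z < hi}"
    and ab: "a \<in> {lo<..<hi}" "b \<in> {lo<..<hi}"
    and int_a: "line_integrable g a"
    and int_b: "line_integrable g b"
    and lim_top: "(g \<longlongrightarrow> 0) (filtercomap Re at_top)"
    and lim_bot: "(g \<longlongrightarrow> 0) (filtercomap Re at_bot)"
  shows "line_integral g a = line_integral g b"
proof -
  define S where "S = {z. lo < Im z \<and> Im z < hi}"
  have S_eq: "S = {z. Im z > lo} \<inter> {z. Im z < hi}"
    by (auto simp: S_def)
  have S: "open S" "convex S"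
    unfolding S_eq by (auto intro!: open_Int convex_Int open_halfspace_Im_lt open_halfspace_Im_gt
        convex_halfspace_Im_lt convex_halfspace_Im_gt)
  obtain G where G0: "\<And>z. z \<in> S \<Longrightarrow> (G has_field_derivative g z) (at z within S)"
    using holomorphic_convex_primitive'[OF S(2,1)] hol unfolding S_def by blast
  have G: "(G has_field_derivative g z) (at z)" if "z \<in> S" for z
    using G0[OF that] at_within_open[OF that S(1)] by simp
  have FTC: "(LINT x|lborel. indicator {-T..T} x *\<^sub>R g (of_real x + \<i> * of_real \<theta>))
       = G (of_real T + \<i> * of_real \<theta>) - G (of_real (-T) + \<i> * of_real \<theta>)"
    if "T \<ge> 0" "\<theta> \<in> {lo<..<hi}" for T \<theta> :: real
  proof (rule integral_FTC_atLeastAtMost)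
    fix x assume "-T \<le> x" "x \<le> T"
    have "((\<lambda>x. G (of_real x + \<i> * of_real \<theta>)) has_vector_derivative (1 * g (of_real x + \<i> * of_real \<theta>))) (at x)"
      by (rule field_vector_diff_chain_at[unfolded o_def, of "\<lambda>x. of_real x + \<i> * of_real \<theta>" _ _ G])
         (use that in \<open>auto intro!: derivative_eq_intros G simp: S_def has_vector_derivative_real_field\<close>)
    then show "((\<lambda>x. G (of_real x + \<i> * of_real \<theta>)) has_vector_derivative g (of_real x + \<i> * of_real \<theta>)) (at x within {-T..T})"
      by (simp add: has_vector_derivative_at_within)
  next
    have "continuous_on S g"
      using hol S_def holomorphic_on_imp_continuous_on by blast
    then show "continuous_on {-T..T} (\<lambda>x. g (of_real x + \<i> * of_real \<theta>))"
      by (rule continuous_on_compose2) (use that in \<open>auto intro!: continuous_intros simp: S_def\<close>)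
  qed (use that in auto)
  have side: "((\<lambda>T. G (of_real T + \<i> * of_real a) - G (of_real T + \<i> * of_real b)) \<longlongrightarrow> 0) F"
    if "(g \<longlongrightarrow> 0) (filtercomap Re F)" for F :: "real filter"
  proof (rule tendstoI)
    fix e :: real assume "e > 0"
    define d where "d = e / (2 * (\<bar>a - b\<bar> + 1))"
    have "d > 0" using \<open>e > 0\<close> unfolding d_def by (intro divide_pos_pos mult_pos_pos add_nonneg_pos) auto
    have "\<forall>\<^sub>F z in filtercomap Re F. norm (g z) < d"
      using tendstoD[OF that \<open>d > 0\<close>] by simp
    then have "\<forall>\<^sub>F T in F. \<forall>z. Re z = T \<longrightarrow> norm (g z) < d"
      by (auto simp: eventually_filtercomap elim!: eventually_mono)
    then show "\<forall>\<^sub>F T in F. dist (G (of_real T + \<i> * of_real a) - G (of_real T + \<i> * of_real b)) 0 < e"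
    proof eventually_elim
      case (elim T)
      define C where "C = closed_segment (of_real T + \<i> * of_real b) (of_real T + \<i> * of_real a)"
      have C1: "Re z = T" if "z \<in> C" for z
      proof -
        from that obtain u where "z = (1 - u) *\<^sub>R (of_real T + \<i> * of_real b) + u *\<^sub>R (of_real T + \<i> * of_real a)"
          unfolding C_def in_segment by blast
        then have "Re z = (1 - u) * T + u * T" by simp
        then show ?thesis by (simp add: algebra_simps)
      qed
      have C2: "C \<subseteq> S"
        unfolding C_def by (rule closed_segment_subset) (use S ab in \<open>auto simp: S_def\<close>)
      have "norm (G (of_real T + \<i> * of_real a) - G (of_real T + \<i> * of_real b))
          \<le> d * norm ((of_real T + \<i> * of_real a) - (of_real T + \<i> * of_real b))"
      proof (rule field_differentiable_bound[where S = C and f' = g])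
        show "(G has_field_derivative g z) (at z within C)" if "z \<in> C" for z
          using G C2 that by (meson has_field_derivative_at_within subsetD)
        show "norm (g z) \<le> d" if "z \<in> C" for z
          using elim C1[OF that] by (simp add: less_imp_le)
      qed (auto simp: C_def)
      also have "(of_real T + \<i> * of_real a) - (of_real T + \<i> * of_real b) = \<i> * of_real (a - b)"
        by (simp add: algebra_simps)
      also have "norm (\<i> * of_real (a - b)) = \<bar>a - b\<bar>"
        by (simp add: norm_mult del: of_real_diff)
      also have "d * \<bar>a - b\<bar> < e"
      proof -
        have "d * (2 * (\<bar>a - b\<bar> + 1)) = e"
          by (simp add: d_def del: distrib_left_numeral)
        then show ?thesis using \<open>d > 0\<close> \<open>e > 0\<close> by (simp add: algebra_simps)
      qed
      finally show ?case by simp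
    qed
  qed
  let ?I = "\<lambda>\<theta> T. LINT x|lborel. indicator {-T..T} x *\<^sub>R g (of_real x + \<i> * of_real \<theta>)"
  have "((\<lambda>T. ?I a T - ?I b T) \<longlongrightarrow> 0 - 0) at_top"
  proof (rule Lim_transform_eventually)
    show "((\<lambda>T. (G (of_real T + \<i> * of_real a) - G (of_real T + \<i> * of_real b))
        - (G (of_real (-T) + \<i> * of_real a) - G (of_real (-T) + \<i> * of_real b))) \<longlongrightarrow> 0 - 0) at_top"
      by (intro tendsto_diff side[OF lim_top] filterlim_compose[OF side[OF lim_bot] filterlim_uminus_at_bot_at_top])
    show "\<forall>\<^sub>F T in at_top. (G (of_real T + \<i> * of_real a) - G (of_real T + \<i> * of_real b))
        - (G (of_real (-T) + \<i> * of_real a) - G (of_real (-T) + \<i> * of_real b)) = ?I a T - ?I b T"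
      using eventually_ge_at_top[of 0] by eventually_elim (simp only: FTC[OF _ ab(1)] FTC[OF _ ab(2)], simp)
  qed
  moreover have "((\<lambda>T. ?I a T - ?I b T) \<longlongrightarrow>
      line_integral g a - (line_integral g b)) at_top"
    by (intro tendsto_diff tendsto_LINT_symmetric_interval int_a int_b)
  ultimately have "line_integral g a - line_integral g b = 0 - 0"
    by (rule tendsto_unique[OF trivial_limit_at_top_linorder, rotated])
  then show ?thesis by simp
qed

text \<open>
  Differentiation under the integral sign. A locally uniform integrable bound on \<open>g\<close> bounds, by
  Cauchy's inequality, also the derivatives and hence the difference quotients, so that dominated
  convergence applies to the latter.
\<close>

lemma holomorphic_on_LINT:
  fixes g :: "real \<Rightarrow> complex \<Rightarrow> complex"
  assumes "open U"
    and hol: "\<And>x. g x holomorphic_on U"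
    and meas: "\<And>w. w \<in> U \<Longrightarrow> (\<lambda>x. g x w) \<in> borel_measurable lborel"
    and dom: "\<And>w. w \<in> U \<Longrightarrow> \<exists>r>0. \<exists>B. cball w r \<subseteq> U \<and> integrable lborel B \<and> (\<forall>x. \<forall>v\<in>cball w r. norm (g x v) \<le> B x)"
  shows "(\<lambda>w. LINT x|lborel. g x w) holomorphic_on U"
proof -
  have "(\<lambda>w. LINT x|lborel. g x w) field_differentiable at w" if w: "w \<in> U" for w
  proof -
    obtain r B where r: "r > 0" "cball w r \<subseteq> U" and B: "integrable lborel B"
      and gB: "\<And>x v. v \<in> cball w r \<Longrightarrow> norm (g x v) \<le> B x"
      using dom[OF w] by blast
    have int: "integrable lborel (\<lambda>x. g x v)" if "v \<in> cball w r" for v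
      using gB[OF that] r that by (intro Bochner_Integration.integrable_bound[OF B] meas AE_I2) 
        (auto intro: order_trans[OF _ abs_ge_self])
    \<comment> \<open>Discs of radius \<open>r2\<close> around points of \<open>cball w r2\<close> stay inside \<open>cball w r\<close>.\<close>
    define r2 where "r2 = r / 2"
    have r2: "r2 > 0" "r = r2 + r2" using r by (auto simp: r2_def)
    have deriv_bound: "norm (deriv (g x) v) \<le> B x / r2" if v: "v \<in> cball w r2" for x v
    proof -
      have sub: "cball v r2 \<subseteq> cball w r"
        using v r2 by (simp add: cball_subset_cball_iff dist_commute)
      then have sub2: "cball v r2 \<subseteq> U" using r by blast
      have "norm ((deriv ^^ 1) (g x) v) \<le> fact 1 * B x / r2 ^ 1"
      proof (rule Cauchy_inequality)
        show "g x holomorphic_on ball v r2"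
          by (rule holomorphic_on_subset[OF hol]) (use sub2 in \<open>auto simp: subset_iff\<close>)
        show "continuous_on (cball v r2) (g x)"
          by (rule holomorphic_on_imp_continuous_on[OF holomorphic_on_subset[OF hol sub2]])
        show "norm (g x u) \<le> B x" if "norm (v - u) = r2" for u
          using sub that by (intro gB) (auto simp: dist_norm)
      qed (use r2 in auto)
      then show ?thesis by simp
    qed
    have quot_bound: "norm ((g x v - g x w) / (v - w)) \<le> B x / r2" if v: "v \<in> cball w r2" "v \<noteq> w" for x v
    proof -
      have "norm (g x v - g x w) \<le> (B x / r2) * norm (v - w)"
      proof (rule field_differentiable_bound[where S = "cball w r2" and f' = "deriv (g x)"])
        show "(g x has_field_derivative deriv (g x) z) (at z within cball w r2)" if "z \<in> cball w r2" for z
        proof -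
          have "z \<in> U" using r r2 that by auto
          then show ?thesis using \<open>open U\<close> hol has_field_derivative_at_within holomorphic_derivI by blast
        qed
      qed (use v r2 deriv_bound in auto)
      then show ?thesis using v(2) by (simp add: norm_divide pos_divide_le_eq)
    qed
    have "((\<lambda>v. ((LINT x|lborel. g x v) - (LINT x|lborel. g x w)) / (v - w)) \<longlongrightarrow> (LINT x|lborel. deriv (g x) w)) (at w)"
      unfolding tendsto_at_iff_sequentially comp_def
    proof safe
      fix X assume X: "\<forall>i. X i \<in> UNIV - {w}" "X \<longlonglongrightarrow> w"
      obtain N where "\<And>n. n \<ge> N \<Longrightarrow> dist (X n) w < r2"
        using tendstoD[OF X(2) r2(1)] unfolding eventually_sequentially by blast
      then have N: "\<And>n. n \<ge> N \<Longrightarrow> X n \<in> cball w r2"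
        by (simp add: dist_commute less_imp_le)
      have wU: "w \<in> cball w r" using r by auto
      have eq: "((LINT x|lborel. g x (X (n + N))) - (LINT x|lborel. g x w)) / (X (n + N) - w)
             = (LINT x|lborel. (g x (X (n + N)) - g x w) / (X (n + N) - w))" for n
      proof -
        have "X (n + N) \<in> cball w r" using N[of "n + N"] r2 by auto
        then show ?thesis
          using Bochner_Integration.integral_diff[OF int[of "X (n + N)"] int[OF wU]] by simp
      qed
      have lim: "(\<lambda>n. LINT x|lborel. (g x (X (n + N)) - g x w) / (X (n + N) - w)) \<longlonglongrightarrow> (LINT x|lborel. deriv (g x) w)"
      proof (rule integral_dominated_convergence)
        have ptw0: "(\<lambda>n. (g x (X (n + N)) - g x w) / (X (n + N) - w)) \<longlonglongrightarrow> deriv (g x) w" for x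
        proof -
          have "(g x has_field_derivative deriv (g x) w) (at w)"
            using hol \<open>open U\<close> w holomorphic_derivI by blast
          then have "((\<lambda>v. (g x v - g x w) / (v - w)) \<longlongrightarrow> deriv (g x) w) (at w)"
            by (simp add: has_field_derivative_iff)
          then have "(\<lambda>n. (g x (X n) - g x w) / (X n - w)) \<longlonglongrightarrow> deriv (g x) w"
            using X unfolding tendsto_at_iff_sequentially comp_def by blast
          then show "(\<lambda>n. (g x (X (n + N)) - g x w) / (X (n + N) - w)) \<longlonglongrightarrow> deriv (g x) w"
            by (rule LIMSEQ_ignore_initial_segment)
        qed
        then show "AE x in lborel. (\<lambda>n. (g x (X (n + N)) - g x w) / (X (n + N) - w)) \<longlonglongrightarrow> deriv (g x) w"
          by (rule AE_I2)
        show "(\<lambda>x. (g x (X (n + N)) - g x w) / (X (n + N) - w)) \<in> borel_measurable lborel" for n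
        proof -
          have "X (n + N) \<in> U" using N[of "n + N"] r2 r by auto
          then show ?thesis by (intro borel_measurable_divide borel_measurable_diff meas w) auto
        qed
        then show "(\<lambda>x. deriv (g x) w) \<in> borel_measurable lborel"
          by (rule borel_measurable_LIMSEQ_metric) (use ptw0 in simp)
        show "integrable lborel (\<lambda>x. B x / r2)" using B by simp
        show "AE x in lborel. norm ((g x (X (n + N)) - g x w) / (X (n + N) - w)) \<le> B x / r2" for n
          using N[of "n + N"] X(1) by (intro AE_I2 quot_bound) auto
      qed
      have "(\<lambda>n. ((LINT x|lborel. g x (X (n + N))) - (LINT x|lborel. g x w)) / (X (n + N) - w)) \<longlonglongrightarrow> (LINT x|lborel. deriv (g x) w)"
        using lim by (simp only: eq)
      then show "(\<lambda>n. ((LINT x|lborel. g x (X n)) - (LINT x|lborel. g x w)) / (X n - w)) \<longlonglongrightarrow> (LINT x|lborel. deriv (g x) w)"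
        by (rule LIMSEQ_offset)
    qed
    then show ?thesis
      by (auto simp: field_differentiable_def has_field_derivative_iff)
  qed
  then show ?thesis
    by (auto simp: holomorphic_on_def intro: field_differentiable_at_within)
qed

section \<open>The kernel\<close>

lemma sech_integral:
  fixes k :: real
  assumes "k > 0"
  shows "integrable lborel (\<lambda>x. 1 / cosh (k * x))" and "(LINT x|lborel. 1 / cosh (k * x)) = pi / k"
proof -
  define F where "F = (\<lambda>x::real. 2 / k * arctan (exp (k * x)))"
  have pos: "cosh (k * x) > 0" for x by (rule cosh_real_pos)
  have der: "DERIV F x :> 1 / cosh (k * x)" for x
  proof -
    have "1 + exp (k * x) * exp (k * x) > 0" by (intro add_pos_pos mult_pos_pos) auto
    then have "1 / cosh (k * x) = 2 * exp (k * x) / (1 + exp (k * x) * exp (k * x))"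
      by (simp add: cosh_def field_simps exp_minus)
    then show ?thesis
      unfolding F_def using assms
      by (auto intro!: derivative_eq_intros simp: power2_eq_square field_simps)
  qed
  have bot: "((F \<circ> real_of_ereal) \<longlongrightarrow> 2 / k * arctan 0) (at_right (-\<infinity>))"
    unfolding ereal_tendsto_simps F_def using assms
    by (intro tendsto_intros filterlim_compose[OF exp_at_bot] filterlim_tendsto_pos_mult_at_bot[OF tendsto_const] filterlim_ident)
  have top: "((F \<circ> real_of_ereal) \<longlongrightarrow> 2 / k * (pi / 2)) (at_left \<infinity>)"
    unfolding ereal_tendsto_simps F_def using assms
    by (intro tendsto_intros filterlim_compose[OF tendsto_arctan_at_top] filterlim_compose[OF exp_at_top]
        filterlim_tendsto_pos_mult_at_top[OF tendsto_const] filterlim_ident)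
  have cont: "isCont (\<lambda>x. 1 / cosh (k * x)) x" for x
    using pos[of x] by (auto intro!: continuous_intros)
  note FTC = interval_integral_FTC_nonneg[of "-\<infinity>" "\<infinity>" F "\<lambda>x. 1 / cosh (k * x)", OF _ der cont _ bot top]
  have "set_integrable lborel (einterval (-\<infinity>) \<infinity>) (\<lambda>x. 1 / cosh (k * x))"
    by (rule FTC) (auto intro!: AE_I2)
  then show "integrable lborel (\<lambda>x. 1 / cosh (k * x))"
    by (simp add: set_integrable_def)
  have "(LBINT x=-\<infinity>..\<infinity>. 1 / cosh (k * x)) = 2 / k * (pi / 2) - 2 / k * arctan 0"
    by (rule FTC) (auto intro!: AE_I2)
  then show "(LINT x|lborel. 1 / cosh (k * x)) = pi / k"
    by (simp add: interval_lebesgue_integral_def set_lebesgue_integral_def)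
qed

text \<open>
  The square of the right-hand side minus the square of the left-hand side is
  \<open>(1 - cos (Im z)) / 2 \<cdot> (1 - exp (Re z))\<^sup>2\<close>. This reduces all estimates of the kernel to real
  arguments.
\<close>

lemma norm_one_plus_exp_ge:
  assumes "\<bar>Im z\<bar> \<le> pi"
  shows "(1 + exp (Re z)) * cos (Im z / 2) \<le> norm (1 + exp z)"
proof (rule power2_le_imp_le)
  define r where "r = exp (Re z)"
  define c where "c = cos (Im z)"
  have c2: "cos (Im z / 2) ^ 2 = (1 + c) / 2"
    using cos_double_cos[of "Im z / 2"] by (simp add: c_def field_simps)
  have "norm (1 + exp z) ^ 2 = (1 + r * c) ^ 2 + (r * sin (Im z)) ^ 2"
    by (simp add: cmod_power2 Re_exp Im_exp r_def c_def)
  also have "(r * sin (Im z)) ^ 2 = r ^ 2 * (1 - c ^ 2)"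
    by (simp add: power_mult_distrib c_def sin_squared_eq)
  finally have "norm (1 + exp z) ^ 2 - ((1 + r) * cos (Im z / 2)) ^ 2 = (1 - c) / 2 * (1 - r) ^ 2"
    unfolding power_mult_distrib c2 by (simp add: power2_eq_square field_simps)
  moreover have "(1 - c) / 2 * (1 - r) ^ 2 \<ge> 0"
    by (simp add: c_def)
  ultimately show "((1 + exp (Re z)) * cos (Im z / 2)) ^ 2 \<le> norm (1 + exp z) ^ 2"
    by (simp add: r_def)
qed simp

lemma one_plus_exp_nonzero: "1 + exp z \<noteq> 0" if "\<bar>Im z\<bar> < pi"
proof -
  have "cos (Im z / 2) > 0" using that by (intro cos_gt_zero_pi) auto
  then have "(1 + exp (Re z)) * cos (Im z / 2) > 0"
    by (intro mult_pos_pos add_pos_pos) auto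
  then have "norm (1 + exp z) > 0"
    using norm_one_plus_exp_ge[of z] that by linarith
  then show ?thesis by simp
qed

lemma exp_le_one_plus_exp:
  fixes u :: real assumes "0 \<le> t" "t \<le> 1"
  shows "exp (t * u) \<le> 1 + exp u"
proof (cases "u \<ge> 0")
  case True
  then have "exp (t * u) \<le> exp u" using assms by (simp add: mult_left_le_one_le)
  also have "\<dots> \<le> 1 + exp u" by simp
  finally show ?thesis .
next
  case False
  then have "exp (t * u) \<le> 1" using assms by (simp add: mult_nonneg_nonpos)
  then show ?thesis by (simp add: add_increasing2)
qed

definition kern :: "real \<Rightarrow> complex \<Rightarrow> complex \<Rightarrow> complex" where
  "kern \<alpha> w x = 1 / ((1 + exp (w - x / of_real \<alpha>)) * (1 + exp x))"

text \<open>
  The factor \<open>1 / (1 + exp (w - x/\<alpha>))\<close> is bounded by a multiple of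
  \<open>exp (- c Re (w - x/\<alpha>))\<close>. This gives exponential decay in \<open>Re w\<close> at the price of \<open>exp (c x/\<alpha>)\<close>, which
  \<open>1 / (1 + exp x)\<close> absorbs as long as \<open>2 c \<le> \<alpha>\<close>. The remaining function of \<open>x\<close> is bounded by a
  hyperbolic secant, whose integral is explicit.
\<close>

lemma norm_kern_le:
  assumes "\<alpha> > 0" "0 \<le> c" "c \<le> 1" "2 * c \<le> \<alpha>" "\<eta> < pi"
    and Im: "\<bar>Im x\<bar> \<le> \<eta>" "\<bar>Im w - Im x / \<alpha>\<bar> \<le> \<eta>"
  shows "norm (kern \<alpha> w x) \<le> exp (- c * Re w) / cos (\<eta> / 2) ^ 2 * (1 / cosh (c / \<alpha> * Re x))"
proof -
  have \<eta>: "0 \<le> \<eta>" using Im(1) by linarith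
  have factor: "norm (1 + exp z) \<ge> (1 + exp (Re z)) * cos (\<eta> / 2)" if "\<bar>Im z\<bar> \<le> \<eta>" for z
  proof -
    have "cos (\<eta> / 2) \<le> cos \<bar>Im z / 2\<bar>"
      by (rule cos_monotone_0_pi_le) (use that \<open>\<eta> < pi\<close> in auto)
    then have "cos (\<eta> / 2) \<le> cos (Im z / 2)" by (simp only: cos_abs_real)
    then have "(1 + exp (Re z)) * cos (\<eta> / 2) \<le> (1 + exp (Re z)) * cos (Im z / 2)"
      by (intro mult_left_mono) (auto simp: add_nonneg_nonneg)
    also have "\<dots> \<le> norm (1 + exp z)"
      by (rule norm_one_plus_exp_ge) (use that assms in auto)
    finally show ?thesis .
  qed
  define u where "u = Re w - Re x / \<alpha>"
  define y where "y = Re x"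
  have cos_pos: "cos (\<eta> / 2) > 0" using \<eta> assms by (intro cos_gt_zero_pi) auto
  have "norm ((1 + exp (w - x / of_real \<alpha>)) * (1 + exp x)) \<ge>
      ((1 + exp u) * cos (\<eta> / 2)) * ((1 + exp y) * cos (\<eta> / 2))"
    unfolding norm_mult
  proof (rule mult_mono)
    show "(1 + exp u) * cos (\<eta> / 2) \<le> norm (1 + exp (w - x / of_real \<alpha>))"
      using factor[of "w - x / of_real \<alpha>"] Im(2) by (simp add: u_def)
    show "(1 + exp y) * cos (\<eta> / 2) \<le> norm (1 + exp x)"
      using factor[of x] Im(1) by (simp add: y_def)
  qed (use cos_pos in \<open>auto intro!: mult_nonneg_nonneg add_nonneg_nonneg\<close>)
  moreover have "((1 + exp u) * cos (\<eta> / 2)) * ((1 + exp y) * cos (\<eta> / 2)) \<ge>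
      exp (c * Re w) * cos (\<eta> / 2) ^ 2 * cosh (c / \<alpha> * y)"
  proof -
    have 1: "exp (c * u) \<le> 1 + exp u"
      using assms by (intro exp_le_one_plus_exp) auto
    define X where "X = exp ((2 * c / \<alpha>) * y)"
    have "X \<le> 1 + exp y"
      unfolding X_def using assms by (intro exp_le_one_plus_exp) (auto simp: field_simps)
    then have "(X + 1) / 2 \<le> (1 + exp y + 1) / 2"
      by (intro divide_right_mono add_mono) auto
    also have "\<dots> \<le> 1 + exp y"
      by simp
    finally have "(X + 1) / 2 \<le> 1 + exp y" .
    moreover have "exp (c / \<alpha> * y) * cosh (c / \<alpha> * y) = (X + 1) / 2"
      by (simp add: X_def cosh_def field_simps flip: exp_add)
    ultimately have 2: "exp (c / \<alpha> * y) * cosh (c / \<alpha> * y) \<le> 1 + exp y"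
      by simp
    have "exp (c * Re w) * cosh (c / \<alpha> * y) = exp (c * u) * (exp (c / \<alpha> * y) * cosh (c / \<alpha> * y))"
      unfolding mult.assoc[symmetric] exp_add[symmetric] using assms by (simp add: u_def y_def field_simps)
    also have "\<dots> \<le> (1 + exp u) * (1 + exp y)"
      by (intro mult_mono 1 2) (auto intro!: mult_nonneg_nonneg add_nonneg_nonneg)
    finally have "exp (c * Re w) * cosh (c / \<alpha> * y) * cos (\<eta> / 2) ^ 2 \<le> (1 + exp u) * (1 + exp y) * cos (\<eta> / 2) ^ 2"
      by (rule mult_right_mono) simp
    then show ?thesis by (simp add: power2_eq_square mult_ac)
  qed
  ultimately have "exp (c * Re w) * cos (\<eta> / 2) ^ 2 * cosh (c / \<alpha> * y) \<le> norm ((1 + exp (w - x / of_real \<alpha>)) * (1 + exp x))"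
    by linarith
  moreover have "exp (c * Re w) * cos (\<eta> / 2) ^ 2 * cosh (c / \<alpha> * y) > 0"
    using cos_pos by (intro mult_pos_pos) auto
  ultimately have "1 / norm ((1 + exp (w - x / of_real \<alpha>)) * (1 + exp x)) \<le>
      1 / (exp (c * Re w) * cos (\<eta> / 2) ^ 2 * cosh (c / \<alpha> * y))"
    by (intro frac_le) simp_all
  then show ?thesis
    by (simp add: kern_def norm_divide exp_minus field_simps y_def)
qed

lemma kern_holomorphic_in_parameter:
  assumes "\<And>w. w \<in> U \<Longrightarrow> \<bar>Im w - Im x / \<alpha>\<bar> < pi" "\<bar>Im x\<bar> < pi"
  shows "(\<lambda>w. kern \<alpha> w x) holomorphic_on U"
  unfolding kern_def using assms one_plus_exp_nonzero[of x] one_plus_exp_nonzero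
  by (auto intro!: holomorphic_intros)

lemma kern_holomorphic:
  assumes "\<alpha> > 0" "\<And>x. x \<in> U \<Longrightarrow> \<bar>Im w - Im x / \<alpha>\<bar> < pi" "\<And>x. x \<in> U \<Longrightarrow> \<bar>Im x\<bar> < pi"
  shows "kern \<alpha> w holomorphic_on U"
  unfolding kern_def using assms one_plus_exp_nonzero
  by (auto intro!: holomorphic_intros)

lemma exp_tendsto_0_Re_at_bot:
  assumes "(c::real) > 0"
  shows "((\<lambda>x. exp (of_real c * x)) \<longlongrightarrow> (0::complex)) (filtercomap Re at_bot)"
proof (rule tendsto_norm_zero_cancel)
  have "((\<lambda>x. exp (c * x)) \<longlongrightarrow> 0) at_bot"
    using assms by (intro filterlim_compose[OF exp_at_bot] filterlim_tendsto_pos_mult_at_bot[OF tendsto_const] filterlim_ident)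
  from filterlim_compose[OF this filterlim_filtercomap[of Re]]
  show "((\<lambda>x. norm (exp (of_real c * x) :: complex)) \<longlongrightarrow> 0) (filtercomap Re at_bot)"
    by simp
qed

lemma exp_tendsto_0_Re_at_top:
  assumes "(c::real) > 0"
  shows "((\<lambda>x. exp (- (of_real c * x))) \<longlongrightarrow> (0::complex)) (filtercomap Re at_top)"
proof (rule tendsto_norm_zero_cancel)
  have "((\<lambda>x. exp (- (c * x))) \<longlongrightarrow> 0) at_top"
    using assms by (intro filterlim_compose[OF exp_at_bot] filterlim_compose[OF filterlim_uminus_at_bot_at_top]
        filterlim_tendsto_pos_mult_at_top[OF tendsto_const] filterlim_ident)
  from filterlim_compose[OF this filterlim_filtercomap[of Re]]
  show "((\<lambda>x. norm (exp (- (of_real c * x)) :: complex)) \<longlongrightarrow> 0) (filtercomap Re at_top)"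
    by simp
qed

lemma inverse_one_plus_exp:
  "1 / (1 + exp z) = exp (- z) / (exp (- z) + 1)" for z :: complex
proof -
  have "exp (- z) * (1 + exp z) = exp (- z) + 1"
    by (simp add: distrib_left flip: exp_add)
  then show ?thesis
    by (metis exp_not_eq_zero mult.right_neutral mult_divide_mult_cancel_left)
qed

text \<open>
  To the right \<open>1 / (1 + exp x)\<close> forces the decay, to the left the other factor does; the formulas of
  \<open>inverse_one_plus_exp\<close> make this visible as a limit of continuous functions of exponentials.
\<close>

lemma kern_tendsto_0:
  assumes "\<alpha> > 0"
  shows "(kern \<alpha> w \<longlongrightarrow> 0) (filtercomap Re at_top)" "(kern \<alpha> w \<longlongrightarrow> 0) (filtercomap Re at_bot)"
proof -
  have \<alpha>: "1 / \<alpha> > 0" using assms by simp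
  have 1: "kern \<alpha> w = (\<lambda>x. 1 / (1 + exp w * exp (- (of_real (1 / \<alpha>) * x))) *
       (exp (- (of_real 1 * x)) / (exp (- (of_real 1 * x)) + 1)))"
  proof
    fix x
    have "kern \<alpha> w x = 1 / (1 + exp (w - x / of_real \<alpha>)) * (1 / (1 + exp x))"
      by (simp add: kern_def)
    then show "kern \<alpha> w x = 1 / (1 + exp w * exp (- (of_real (1 / \<alpha>) * x))) *
       (exp (- (of_real 1 * x)) / (exp (- (of_real 1 * x)) + 1))"
      unfolding inverse_one_plus_exp[of x] by (simp flip: exp_add)
  qed
  have "(kern \<alpha> w \<longlongrightarrow> 1 / (1 + exp w * 0) * (0 / (0 + 1))) (filtercomap Re at_top)"
    unfolding 1 by (intro tendsto_intros exp_tendsto_0_Re_at_top \<alpha>) auto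
  then show "(kern \<alpha> w \<longlongrightarrow> 0) (filtercomap Re at_top)" by simp
  have 2: "kern \<alpha> w = (\<lambda>x. exp (- w) * exp (of_real (1 / \<alpha>) * x) / (exp (- w) * exp (of_real (1 / \<alpha>) * x) + 1) *
       (1 / (1 + exp (of_real 1 * x))))"
  proof
    fix x
    have "kern \<alpha> w x = 1 / (1 + exp (w - x / of_real \<alpha>)) * (1 / (1 + exp x))"
      by (simp add: kern_def)
    then show "kern \<alpha> w x = exp (- w) * exp (of_real (1 / \<alpha>) * x) / (exp (- w) * exp (of_real (1 / \<alpha>) * x) + 1) *
       (1 / (1 + exp (of_real 1 * x)))"
      unfolding inverse_one_plus_exp[of "w - x / of_real \<alpha>"] by (simp flip: exp_add)
  qed
  have "(kern \<alpha> w \<longlongrightarrow> exp (- w) * 0 / (exp (- w) * 0 + 1) * (1 / (1 + 0))) (filtercomap Re at_bot)"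
    unfolding 2 by (intro tendsto_intros exp_tendsto_0_Re_at_bot \<alpha>) auto
  then show "(kern \<alpha> w \<longlongrightarrow> 0) (filtercomap Re at_bot)" by simp
qed

definition line_F :: "real \<Rightarrow> real \<Rightarrow> complex \<Rightarrow> complex" where
  "line_F \<alpha> \<theta> w = (line_integral (kern \<alpha> w) \<theta>)"

lemma stable_F_eq_line_F: "stable_F \<alpha> w = line_F \<alpha> 0 w"
  by (simp add: stable_F_def line_F_def kern_def)

text \<open>
  A rate admissible in \<open>norm_kern_le\<close> for every \<open>\<alpha>\<close>.
\<close>

definition decay :: "real \<Rightarrow> real" where
  "decay \<alpha> = min 1 \<alpha> / 2"

lemma decay: "0 < decay \<alpha>" "decay \<alpha> \<le> 1" "2 * decay \<alpha> \<le> \<alpha>" if "\<alpha> > 0"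
  using that by (auto simp: decay_def)

lemma norm_kern_line_le:
  assumes "\<alpha> > 0" "\<eta> < pi" "\<bar>\<theta>\<bar> \<le> \<eta>" "\<bar>Im w - \<theta> / \<alpha>\<bar> \<le> \<eta>"
  shows "norm (kern \<alpha> w (of_real x + \<i> * of_real \<theta>)) \<le>
    exp (- decay \<alpha> * Re w) / cos (\<eta> / 2) ^ 2 * (1 / cosh (decay \<alpha> / \<alpha> * x))"
  using norm_kern_le[of \<alpha> "decay \<alpha>" \<eta> "of_real x + \<i> * of_real \<theta>" w] decay[of \<alpha>] assms by simp

lemma measurable_kern_line [measurable]:
  "(\<lambda>x. kern \<alpha> w (of_real x + \<i> * of_real \<theta>)) \<in> borel_measurable lborel"
  unfolding kern_def by (simp, measurable)

lemma integrable_kern_line: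
  assumes "\<alpha> > 0" "\<bar>\<theta>\<bar> < pi" "\<bar>Im w - \<theta> / \<alpha>\<bar> < pi"
  shows "line_integrable (kern \<alpha> w) \<theta>"
proof (rule Bochner_Integration.integrable_bound)
  define \<eta> where "\<eta> = max \<bar>\<theta>\<bar> \<bar>Im w - \<theta> / \<alpha>\<bar>"
  show "integrable lborel (\<lambda>x. exp (- decay \<alpha> * Re w) / cos (\<eta> / 2) ^ 2 * (1 / cosh (decay \<alpha> / \<alpha> * x)))"
    using assms decay by (intro integrable_mult_right sech_integral) auto
  show "AE x in lborel. norm (kern \<alpha> w (of_real x + \<i> * of_real \<theta>)) \<le>
      norm (exp (- decay \<alpha> * Re w) / cos (\<eta> / 2) ^ 2 * (1 / cosh (decay \<alpha> / \<alpha> * x)))"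
    using assms unfolding real_norm_def
    by (intro AE_I2 order_trans[OF norm_kern_line_le abs_ge_self]) (auto simp: \<eta>_def)
qed measurable

lemma norm_line_F_le:
  assumes "\<alpha> > 0" "\<eta> < pi" "\<bar>\<theta>\<bar> \<le> \<eta>" "\<bar>Im w - \<theta> / \<alpha>\<bar> \<le> \<eta>"
  shows "norm (line_F \<alpha> \<theta> w) \<le> pi * \<alpha> / (decay \<alpha> * cos (\<eta> / 2) ^ 2) * exp (- decay \<alpha> * Re w)"
proof -
  have d: "decay \<alpha> / \<alpha> > 0" using assms decay by simp
  have "norm (line_F \<alpha> \<theta> w) \<le> (LINT x|lborel. norm (kern \<alpha> w (of_real x + \<i> * of_real \<theta>)))"
    unfolding line_F_def by (rule integral_norm_bound)
  also have "\<dots> \<le> (LINT x|lborel. exp (- decay \<alpha> * Re w) / cos (\<eta> / 2) ^ 2 * (1 / cosh (decay \<alpha> / \<alpha> * x)))"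
    using assms
    by (intro integral_mono integrable_norm integrable_kern_line norm_kern_line_le integrable_mult_right sech_integral d) auto
  also have "\<dots> = exp (- decay \<alpha> * Re w) / cos (\<eta> / 2) ^ 2 * (pi / (decay \<alpha> / \<alpha>))"
    by (simp only: Bochner_Integration.integral_mult_right_zero sech_integral(2)[OF d])
  finally show ?thesis by (simp add: field_simps)
qed

lemma line_F_holomorphic:
  assumes "\<alpha> > 0" "\<bar>\<theta>\<bar> < pi"
  shows "line_F \<alpha> \<theta> holomorphic_on {w. \<bar>Im w - \<theta> / \<alpha>\<bar> < pi}"
  unfolding line_F_def
proof (rule holomorphic_on_LINT)
  show "open {w. \<bar>Im w - \<theta> / \<alpha>\<bar> < pi}"
    by (intro open_Collect_less continuous_intros)
  show "(\<lambda>w. kern \<alpha> w (of_real x + \<i> * of_real \<theta>)) holomorphic_on {w. \<bar>Im w - \<theta> / \<alpha>\<bar> < pi}" for x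
    by (rule kern_holomorphic_in_parameter) (use assms in auto)
  fix w assume w: "w \<in> {w. \<bar>Im w - \<theta> / \<alpha>\<bar> < pi}"
  define r where "r = (pi - \<bar>Im w - \<theta> / \<alpha>\<bar>) / 2"
  define \<eta> where "\<eta> = max \<bar>\<theta>\<bar> (\<bar>Im w - \<theta> / \<alpha>\<bar> + r)"
  have \<eta>: "\<eta> < pi" using w assms by (auto simp: \<eta>_def r_def field_simps)
  have Im: "\<bar>Im v - \<theta> / \<alpha>\<bar> \<le> \<eta>" "Re v \<ge> Re w - r" if "v \<in> cball w r" for v
  proof -
    have "\<bar>Im w - Im v\<bar> \<le> r" "\<bar>Re w - Re v\<bar> \<le> r"
      using that abs_Im_le_cmod[of "w - v"] abs_Re_le_cmod[of "w - v"] by (auto simp: dist_norm)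
    then show "\<bar>Im v - \<theta> / \<alpha>\<bar> \<le> \<eta>" "Re v \<ge> Re w - r" by (auto simp: \<eta>_def)
  qed
  define B where "B = (\<lambda>x. exp (- decay \<alpha> * (Re w - r)) / cos (\<eta> / 2) ^ 2 * (1 / cosh (decay \<alpha> / \<alpha> * x)))"
  have "integrable lborel B"
    unfolding B_def using assms decay by (intro integrable_mult_right sech_integral) auto
  moreover have "r > 0" using w by (auto simp: r_def)
  moreover have "cball w r \<subseteq> {w. \<bar>Im w - \<theta> / \<alpha>\<bar> < pi}"
    using Im(1) \<eta> by force
  moreover have "norm (kern \<alpha> v (of_real x + \<i> * of_real \<theta>)) \<le> B x" if "v \<in> cball w r" for v x
  proof -
    have "norm (kern \<alpha> v (of_real x + \<i> * of_real \<theta>)) \<le>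
        exp (- decay \<alpha> * Re v) / cos (\<eta> / 2) ^ 2 * (1 / cosh (decay \<alpha> / \<alpha> * x))"
      by (rule norm_kern_line_le) (use assms Im[OF that] \<eta> in \<open>auto simp: \<eta>_def\<close>)
    also have "\<dots> \<le> B x"
      unfolding B_def using Im(2)[OF that] decay[of \<alpha>] assms
      by (intro mult_right_mono divide_right_mono) auto
    finally show ?thesis .
  qed
  ultimately show "\<exists>r>0. \<exists>B. cball w r \<subseteq> {w. \<bar>Im w - \<theta> / \<alpha>\<bar> < pi} \<and> integrable lborel B \<and>
      (\<forall>x. \<forall>v\<in>cball w r. norm (kern \<alpha> v (of_real x + \<i> * of_real \<theta>)) \<le> B x)"
    by blast
qed measurable

text \<open>
  The heights \<open>\<theta>\<close> with \<open>|\<theta>| < \<pi>\<close> and \<open>|Im w - \<theta>/\<alpha>| < \<pi>\<close> form an interval, and the kernel has no pole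
  in the corresponding strip of the \<open>x\<close>-plane.
\<close>

lemma line_F_shift:
  assumes "\<alpha> > 0" "\<bar>\<theta>\<^sub>1\<bar> < pi" "\<bar>Im w - \<theta>\<^sub>1 / \<alpha>\<bar> < pi" "\<bar>\<theta>\<^sub>2\<bar> < pi" "\<bar>Im w - \<theta>\<^sub>2 / \<alpha>\<bar> < pi"
  shows "line_F \<alpha> \<theta>\<^sub>1 w = line_F \<alpha> \<theta>\<^sub>2 w"
proof -
  define lo where "lo = max (- pi) (\<alpha> * (Im w - pi))"
  define hi where "hi = min pi (\<alpha> * (Im w + pi))"
  have mem: "lo < t \<and> t < hi \<longleftrightarrow> \<bar>t\<bar> < pi \<and> \<bar>Im w - t / \<alpha>\<bar> < pi" for t
    using \<open>\<alpha> > 0\<close> by (auto simp: lo_def hi_def abs_less_iff field_simps)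
  show ?thesis
    unfolding line_F_def
  proof (rule LINT_shift_contour[where lo = lo and hi = hi])
    show "kern \<alpha> w holomorphic_on {z. lo < Im z \<and> Im z < hi}"
      by (rule kern_holomorphic) (use \<open>\<alpha> > 0\<close> in \<open>auto simp: mem\<close>)
  qed (use assms mem[of \<theta>\<^sub>1] mem[of \<theta>\<^sub>2] in \<open>auto intro!: integrable_kern_line kern_tendsto_0\<close>)
qed

section \<open>Continuation of F to a strip wider than its period\<close>

definition F_strip :: "real \<Rightarrow> complex set" where
  "F_strip \<alpha> = {w. \<bar>Im w\<bar> < pi + pi / \<alpha>}"

lemma F_strip: "open (F_strip \<alpha>)" "convex (F_strip \<alpha>)" "connected (F_strip \<alpha>)"
proof -
  have "F_strip \<alpha> = {w. Im w > - (pi + pi / \<alpha>)} \<inter> {w. Im w < pi + pi / \<alpha>}"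
    by (auto simp: F_strip_def)
  then show "open (F_strip \<alpha>)" "convex (F_strip \<alpha>)"
    by (auto intro!: open_Int convex_Int open_halfspace_Im_lt open_halfspace_Im_gt
        convex_halfspace_Im_lt convex_halfspace_Im_gt simp del: minus_add_distrib)
  then show "connected (F_strip \<alpha>)" by (simp add: convex_connected)
qed

text \<open>
  The height is chosen such that \<open>\<theta>\<close> and \<open>Im w - \<theta>/\<alpha>\<close> coincide. Both conditions \<open>|\<theta>| < \<pi>\<close> and
  \<open>|Im w - \<theta>/\<alpha>| < \<pi>\<close> then become \<open>|Im w| < \<pi> + \<pi>/\<alpha>\<close>.
\<close>

definition F_ext :: "real \<Rightarrow> complex \<Rightarrow> complex" where
  "F_ext \<alpha> w = line_F \<alpha> (\<alpha> * Im w / (1 + \<alpha>)) w"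

lemma F_ext_line:
  assumes "\<alpha> > 0"
  shows "Im w - \<alpha> * Im w / (1 + \<alpha>) / \<alpha> = \<alpha> * Im w / (1 + \<alpha>)"
    and "\<bar>Im w\<bar> \<le> h \<Longrightarrow> \<bar>\<alpha> * Im w / (1 + \<alpha>)\<bar> \<le> \<alpha> * h / (1 + \<alpha>)"
    and "h < pi + pi / \<alpha> \<Longrightarrow> \<alpha> * h / (1 + \<alpha>) < pi"
    and "w \<in> F_strip \<alpha> \<Longrightarrow> \<bar>\<alpha> * Im w / (1 + \<alpha>)\<bar> < pi"
proof -
  have "1 + \<alpha> \<noteq> 0" using assms by simp
  then have "Im w - Im w / (1 + \<alpha>) = \<alpha> * Im w / (1 + \<alpha>)"
    by (simp add: field_simps)
  then show "Im w - \<alpha> * Im w / (1 + \<alpha>) / \<alpha> = \<alpha> * Im w / (1 + \<alpha>)"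
    using assms by simp
  show *: "\<bar>Im w\<bar> \<le> h \<Longrightarrow> \<bar>\<alpha> * Im w / (1 + \<alpha>)\<bar> \<le> \<alpha> * h / (1 + \<alpha>)" for h
    using assms by (auto simp: abs_mult intro!: divide_right_mono mult_left_mono)
  show **: "h < pi + pi / \<alpha> \<Longrightarrow> \<alpha> * h / (1 + \<alpha>) < pi" for h
    using assms by (simp add: field_simps)
  show "w \<in> F_strip \<alpha> \<Longrightarrow> \<bar>\<alpha> * Im w / (1 + \<alpha>)\<bar> < pi"
    using *[of "\<bar>Im w\<bar>"] **[of "\<bar>Im w\<bar>"] by (simp add: F_strip_def)
qed

lemma F_ext_eq_line_F:
  assumes "\<alpha> > 0" "w \<in> F_strip \<alpha>" "\<bar>\<theta>\<bar> < pi" "\<bar>Im w - \<theta> / \<alpha>\<bar> < pi"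
  shows "F_ext \<alpha> w = line_F \<alpha> \<theta> w"
  unfolding F_ext_def
  by (rule line_F_shift) (use assms F_ext_line(4)[of \<alpha> w] in \<open>simp_all only: F_ext_line(1)\<close>)

lemma stable_F_eq_F_ext:
  assumes "\<alpha> > 0" "\<bar>Im w\<bar> < pi"
  shows "stable_F \<alpha> w = F_ext \<alpha> w"
proof -
  have "pi / \<alpha> > 0" using assms by simp
  then have "w \<in> F_strip \<alpha>" using assms unfolding F_strip_def mem_Collect_eq by linarith
  then show ?thesis
    unfolding stable_F_eq_line_F using assms F_ext_eq_line_F[of \<alpha> w 0] by simp
qed

text \<open>
  The height of the line in \<open>F_ext\<close> depends on \<open>w\<close>, so that the formula is not visibly holomorphic.
  Near a given point, however, the height may be frozen.
\<close>

lemma F_ext_holomorphic: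
  assumes "\<alpha> > 0"
  shows "F_ext \<alpha> holomorphic_on F_strip \<alpha>"
proof -
  have "F_ext \<alpha> analytic_on {w}" if w: "w \<in> F_strip \<alpha>" for w
  proof -
    define \<theta> where "\<theta> = \<alpha> * Im w / (1 + \<alpha>)"
    define U where "U = {v. \<bar>Im v - \<theta> / \<alpha>\<bar> < pi} \<inter> F_strip \<alpha>"
    have \<theta>: "\<bar>\<theta>\<bar> < pi" "\<bar>Im w - \<theta> / \<alpha>\<bar> < pi"
      using F_ext_line[OF assms] w unfolding \<theta>_def by auto
    have "open U"
      unfolding U_def by (intro open_Int F_strip open_Collect_less continuous_intros)
    moreover have "line_F \<alpha> \<theta> holomorphic_on U"
      by (rule holomorphic_on_subset[OF line_F_holomorphic]) (use assms \<theta> in \<open>auto simp: U_def\<close>)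
    then have "F_ext \<alpha> holomorphic_on U"
      by (rule holomorphic_transform) (use F_ext_eq_line_F[OF assms _ \<theta>(1)] in \<open>auto simp: U_def\<close>)
    moreover have "w \<in> U" using w \<theta> by (auto simp: U_def)
    ultimately show ?thesis
      using analytic_at by blast
  qed
  then show ?thesis
    using analytic_imp_holomorphic analytic_on_analytic_at by blast
qed

lemma norm_F_ext_le:
  assumes "\<alpha> > 0" "h < pi + pi / \<alpha>"
  obtains C where "C > 0" "\<And>w. \<bar>Im w\<bar> \<le> h \<Longrightarrow> norm (F_ext \<alpha> w) \<le> C * exp (- decay \<alpha> * Re w)"
proof (cases "h \<ge> 0")
  case True
  define \<eta> where "\<eta> = \<alpha> * h / (1 + \<alpha>)"
  have \<eta>: "0 \<le> \<eta>" "\<eta> < pi"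
    using F_ext_line(3)[OF assms] True assms by (auto simp: \<eta>_def)
  show ?thesis
  proof
    have "cos (\<eta> / 2) > 0" using \<eta> by (intro cos_gt_zero_pi) auto
    then show "pi * \<alpha> / (decay \<alpha> * cos (\<eta> / 2) ^ 2) > 0"
      using assms decay by (intro divide_pos_pos mult_pos_pos) auto
    fix w assume "\<bar>Im w\<bar> \<le> h"
    then show "norm (F_ext \<alpha> w) \<le> pi * \<alpha> / (decay \<alpha> * cos (\<eta> / 2) ^ 2) * exp (- decay \<alpha> * Re w)"
      unfolding F_ext_def using F_ext_line[OF assms(1)] assms \<eta>
      by (intro norm_line_F_le) (auto simp: \<eta>_def)
  qed
next
  case False
  show ?thesis by (rule that[of 1]) (use False in auto)
qed

lemma holomorphic_eqI_real:
  assumes "f holomorphic_on S" "g holomorphic_on S" "open S" "connected S"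
    and "\<And>r::real. of_real r \<in> S" "\<And>r::real. f (of_real r) = g (of_real r)" "w \<in> S"
  shows "f w = g w"
proof -
  have "f w - g w = 0"
  proof (rule analytic_continuation[where f = "\<lambda>w. f w - g w" and S = S and U = "range complex_of_real" and \<xi> = 0])
    show "0 islimpt range complex_of_real"
      unfolding islimpt_approachable
    proof safe
      fix e :: real assume "e > 0"
      then show "\<exists>x'\<in>range complex_of_real. x' \<noteq> 0 \<and> dist x' 0 < e"
        by (intro bexI[OF _ rangeI[of complex_of_real "e / 2"]]) auto
    qed
  qed (use assms assms(5)[of 0] in \<open>auto intro!: holomorphic_intros\<close>)
  then show ?thesis by simp
qed

text \<open>
  For real \<open>w\<close> the substitution \<open>x = \<alpha> w - \<alpha> y\<close> exchanges the two factors of the kernel. The general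
  case follows by analytic continuation.
\<close>

lemma F_ext_reciprocal:
  assumes "\<alpha> > 0" "w \<in> F_strip \<alpha>"
  shows "F_ext \<alpha> w = of_real \<alpha> * F_ext (1 / \<alpha>) (of_real \<alpha> * w)"
proof (rule holomorphic_eqI_real[where S = "F_strip \<alpha>" and g = "\<lambda>w. of_real \<alpha> * F_ext (1 / \<alpha>) (of_real \<alpha> * w)"])
  have "pi / \<alpha> > 0" using assms by simp
  then have "pi + pi / \<alpha> > 0" by (intro add_pos_pos) auto
  then show "of_real r \<in> F_strip \<alpha>" for r by (simp add: F_strip_def)
  have "(\<lambda>w. of_real \<alpha> * w) ` F_strip \<alpha> \<subseteq> F_strip (1 / \<alpha>)"
    using assms by (auto simp: F_strip_def abs_mult field_simps)
  then show "(\<lambda>w. of_real \<alpha> * F_ext (1 / \<alpha>) (of_real \<alpha> * w)) holomorphic_on F_strip \<alpha>"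
    using holomorphic_on_compose_gen[of "\<lambda>w. of_real \<alpha> * w" "F_strip \<alpha>" "F_ext (1 / \<alpha>)" "F_strip (1 / \<alpha>)"]
      F_ext_holomorphic[of "1 / \<alpha>"] assms
    by (intro holomorphic_intros) (auto simp: o_def intro!: holomorphic_intros)
  show "F_ext \<alpha> (of_real r) = of_real \<alpha> * F_ext (1 / \<alpha>) (of_real \<alpha> * of_real r)" for r
  proof -
    have "stable_F \<alpha> (of_real r) = (LINT x|lborel. kern \<alpha> (of_real r) (of_real x))"
      by (simp add: stable_F_eq_line_F line_F_def)
    also have "\<dots> = \<bar>- \<alpha>\<bar> *\<^sub>R (LINT y|lborel. kern \<alpha> (of_real r) (of_real (\<alpha> * r + (- \<alpha>) * y)))"
      by (rule lborel_integral_real_affine) (use assms in auto)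
    also have "(\<lambda>y. kern \<alpha> (of_real r) (of_real (\<alpha> * r + (- \<alpha>) * y))) = (\<lambda>y. kern (1 / \<alpha>) (of_real (\<alpha> * r)) (of_real y))"
      using assms by (auto simp: kern_def field_simps fun_eq_iff)
    also have "\<bar>- \<alpha>\<bar> *\<^sub>R (LINT y|lborel. kern (1 / \<alpha>) (of_real (\<alpha> * r)) (of_real y)) = of_real \<alpha> * stable_F (1 / \<alpha>) (of_real (\<alpha> * r))"
      using assms by (simp add: stable_F_eq_line_F line_F_def scaleR_conv_of_real)
    finally show ?thesis
      using assms by (simp add: stable_F_eq_F_ext)
  qed
qed (use assms F_ext_holomorphic F_strip in auto)

lemma sinh_nonzero_in_strip:
  fixes z :: complex
  assumes "\<bar>Im z\<bar> < pi" "z \<noteq> 0"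
  shows "sinh z \<noteq> 0"
proof
  assume "sinh z = 0"
  then have "exp z = exp (- z)"
    by (simp add: sinh_field_def)
  then obtain n :: int where "z = - z + (of_int (2 * n) * pi) * \<i>"
    using exp_eq by blast
  then have "2 * Re z = 0" "2 * Im z = 2 * (of_int n * pi)"
    by (simp_all add: complex_eq_iff)
  moreover from this have "\<bar>of_int n * pi\<bar> < 1 * pi" using assms by simp
  then have "\<bar>of_int n :: real\<bar> < 1"
    by (simp add: abs_mult)
  then have "n = 0" by linarith
  ultimately show False using assms by (simp add: complex_eq_iff)
qed

lemma inverse_sinh_tendsto_0:
  assumes "(\<beta>::real) > 0"
  shows "((\<lambda>x. 1 / sinh (of_real \<beta> * (x - c))) \<longlongrightarrow> (0::complex)) (filtercomap Re at_top)"
    and "((\<lambda>x. 1 / sinh (of_real \<beta> * (x - c))) \<longlongrightarrow> (0::complex)) (filtercomap Re at_bot)"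
proof -
  let ?l = "\<lambda>x::complex. exp (of_real \<beta> * c) * exp (- (of_real \<beta> * x))"
    and ?r = "\<lambda>x::complex. exp (- (of_real \<beta> * c)) * exp (of_real \<beta> * x)"
  let ?la = "exp (of_real \<beta> * c) * 0" and ?ra = "exp (- (of_real \<beta> * c)) * 0"
  have alg: "1 / sinh z = 2 * exp (- z) / (1 - exp (- z) * exp (- z))"
    "1 / sinh z = - (2 * exp z / (1 - exp z * exp z))" for z :: complex
  proof -
    have 1: "2 * sinh z = exp z - exp (- z)" by (simp add: sinh_field_def)
    have "1 - exp (- z) * exp (- z) = exp (- z) * (2 * sinh z)"
      unfolding 1 by (simp add: right_diff_distrib flip: exp_add)
    then show "1 / sinh z = 2 * exp (- z) / (1 - exp (- z) * exp (- z))"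
      by (simp only:) simp
    have "1 - exp z * exp z = - (exp z * (2 * sinh z))"
      unfolding 1 by (simp add: right_diff_distrib flip: exp_add)
    then show "1 / sinh z = - (2 * exp z / (1 - exp z * exp z))"
      by (simp only:) simp
  qed
  have 1: "(\<lambda>x. 1 / sinh (of_real \<beta> * (x - c))) = (\<lambda>x. 2 * ?l x / (1 - ?l x * ?l x))"
    unfolding alg(1) by (simp add: algebra_simps flip: exp_add)
  have 2: "(\<lambda>x. 1 / sinh (of_real \<beta> * (x - c))) = (\<lambda>x. - (2 * ?r x / (1 - ?r x * ?r x)))"
    unfolding alg(2) by (simp add: algebra_simps flip: exp_add)
  have "((\<lambda>x. 1 / sinh (of_real \<beta> * (x - c))) \<longlongrightarrow> 2 * ?la / (1 - ?la * ?la)) (filtercomap Re at_top)"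
    unfolding 1 by (intro tendsto_intros exp_tendsto_0_Re_at_top assms) auto
  then show "((\<lambda>x. 1 / sinh (of_real \<beta> * (x - c))) \<longlongrightarrow> (0::complex)) (filtercomap Re at_top)" by simp
  have "((\<lambda>x. 1 / sinh (of_real \<beta> * (x - c))) \<longlongrightarrow> - (2 * ?ra / (1 - ?ra * ?ra))) (filtercomap Re at_bot)"
    unfolding 2 by (intro tendsto_intros exp_tendsto_0_Re_at_bot assms) auto
  then show "((\<lambda>x. 1 / sinh (of_real \<beta> * (x - c))) \<longlongrightarrow> (0::complex)) (filtercomap Re at_bot)" by simp
qed

section \<open>The jump of F across its period\<close>

text \<open>
  The residue theorem for two infinite lines. A multiple of \<open>1 / sinh (\<beta> (z - x0))\<close> removes the pole, and
  the integral of the regular remainder does not change between the lines. With \<open>\<beta> = \<pi> / (2 \<theta>)\<close> the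
  comparison function equals \<open>\<mp>\<i> / cosh (\<beta> (x - x0))\<close> on the two lines, so that its contribution is
  known.
\<close>

lemma LINT_jump_across_pole:
  fixes g :: "complex \<Rightarrow> complex" and x0 \<theta> :: real
  assumes "\<theta> > 0"
    and hol: "g holomorphic_on {z. \<bar>Im z\<bar> < 2 * \<theta>} - {of_real x0}"
    and res: "((\<lambda>z. (z - of_real x0) * g z) \<longlongrightarrow> c) (at (of_real x0))"
    and int: "line_integrable g \<theta>"
      "line_integrable g (- \<theta>)"
    and lim: "(g \<longlongrightarrow> 0) (filtercomap Re at_top)" "(g \<longlongrightarrow> 0) (filtercomap Re at_bot)"
  shows "line_integral g \<theta> - line_integral g (- \<theta>) = - 2 * pi * \<i> * c"
proof -
  define \<beta> where "\<beta> = pi / (2 * \<theta>)"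
  have \<beta>: "\<beta> > 0" using \<open>\<theta> > 0\<close> by (simp add: \<beta>_def)
  define U where "U = {z. \<bar>Im z\<bar> < 2 * \<theta>}"
  define s where "s = (\<lambda>z. 1 / sinh (of_real \<beta> * (z - of_real x0)) :: complex)"
  define d where "d = (\<lambda>z. g z - c * of_real \<beta> * s z)"
  have U: "open U" "of_real x0 \<in> interior U"
  proof -
    show "open U"
      unfolding U_def by (intro open_Collect_less continuous_intros)
    then show "of_real x0 \<in> interior U"
      using \<open>\<theta> > 0\<close> by (simp add: interior_open) (simp add: U_def)
  qed
  have s_nz: "sinh (of_real \<beta> * (z - of_real x0)) \<noteq> 0" if "z \<in> U - {of_real x0}" for z
  proof (rule sinh_nonzero_in_strip)
    show "\<bar>Im (of_real \<beta> * (z - of_real x0))\<bar> < pi"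
      using that \<open>\<theta> > 0\<close> by (auto simp: \<beta>_def U_def abs_mult field_simps)
  qed (use that \<beta> in auto)
  have d_hol: "d holomorphic_on U - {of_real x0}"
    unfolding d_def s_def using hol s_nz unfolding sinh_field_def
    by (intro holomorphic_intros) (auto simp: U_def)
  have s_res: "((\<lambda>z. (z - of_real x0) * s z) \<longlongrightarrow> 1 / of_real \<beta>) (at (of_real x0))"
  proof -
    have "((\<lambda>z. sinh (of_real \<beta> * (z - of_real x0))) has_field_derivative of_real \<beta> * cosh 0) (at (of_real x0 :: complex))"
      by (auto intro!: derivative_eq_intros)
    then have "((\<lambda>z. sinh (of_real \<beta> * (z - of_real x0)) / (z - of_real x0)) \<longlongrightarrow> of_real \<beta>) (at (of_real x0 :: complex))"
      by (simp add: has_field_derivative_iff)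
    from tendsto_divide[OF tendsto_const[of 1] this] \<beta>
    show ?thesis by (simp add: s_def)
  qed
  have d_res: "((\<lambda>z. (z - of_real x0) * d z) \<longlongrightarrow> c - c * of_real \<beta> * (1 / of_real \<beta>)) (at (of_real x0))"
  proof -
    have "(\<lambda>z. (z - of_real x0) * d z) = (\<lambda>z. (z - of_real x0) * g z - c * of_real \<beta> * ((z - of_real x0) * s z))"
      by (simp add: d_def algebra_simps)
    then show ?thesis by (simp only:) (intro tendsto_intros res s_res)
  qed
  then have "((\<lambda>z. (z - of_real x0) * d z) \<longlongrightarrow> 0) (at (of_real x0))"
    using \<beta> by simp
  with d_hol U obtain h0 where h0: "h0 holomorphic_on U" "\<And>z. z \<in> U - {of_real x0} \<Longrightarrow> h0 z = d z"
    using holomorphic_on_extend_lim[of d U "of_real x0"] by blast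
  \<comment> \<open>Unlike \<open>h0\<close>, which is unspecified outside the strip, \<open>h\<close> inherits the decay of \<open>d\<close>.\<close>
  define h where "h = (\<lambda>z. if z = of_real x0 then h0 z else d z)"
  have h_hol: "h holomorphic_on U"
    by (rule holomorphic_transform[OF h0(1)]) (use h0(2) in \<open>auto simp: h_def\<close>)
  have h_line: "h (of_real x + \<i> * of_real t) = g (of_real x + \<i> * of_real t) - c * of_real \<beta> * s (of_real x + \<i> * of_real t)"
    if "t \<noteq> 0" for x t
    using that by (auto simp: h_def d_def complex_eq_iff)
  have s_top: "s (of_real x + \<i> * of_real \<theta>) = - \<i> * of_real (1 / cosh (- (\<beta> * x0) + \<beta> * x))"
    and s_bot: "s (of_real x + \<i> * of_real (- \<theta>)) = \<i> * of_real (1 / cosh (- (\<beta> * x0) + \<beta> * x))" for x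
  proof -
    have "\<beta> * \<theta> = pi / 2"
      using \<open>\<theta> > 0\<close> by (simp add: \<beta>_def)
    then have half: "of_real \<beta> * of_real \<theta> = (of_real (pi / 2) :: complex)"
      by (simp only: of_real_mult[symmetric])
    have e1: "of_real \<beta> * (of_real x + \<i> * of_real \<theta> - of_real x0) = of_real (- (\<beta> * x0) + \<beta> * x) + \<i> * of_real (pi / 2)"
      unfolding half[symmetric] by (simp add: algebra_simps)
    have e2: "of_real \<beta> * (of_real x + \<i> * of_real (- \<theta>) - of_real x0) = of_real (- (\<beta> * x0) + \<beta> * x) - \<i> * of_real (pi / 2)"
      unfolding half[symmetric] by (simp add: algebra_simps)
    have sh: "sinh (y + \<i> * of_real (pi / 2)) = \<i> * cosh y" "sinh (y - \<i> * of_real (pi / 2)) = - (\<i> * cosh y)" for y :: complex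
    proof -
      define q where "q = \<i> * complex_of_real (pi / 2)"
      have q: "exp q = \<i>" "exp (- q) = - \<i>"
        by (simp_all add: q_def exp_Euler exp_minus_Euler cos_of_real sin_of_real flip: of_real_divide)
      have "exp (y + q) = exp y * \<i>" "exp (- (y + q)) = exp (- y) * (- \<i>)"
        "exp (y - q) = exp y * (- \<i>)" "exp (- (y - q)) = \<i> * exp (- y)"
        by (simp_all only: minus_add_distrib minus_diff_eq diff_conv_add_uminus minus_minus exp_add q mult.commute)
      then show "sinh (y + \<i> * of_real (pi / 2)) = \<i> * cosh y" "sinh (y - \<i> * of_real (pi / 2)) = - (\<i> * cosh y)"
        unfolding q_def[symmetric] sinh_field_def cosh_field_def by (simp_all only:) (simp_all add: field_simps)
    qed
    have co: "cosh (of_real y) = (of_real (cosh y) :: complex)" for y :: real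
      by (simp add: cosh_field_def flip: exp_of_real)
    show "s (of_real x + \<i> * of_real \<theta>) = - \<i> * of_real (1 / cosh (- (\<beta> * x0) + \<beta> * x))"
      unfolding s_def e1 sh co by (simp add: divide_simps)
    show "s (of_real x + \<i> * of_real (- \<theta>)) = \<i> * of_real (1 / cosh (- (\<beta> * x0) + \<beta> * x))"
      unfolding s_def e2 sh co by (simp add: divide_simps)
  qed
  have sech: "integrable lborel (\<lambda>x. 1 / cosh (- (\<beta> * x0) + \<beta> * x))"
    "(LINT x|lborel. 1 / cosh (- (\<beta> * x0) + \<beta> * x)) = pi / \<beta>"
  proof -
    have 1: "integrable lborel (\<lambda>x::real. 1 / cosh x)" "(LINT x|lborel. 1 / cosh (x::real)) = pi"
      using sech_integral[of 1] by simp_all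
    show "integrable lborel (\<lambda>x. 1 / cosh (- (\<beta> * x0) + \<beta> * x))"
      by (rule lborel_integrable_real_affine[OF 1(1)]) (use \<beta> in auto)
    show "(LINT x|lborel. 1 / cosh (- (\<beta> * x0) + \<beta> * x)) = pi / \<beta>"
      using lborel_integral_real_affine[of \<beta> "\<lambda>x::real. 1 / cosh x" "- (\<beta> * x0)"] \<beta> 1(2) by (simp add: field_simps)
  qed
  have s_int: "line_integrable s \<theta>" "line_integrable s (- \<theta>)"
    unfolding s_top s_bot by (intro integrable_mult_right integrable_of_real sech)+
  have s_val: "line_integral s \<theta> = - \<i> * of_real (pi / \<beta>)"
    "line_integral s (- \<theta>) = \<i> * of_real (pi / \<beta>)"
    unfolding s_top s_bot by (simp_all only: Bochner_Integration.integral_mult_right_zero integral_of_real sech)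
  have shift: "line_integral h \<theta> = line_integral h (- \<theta>)"
  proof (rule LINT_shift_contour[where lo = "- 2 * \<theta>" and hi = "2 * \<theta>"])
    show "h holomorphic_on {z. - 2 * \<theta> < Im z \<and> Im z < 2 * \<theta>}"
      by (rule holomorphic_on_subset[OF h_hol]) (auto simp: U_def abs_less_iff)
    show "line_integrable h \<theta>"
      using \<open>\<theta> > 0\<close> by (subst h_line) (auto intro!: Bochner_Integration.integrable_diff int integrable_mult_right s_int)
    show "line_integrable h (- \<theta>)"
      using \<open>\<theta> > 0\<close> int(2) s_int(2) by (subst h_line) (auto intro!: Bochner_Integration.integrable_diff integrable_mult_right)
    have d_lim: "(d \<longlongrightarrow> 0 - c * of_real \<beta> * 0) (filtercomap Re at_top)" "(d \<longlongrightarrow> 0 - c * of_real \<beta> * 0) (filtercomap Re at_bot)"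
      unfolding d_def s_def by (intro tendsto_intros lim inverse_sinh_tendsto_0 \<beta>)+
    show "(h \<longlongrightarrow> 0) (filtercomap Re at_top)"
    proof (rule Lim_transform_eventually)
      show "(d \<longlongrightarrow> 0) (filtercomap Re at_top)" using d_lim by simp
      show "\<forall>\<^sub>F z in filtercomap Re at_top. d z = h z"
        unfolding eventually_filtercomap_Re_at_top by (rule exI[of _ "x0 + 1"]) (auto simp: h_def)
    qed
    show "(h \<longlongrightarrow> 0) (filtercomap Re at_bot)"
    proof (rule Lim_transform_eventually)
      show "(d \<longlongrightarrow> 0) (filtercomap Re at_bot)" using d_lim by simp
      show "\<forall>\<^sub>F z in filtercomap Re at_bot. d z = h z"
        unfolding eventually_filtercomap_Re_at_bot by (rule exI[of _ "x0 - 1"]) (auto simp: h_def)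
    qed
  qed (use \<open>\<theta> > 0\<close> in auto)
  have "line_integral h t =
      line_integral g t - c * of_real \<beta> * line_integral s t"
    if "t \<noteq> 0" "line_integrable g t" "line_integrable s t" for t
    unfolding h_line[OF that(1)]
    using Bochner_Integration.integral_diff[OF that(2) integrable_mult_right[OF that(3), of "c * of_real \<beta>"]]
    by (simp only: Bochner_Integration.integral_mult_right_zero)
  from this[OF _ int(1) s_int(1)] this[OF _ int(2) s_int(2)]
  have "line_integral g \<theta> =
      line_integral h \<theta> + c * of_real \<beta> * (- \<i> * of_real (pi / \<beta>))"
    "line_integral g (- \<theta>) =
      line_integral h (- \<theta>) + c * of_real \<beta> * (\<i> * of_real (pi / \<beta>))"
    using \<open>\<theta> > 0\<close> unfolding s_val by simp_all
  then show ?thesis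
    unfolding shift using \<beta> by simp
qed

text \<open>
  The kernels for \<open>t + \<pi> \<i>\<close> and \<open>t - \<pi> \<i>\<close> are the same function, with a simple pole at \<open>x = \<alpha> t\<close>. The
  two values of \<open>F_ext\<close> are its integrals over a line above and a line below this pole.
\<close>

lemma F_ext_jump_real:
  assumes "\<alpha> > 0"
  shows "F_ext \<alpha> (of_real t + pi * \<i>) - F_ext \<alpha> (of_real t - pi * \<i>) = - 2 * pi * \<i> * (of_real \<alpha> / (1 + exp (of_real (\<alpha> * t))))"
proof -
  \<comment> \<open>The lines \<open>Im x = \<plusminus>\<theta>\<close> must be admissible for \<open>t \<plusminus> \<pi> \<i>\<close>, and the kernel may have no pole besides
    \<open>\<alpha> t\<close> for \<open>|Im x| < 2 \<theta>\<close>.\<close>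
  define \<theta> where "\<theta> = min pi (pi * \<alpha>) / 2"
  have \<theta>: "\<theta> > 0" "2 * \<theta> \<le> pi" "2 * \<theta> \<le> pi * \<alpha>"
    using assms by (auto simp: \<theta>_def)
  have \<theta>': "0 < \<theta> / \<alpha>" "\<theta> / \<alpha> < pi" "\<bar>\<theta>\<bar> < pi"
    using assms \<theta> by (auto simp: field_simps)
  define g where "g = kern \<alpha> (of_real t + pi * \<i>)"
  have per: "exp (of_real t + pi * \<i> - z) = - exp (of_real t - z)" "exp (of_real t - pi * \<i> - z) = - exp (of_real t - z)" for z
    by (simp_all add: exp_diff exp_add exp_minus)
  then have g_alt: "kern \<alpha> (of_real t - pi * \<i>) = g"
    by (simp add: g_def kern_def fun_eq_iff)
  have top: "F_ext \<alpha> (of_real t + pi * \<i>) = line_integral g \<theta>"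
    unfolding g_def line_F_def[symmetric] using assms \<theta>'
    by (intro F_ext_eq_line_F) (auto simp: F_strip_def)
  have bot: "F_ext \<alpha> (of_real t - pi * \<i>) = line_integral g (- \<theta>)"
    unfolding g_alt[symmetric] line_F_def[symmetric] using assms \<theta>'
    by (intro F_ext_eq_line_F) (auto simp: F_strip_def)
  show ?thesis
    unfolding top bot
  proof (rule LINT_jump_across_pole[of \<theta> g "\<alpha> * t"])
    have nz: "1 + exp (of_real t + pi * \<i> - z / of_real \<alpha>) \<noteq> 0" if "\<bar>Im z\<bar> < 2 * \<theta>" "z \<noteq> of_real (\<alpha> * t)" for z
    proof
      assume "1 + exp (of_real t + pi * \<i> - z / of_real \<alpha>) = 0"
      then have "exp (of_real t - z / of_real \<alpha>) = 1" by (simp add: per)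
      then obtain n :: int where n: "t - Re z / \<alpha> = 0" "- (Im z / \<alpha>) = of_int (2 * n) * pi"
        unfolding exp_eq_1 by auto
      have "\<bar>- (Im z / \<alpha>)\<bar> < 1 * pi"
        using that(1) \<theta>(3) assms by (simp add: field_simps)
      then have "\<bar>of_int (2 * n) * pi\<bar> < 1 * pi"
        unfolding n(2) .
      then have "\<bar>of_int (2 * n) :: real\<bar> < 1"
        by (simp add: abs_mult)
      then have "n = 0" by linarith
      then have "z = of_real (\<alpha> * t)"
        using n assms by (simp add: complex_eq_iff field_simps)
      then show False using that by simp
    qed
    show "g holomorphic_on {z. \<bar>Im z\<bar> < 2 * \<theta>} - {of_real (\<alpha> * t)}"
      unfolding g_def kern_def using assms nz one_plus_exp_nonzero \<theta>(2)
      by (intro holomorphic_intros) auto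
    have "((\<lambda>z. 1 + exp (of_real t + pi * \<i> - z / of_real \<alpha>)) has_field_derivative 1 / of_real \<alpha>) (at (of_real (\<alpha> * t)))"
      using assms by (auto intro!: derivative_eq_intros simp: per)
    then have "((\<lambda>z. (1 + exp (of_real t + pi * \<i> - z / of_real \<alpha>)) / (z - of_real (\<alpha> * t))) \<longlongrightarrow> 1 / of_real \<alpha>) (at (of_real (\<alpha> * t)))"
      using assms by (simp add: has_field_derivative_iff per)
    note quot = this
    have "((\<lambda>z. 1 / (1 + exp z)) \<longlongrightarrow> 1 / (1 + exp (of_real (\<alpha> * t)))) (at (of_real (\<alpha> * t) :: complex))"
      by (intro tendsto_intros one_plus_exp_nonzero) auto
    from tendsto_mult[OF tendsto_divide[OF tendsto_const[of 1] quot] this]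
    have "((\<lambda>z. 1 / ((1 + exp (of_real t + pi * \<i> - z / of_real \<alpha>)) / (z - of_real (\<alpha> * t))) * (1 / (1 + exp z))) \<longlongrightarrow>
       1 / (1 / of_real \<alpha>) * (1 / (1 + exp (of_real (\<alpha> * t))))) (at (of_real (\<alpha> * t)))"
      using assms by simp
    then show "((\<lambda>z. (z - of_real (\<alpha> * t)) * g z) \<longlongrightarrow> of_real \<alpha> / (1 + exp (of_real (\<alpha> * t)))) (at (of_real (\<alpha> * t)))"
      by (simp add: g_def kern_def)
    show "line_integrable g \<theta>"
      unfolding g_def using assms \<theta>' by (intro integrable_kern_line) auto
    show "line_integrable g (- \<theta>)"
      unfolding g_alt[symmetric] using assms \<theta>' by (intro integrable_kern_line) auto
    show "(g \<longlongrightarrow> 0) (filtercomap Re at_top)" "(g \<longlongrightarrow> 0) (filtercomap Re at_bot)"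
      unfolding g_def using kern_tendsto_0[OF assms] by auto
  qed (use \<theta> in auto)
qed

lemma abs_add_pi_less: "\<bar>x + pi\<bar> < pi + b" "\<bar>x - pi\<bar> < pi + b" if "\<bar>x\<bar> < b" for x b :: real
  using that pi_gt_zero by linarith+

lemma holomorphic_on_comp:
  assumes "f holomorphic_on T" "g holomorphic_on S" "\<And>z. z \<in> S \<Longrightarrow> g z \<in> T"
  shows "(\<lambda>z. f (g z)) holomorphic_on S"
  using holomorphic_on_compose_gen[of g S f T] assms by (auto simp: o_def)

lemma F_ext_jump:
  assumes "\<alpha> > 0" "\<bar>Im w\<bar> < pi / \<alpha>"
  shows "F_ext \<alpha> (w + pi * \<i>) - F_ext \<alpha> (w - pi * \<i>) = - 2 * pi * \<i> * (of_real \<alpha> / (1 + exp (of_real \<alpha> * w)))"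
proof (rule holomorphic_eqI_real[where S = "{w. \<bar>Im w\<bar> < pi / \<alpha>}"
      and f = "\<lambda>w. F_ext \<alpha> (w + pi * \<i>) - F_ext \<alpha> (w - pi * \<i>)"])
  let ?S = "{w. \<bar>Im w\<bar> < pi / \<alpha>}"
  have S_eq: "?S = {w. Im w > - (pi / \<alpha>)} \<inter> {w. Im w < pi / \<alpha>}" by auto
  show "open ?S" "connected ?S"
    unfolding S_eq by (auto intro!: open_Int convex_connected convex_Int open_halfspace_Im_lt open_halfspace_Im_gt
        convex_halfspace_Im_lt convex_halfspace_Im_gt)
  show "(\<lambda>w. F_ext \<alpha> (w + pi * \<i>) - F_ext \<alpha> (w - pi * \<i>)) holomorphic_on ?S"
    by (intro holomorphic_on_diff holomorphic_on_comp[OF F_ext_holomorphic[OF assms(1)]] holomorphic_intros)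
       (auto simp: F_strip_def intro: abs_add_pi_less)
  have "1 + exp (of_real \<alpha> * w) \<noteq> 0" if "w \<in> ?S" for w
    by (rule one_plus_exp_nonzero) (use that assms in \<open>auto simp: abs_mult field_simps\<close>)
  then show "(\<lambda>w. - 2 * pi * \<i> * (of_real \<alpha> / (1 + exp (of_real \<alpha> * w)))) holomorphic_on ?S"
    by (intro holomorphic_intros)
  show "F_ext \<alpha> (of_real r + pi * \<i>) - F_ext \<alpha> (of_real r - pi * \<i>) = - 2 * pi * \<i> * (of_real \<alpha> / (1 + exp (of_real \<alpha> * of_real r)))" for r
    using F_ext_jump_real[OF assms(1), of r] by simp
qed (use assms in auto)


section \<open>The double sine function in the strip\<close>

lemma eq_0_if_deriv_0_tendsto_0:
  fixes D :: "complex \<Rightarrow> complex"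
  assumes "convex S" "\<And>w. w \<in> S \<Longrightarrow> (D has_field_derivative 0) (at w)"
    and "\<And>w r. w \<in> S \<Longrightarrow> w + of_real r \<in> S" "w \<in> S" "((\<lambda>r. D (w + of_real r)) \<longlongrightarrow> 0) at_top"
  shows "D w = 0"
proof -
  obtain c where c: "\<And>w. w \<in> S \<Longrightarrow> D w = c"
    using has_field_derivative_zero_constant[OF assms(1), of D] assms(2) has_field_derivative_at_within by metis
  have "(\<lambda>r. D (w + of_real r)) = (\<lambda>_. c)"
    using assms(3,4) c by auto
  then have "c = 0"
    using assms(5) tendsto_const_iff[OF trivial_limit_at_top_linorder] by metis
  then show ?thesis using c assms by auto
qed

text \<open>
  A primitive exists on the strip. By the exponential bound it converges along the real axis, and its
  variation over vertical segments tends to 0, so that the limit is the same on all horizontal lines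
  and can be subtracted.
\<close>

lemma ex_primitive_vanishing_at_top:
  fixes F :: "complex \<Rightarrow> complex"
  assumes S: "S = {w. \<bar>Im w\<bar> < b}" "b > 0"
    and hol: "F holomorphic_on S" and "d > 0"
    and bound: "\<And>h. h < b \<Longrightarrow> \<exists>C>0. \<forall>w. \<bar>Im w\<bar> \<le> h \<longrightarrow> norm (F w) \<le> C * exp (- d * Re w)"
  shows "\<exists>L. (\<forall>w\<in>S. (L has_field_derivative F w) (at w)) \<and> (\<forall>w\<in>S. ((\<lambda>r. L (w + of_real r)) \<longlongrightarrow> 0) at_top)"
proof -
  have S_eq: "S = {w. Im w > - b} \<inter> {w. Im w < b}" unfolding S by auto
  have S_props: "open S" "convex S"
    unfolding S_eq by (auto intro!: open_Int convex_Int open_halfspace_Im_lt open_halfspace_Im_gt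
        convex_halfspace_Im_lt convex_halfspace_Im_gt)
  obtain G where G0: "\<And>z. z \<in> S \<Longrightarrow> (G has_field_derivative F z) (at z within S)"
    using holomorphic_convex_primitive'[OF S_props(2,1) hol] by blast
  have G: "(G has_field_derivative F z) (at z)" if "z \<in> S" for z
    using G0[OF that] at_within_open[OF that S_props(1)] by simp
  obtain C where C: "C > 0" "\<And>w. \<bar>Im w\<bar> \<le> 0 \<Longrightarrow> norm (F w) \<le> C * exp (- d * Re w)"
    using bound[OF \<open>b > 0\<close>] by blast
  have real_in_S: "of_real r \<in> S" for r using S by auto
  have step: "norm (G (of_real y) - G (of_real x)) \<le> C / d * exp (- d * x)" if "x \<le> y" for x y
  proof (cases "x = y")
    case True then show ?thesis using C \<open>d > 0\<close> by simp
  next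
    case False
    have "norm (G (of_real y) - G (of_real x)) \<le> - C / d * exp (- d * y) - (- C / d * exp (- d * x))"
    proof (rule differentiable_bound_general[where f' = "\<lambda>r. F (of_real r)" and \<phi>' = "\<lambda>r. C * exp (- d * r)"])
      show "x < y" using that False by simp
      have der: "((\<lambda>r. G (of_real r)) has_vector_derivative F (of_real r)) (at r)" for r
        using has_vector_derivative_real_field[OF G[OF real_in_S]] by simp
      then show "((\<lambda>r. G (of_real r)) has_vector_derivative F (of_real r)) (at r)" for r .
      show "continuous_on {x..y} (\<lambda>r. G (of_real r))"
        using der by (meson continuous_at_imp_continuous_on has_vector_derivative_continuous)
      show "continuous_on {x..y} (\<lambda>r. - C / d * exp (- d * r))"
        by (intro continuous_intros)
      show "((\<lambda>r. - C / d * exp (- d * r)) has_vector_derivative C * exp (- d * r)) (at r)" for r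
        unfolding has_real_derivative_iff_has_vector_derivative[symmetric]
        using \<open>d > 0\<close> by (auto intro!: derivative_eq_intros)
      show "norm (F (of_real r)) \<le> C * exp (- d * r)" for r
        using C(2)[of "of_real r"] by simp
    qed
    also have "\<dots> \<le> C / d * exp (- d * x)"
      using C \<open>d > 0\<close> by simp
    finally show ?thesis .
  qed
  have exp_lim: "((\<lambda>r. K * exp (- d * r)) \<longlongrightarrow> 0) at_top" for K
  proof -
    have "((\<lambda>r. exp (- (d * r))) \<longlongrightarrow> 0) at_top"
      using \<open>d > 0\<close> by (intro filterlim_compose[OF exp_at_bot] filterlim_compose[OF filterlim_uminus_at_bot_at_top]
          filterlim_tendsto_pos_mult_at_top[OF tendsto_const] filterlim_ident)
    from tendsto_mult_right_zero[OF this] show ?thesis by simp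
  qed
  have "Cauchy (\<lambda>n. G (of_real (real n)))"
  proof (rule metric_CauchyI)
    fix e :: real assume "e > 0"
    have "\<forall>\<^sub>F r in at_top. C / d * exp (- d * r) < e"
      using order_tendstoD(2)[OF exp_lim \<open>e > 0\<close>] .
    then obtain M where M: "\<And>r. r \<ge> M \<Longrightarrow> C / d * exp (- d * r) < e"
      by (auto simp: eventually_at_top_linorder)
    have *: "dist (G (of_real (real m))) (G (of_real (real n))) < e" if "m \<ge> nat \<lceil>M\<rceil>" "m \<le> n" for m n
    proof -
      have "dist (G (of_real (real m))) (G (of_real (real n))) \<le> C / d * exp (- d * real m)"
        using step[of "real m" "real n"] that by (simp add: dist_norm norm_minus_commute)
      also have "\<dots> < e" using that by (intro M) linarith
      finally show ?thesis .
    qed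
    show "\<exists>N. \<forall>m\<ge>N. \<forall>n\<ge>N. dist (G (of_real (real m))) (G (of_real (real n))) < e"
      using * by (metis dist_commute nle_le)
  qed
  then obtain l where l: "(\<lambda>n. G (of_real (real n))) \<longlonglongrightarrow> l"
    using Cauchy_convergent convergent_def by blast
  have near: "norm (G (of_real r) - l) \<le> C / d * exp (- d * r)" for r
  proof -
    have "\<forall>\<^sub>F n in sequentially. norm (G (of_real (real n)) - G (of_real r)) \<le> C / d * exp (- d * r)"
      using eventually_ge_at_top[of "nat \<lceil>r\<rceil>"] by eventually_elim (intro step, linarith)
    moreover have "(\<lambda>n. norm (G (of_real (real n)) - G (of_real r))) \<longlonglongrightarrow> norm (l - G (of_real r))"
      by (intro tendsto_intros l)
    ultimately have "norm (l - G (of_real r)) \<le> C / d * exp (- d * r)"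
      by (intro tendsto_upperbound[OF _ _ sequentially_bot])
    then show ?thesis by (simp add: norm_minus_commute)
  qed
  have "((\<lambda>r. G (w + of_real r) - l) \<longlongrightarrow> 0) at_top" if w: "w \<in> S" for w
  proof -
    obtain K where K: "K > 0" "\<And>v. \<bar>Im v\<bar> \<le> \<bar>Im w\<bar> \<Longrightarrow> norm (F v) \<le> K * exp (- d * Re v)"
      using bound[of "\<bar>Im w\<bar>"] w S by auto
    have vert: "norm (G (w + of_real r) - G (of_real (Re w + r))) \<le> K * exp (- d * (Re w + r)) * \<bar>Im w\<bar>" for r
    proof -
      let ?p = "complex_of_real (Re w + r)" and ?q = "w + of_real r"
      have seg: "Re v = Re w + r \<and> \<bar>Im v\<bar> \<le> \<bar>Im w\<bar>" if "v \<in> closed_segment ?p ?q" for v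
      proof -
        from that obtain u where u: "0 \<le> u" "u \<le> 1" "v = (1 - u) *\<^sub>R ?p + u *\<^sub>R ?q"
          unfolding in_segment by blast
        have "Re v = (1 - u) * (Re w + r) + u * (Re w + r)" "Im v = u * Im w"
          unfolding u(3) by simp_all
        then show ?thesis
          using u(1,2) by (simp add: algebra_simps abs_mult mult_left_le_one_le)
      qed
      have sub: "closed_segment ?p ?q \<subseteq> S"
        using seg w S by fastforce
      have "norm (G ?q - G ?p) \<le> K * exp (- d * (Re w + r)) * norm (?q - ?p)"
      proof (rule field_differentiable_bound[where S = "closed_segment ?p ?q" and f' = F])
        show "(G has_field_derivative F z) (at z within closed_segment ?p ?q)" if "z \<in> closed_segment ?p ?q" for z
          using G sub that has_field_derivative_at_within by blast
        show "norm (F z) \<le> K * exp (- d * (Re w + r))" if "z \<in> closed_segment ?p ?q" for z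
          using K(2)[of z] seg[OF that] by simp
      qed auto
      also have "?q - ?p = \<i> * of_real (Im w)" by (simp add: complex_eq_iff)
      finally show ?thesis by (simp add: norm_mult)
    qed
    define M where "M = K * exp (- d * Re w) * \<bar>Im w\<bar> + C / d * exp (- d * Re w)"
    have "norm (G (w + of_real r) - l) \<le> M * exp (- d * r)" for r
    proof -
      have "norm (G (w + of_real r) - l) \<le> norm (G (w + of_real r) - G (of_real (Re w + r))) + norm (G (of_real (Re w + r)) - l)"
        by (rule norm_diff_triangle_le) auto
      also have "\<dots> \<le> K * exp (- d * (Re w + r)) * \<bar>Im w\<bar> + C / d * exp (- d * (Re w + r))"
        by (intro add_mono vert near)
      also have "\<dots> = M * exp (- d * r)"
        by (simp add: M_def algebra_simps exp_add exp_diff exp_minus divide_simps)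
      finally show ?thesis .
    qed
    then show ?thesis
      by (intro Lim_null_comparison[OF _ exp_lim[of M]] always_eventually allI)
  qed
  then show ?thesis
    by (intro exI[of _ "\<lambda>w. G w - l"]) (auto intro!: derivative_eq_intros G)
qed

definition log_sine :: "real \<Rightarrow> complex \<Rightarrow> complex" where
  "log_sine \<alpha> = (SOME L. (\<forall>w\<in>F_strip \<alpha>. (L has_field_derivative F_ext \<alpha> w) (at w)) \<and>
                      (\<forall>w\<in>F_strip \<alpha>. ((\<lambda>r. L (w + of_real r)) \<longlongrightarrow> 0) at_top))"

lemma log_sine:
  assumes "\<alpha> > 0" "w \<in> F_strip \<alpha>"
  shows "(log_sine \<alpha> has_field_derivative F_ext \<alpha> w) (at w)" "((\<lambda>r. log_sine \<alpha> (w + of_real r)) \<longlongrightarrow> 0) at_top"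
proof -
  have "\<exists>L. (\<forall>w\<in>F_strip \<alpha>. (L has_field_derivative F_ext \<alpha> w) (at w)) \<and>
           (\<forall>w\<in>F_strip \<alpha>. ((\<lambda>r. L (w + of_real r)) \<longlongrightarrow> 0) at_top)"
  proof (rule ex_primitive_vanishing_at_top[OF F_strip_def])
    show "pi + pi / \<alpha> > 0" using assms by (intro add_pos_pos) auto
    show "\<exists>C>0. \<forall>w. \<bar>Im w\<bar> \<le> h \<longrightarrow> norm (F_ext \<alpha> w) \<le> C * exp (- decay \<alpha> * Re w)" if "h < pi + pi / \<alpha>" for h
      using norm_F_ext_le[OF assms(1) that] by metis
  qed (use assms F_ext_holomorphic decay in auto)
  from someI_ex[OF this] assms(2)
  show "(log_sine \<alpha> has_field_derivative F_ext \<alpha> w) (at w)" "((\<lambda>r. log_sine \<alpha> (w + of_real r)) \<longlongrightarrow> 0) at_top"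
    unfolding log_sine_def by auto
qed

lemma log_sine_reciprocal:
  assumes "\<alpha> > 0" "w \<in> F_strip \<alpha>"
  shows "log_sine \<alpha> w = log_sine (1 / \<alpha>) (of_real \<alpha> * w)"
proof -
  have scale: "of_real \<alpha> * w \<in> F_strip (1 / \<alpha>)" if "w \<in> F_strip \<alpha>" for w
    using that assms by (auto simp: F_strip_def abs_mult field_simps)
  have "log_sine \<alpha> w - log_sine (1 / \<alpha>) (of_real \<alpha> * w) = 0"
  proof (rule eq_0_if_deriv_0_tendsto_0[where S = "F_strip \<alpha>" and w = w and D = "\<lambda>w. log_sine \<alpha> w - log_sine (1 / \<alpha>) (of_real \<alpha> * w)"])
    show "((\<lambda>w. log_sine \<alpha> w - log_sine (1 / \<alpha>) (of_real \<alpha> * w)) has_field_derivative 0) (at w)" if "w \<in> F_strip \<alpha>" for w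
    proof -
      have "((\<lambda>w. log_sine (1 / \<alpha>) (of_real \<alpha> * w)) has_field_derivative F_ext (1 / \<alpha>) (of_real \<alpha> * w) * of_real \<alpha>) (at w)"
        by (rule DERIV_chain2[where f = "log_sine (1 / \<alpha>)" and g = "\<lambda>w. of_real \<alpha> * w", OF log_sine(1)])
           (use assms scale[OF that] in \<open>auto intro!: derivative_eq_intros\<close>)
      from DERIV_diff[OF log_sine(1)[OF assms(1) that] this] show ?thesis
        using F_ext_reciprocal[OF assms(1) that] by (simp add: mult.commute)
    qed
    have "((\<lambda>r. log_sine (1 / \<alpha>) (of_real \<alpha> * w + of_real (\<alpha> * r))) \<longlongrightarrow> 0) at_top"
      by (rule filterlim_compose[where f = "\<lambda>r. \<alpha> * r", OF log_sine(2)])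
         (use assms scale in \<open>auto intro!: filterlim_tendsto_pos_mult_at_top[OF tendsto_const] filterlim_ident\<close>)
    from tendsto_diff[OF log_sine(2)[OF assms] this]
    show "((\<lambda>r. log_sine \<alpha> (w + of_real r) - log_sine (1 / \<alpha>) (of_real \<alpha> * (w + of_real r))) \<longlongrightarrow> 0) at_top"
      by (simp add: distrib_left)
  qed (use assms F_strip in \<open>auto simp: F_strip_def\<close>)
  then show ?thesis by simp
qed

lemma one_plus_exp_notin_nonpos_Reals:
  assumes "\<bar>Im z\<bar> < pi"
  shows "1 + exp z \<notin> \<real>\<^sub>\<le>\<^sub>0"
proof
  assume "1 + exp z \<in> \<real>\<^sub>\<le>\<^sub>0"
  then have 1: "1 + exp (Re z) * cos (Im z) \<le> 0" "exp (Re z) * sin (Im z) = 0"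
    by (auto simp: complex_nonpos_Reals_iff Re_exp Im_exp)
  from 1(2) have "Im z = 0"
    using assms sin_gt_zero[of "Im z"] sin_gt_zero[of "- Im z"] by (cases "Im z" "0 :: real" rule: linorder_cases) auto
  then have "1 + exp (Re z) \<le> 0" using 1(1) by simp
  moreover have "exp (Re z) > 0" by simp
  ultimately show False by linarith
qed

text \<open>
  Both sides have the same derivative, by \<open>F_ext_jump\<close>, and both vanish at \<open>+\<infinity>\<close>. The principal
  logarithm is holomorphic here because \<open>|Im (\<alpha> w)| < \<pi>\<close>.
\<close>

lemma log_sine_jump:
  assumes "\<alpha> > 0" "\<bar>Im w\<bar> < pi / \<alpha>"
  shows "log_sine \<alpha> (w + pi * \<i>) - log_sine \<alpha> (w - pi * \<i>) = 2 * pi * \<i> * Ln (1 + exp (- (of_real \<alpha> * w)))"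
proof -
  let ?S = "{w. \<bar>Im w\<bar> < pi / \<alpha>}"
  have S_eq: "?S = {w. Im w > - (pi / \<alpha>)} \<inter> {w. Im w < pi / \<alpha>}" by auto
  have sub: "w + pi * \<i> \<in> F_strip \<alpha>" "w - pi * \<i> \<in> F_strip \<alpha>" if "w \<in> ?S" for w
    using that by (auto simp: F_strip_def intro: abs_add_pi_less)
  define D where "D = (\<lambda>w. log_sine \<alpha> (w + pi * \<i>) - log_sine \<alpha> (w - pi * \<i>) - 2 * pi * \<i> * Ln (1 + exp (- (of_real \<alpha> * w))))"
  have "D w = 0"
  proof (rule eq_0_if_deriv_0_tendsto_0[where S = ?S and D = D and w = w])
    show "convex ?S"
      unfolding S_eq by (intro convex_Int convex_halfspace_Im_lt convex_halfspace_Im_gt)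
    show "(D has_field_derivative 0) (at w)" if w: "w \<in> ?S" for w
    proof -
      have Im: "\<bar>Im (- (of_real \<alpha> * w))\<bar> < pi"
        using w assms by (auto simp: abs_mult field_simps)
      define e where "e = exp (- (of_real \<alpha> * w))"
      have nz: "1 + e \<noteq> 0" "1 + e \<notin> \<real>\<^sub>\<le>\<^sub>0"
        unfolding e_def using one_plus_exp_nonzero[OF Im] one_plus_exp_notin_nonpos_Reals[OF Im] by auto
      have "(D has_field_derivative F_ext \<alpha> (w + pi * \<i>) - F_ext \<alpha> (w - pi * \<i>) - 2 * pi * \<i> * (- (of_real \<alpha> * e) / (1 + e))) (at w)"
        unfolding D_def
      proof (intro DERIV_diff DERIV_cmult)
        show "((\<lambda>w. log_sine \<alpha> (w + pi * \<i>)) has_field_derivative F_ext \<alpha> (w + pi * \<i>)) (at w)"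
          using log_sine(1)[OF assms(1) sub(1)[OF w]] by (simp only: DERIV_shift)
        show "((\<lambda>w. log_sine \<alpha> (w - pi * \<i>)) has_field_derivative F_ext \<alpha> (w - pi * \<i>)) (at w)"
          using log_sine(1)[OF assms(1) sub(2)[OF w]] by (simp only: DERIV_shift diff_conv_add_uminus)
        show "((\<lambda>w. Ln (1 + exp (- (of_real \<alpha> * w)))) has_field_derivative - (of_real \<alpha> * e) / (1 + e)) (at w)"
          using nz unfolding e_def by (auto intro!: derivative_eq_intros simp: field_simps)
      qed
      moreover have "F_ext \<alpha> (w + pi * \<i>) - F_ext \<alpha> (w - pi * \<i>) = - 2 * pi * \<i> * (of_real \<alpha> * e / (1 + e))"
      proof -
        have "1 / (1 + exp (of_real \<alpha> * w)) = e / (e + 1)"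
          unfolding inverse_one_plus_exp e_def ..
        then show ?thesis
          using F_ext_jump[OF assms(1), of w] w by (simp add: divide_inverse add.commute)
      qed
      ultimately show ?thesis by (simp add: field_simps)
    qed
    have "((\<lambda>r. exp (- (of_real \<alpha> * (w + of_real r)))) \<longlongrightarrow> 0) at_top"
    proof (rule filterlim_compose[OF exp_tendsto_0_Re_at_top[OF assms(1)]])
      show "filterlim (\<lambda>r. w + of_real r) (filtercomap Re at_top) at_top"
        unfolding filterlim_filtercomap_iff o_def
        by (simp add: filterlim_tendsto_add_at_top[OF tendsto_const filterlim_ident])
    qed
    then have "((\<lambda>r. Ln (1 + exp (- (of_real \<alpha> * (w + of_real r))))) \<longlongrightarrow> Ln (1 + 0)) at_top"
      by (intro tendsto_intros) auto
    note Ln_lim = this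
    have "((\<lambda>r. log_sine \<alpha> ((w + pi * \<i>) + of_real r)) \<longlongrightarrow> 0) at_top" "((\<lambda>r. log_sine \<alpha> ((w - pi * \<i>) + of_real r)) \<longlongrightarrow> 0) at_top"
      using sub[of w] assms by (auto intro!: log_sine(2))
    from tendsto_diff[OF tendsto_diff[OF this] tendsto_mult[OF tendsto_const[of "2 * pi * \<i>"] Ln_lim]]
    have "((\<lambda>r. log_sine \<alpha> ((w + pi * \<i>) + of_real r) - log_sine \<alpha> ((w - pi * \<i>) + of_real r) -
         2 * pi * \<i> * Ln (1 + exp (- (of_real \<alpha> * (w + of_real r))))) \<longlongrightarrow> 0 - 0 - 2 * pi * \<i> * Ln (1 + 0)) at_top" .
    then show "((\<lambda>r. D (w + of_real r)) \<longlongrightarrow> 0) at_top"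
      by (simp add: D_def algebra_simps)
  qed (use assms in auto)
  then show ?thesis by (simp add: D_def)
qed

definition sine_strip :: "real \<Rightarrow> complex \<Rightarrow> complex" where
  "sine_strip \<alpha> w = exp (log_sine \<alpha> w / (2 * pi * \<i>))"

lemma sine_strip_nonzero [simp]: "sine_strip \<alpha> w \<noteq> 0"
  by (simp add: sine_strip_def)

lemma sine_strip_holomorphic: "\<alpha> > 0 \<Longrightarrow> sine_strip \<alpha> holomorphic_on F_strip \<alpha>"
  unfolding sine_strip_def
  by (intro holomorphic_intros) (use log_sine(1) F_strip(1) in \<open>auto simp: holomorphic_on_open\<close>)

lemma sine_strip_shift:
  assumes "\<alpha> > 0" "\<bar>Im w\<bar> < pi / \<alpha>"
  shows "sine_strip \<alpha> (w + pi * \<i>) = (1 + exp (- (of_real \<alpha> * w))) * sine_strip \<alpha> (w - pi * \<i>)"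
proof -
  have "\<bar>Im (- (of_real \<alpha> * w))\<bar> < pi"
    using assms by (auto simp: abs_mult field_simps)
  then have nz: "1 + exp (- (of_real \<alpha> * w)) \<noteq> 0" by (rule one_plus_exp_nonzero)
  have "log_sine \<alpha> (w + pi * \<i>) / (2 * pi * \<i>) = Ln (1 + exp (- (of_real \<alpha> * w))) + log_sine \<alpha> (w - pi * \<i>) / (2 * pi * \<i>)"
    using log_sine_jump[OF assms] by (simp add: field_simps)
  then show ?thesis
    using nz by (simp add: sine_strip_def exp_add)
qed

lemma sine_strip_reciprocal:
  assumes "\<alpha> > 0" "w \<in> F_strip \<alpha>"
  shows "sine_strip \<alpha> w = sine_strip (1 / \<alpha>) (of_real \<alpha> * w)"
  using log_sine_reciprocal[OF assms] by (simp add: sine_strip_def)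

section \<open>Meromorphic continuation by quasi-periodicity\<close>

text \<open>
  The identity theorem, which for meromorphic functions says that \<open>f - g\<close> either takes the value 0 near
  every point or avoids it near every point.
\<close>

lemma meromorphic_identity:
  assumes "f meromorphic_on UNIV" "g meromorphic_on UNIV" "\<forall>\<^sub>F w in at z. f w = g w"
  shows "\<forall>\<^sub>F w in at v. f w = g w"
proof -
  have "(\<lambda>w. f w - g w) meromorphic_on UNIV"
    using assms by (intro meromorphic_intros)
  from meromorphic_imp_constant_or_avoid[OF this open_UNIV connected_UNIV, of 0]
  have "(\<forall>w. \<forall>\<^sub>F v in at w. f v = g v) \<or> (\<forall>w. \<forall>\<^sub>F v in at w. f v \<noteq> g v)"
    by (simp add: eventually_cosparse_open_eq)
  moreover have False if "\<forall>\<^sub>F w in at z. f w \<noteq> g w"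
  proof -
    have "\<forall>\<^sub>F w in at z. False"
      using that assms(3) by eventually_elim simp
    then show False by simp
  qed
  ultimately show ?thesis by blast
qed

text \<open>
  The multiplier in \<open>sine_strip_shift\<close>, written in terms of the upper one of the two points.
\<close>

definition sine_factor :: "real \<Rightarrow> complex \<Rightarrow> complex" where
  "sine_factor \<alpha> w = 1 + exp (- (of_real \<alpha> * (w - pi * \<i>)))"

lemma sine_factor_analytic [analytic_intros]: "f analytic_on A \<Longrightarrow> (\<lambda>w. sine_factor \<alpha> (f w)) analytic_on A"
  unfolding sine_factor_def by (intro analytic_intros)

lemma sine_factor_nonzero:
  assumes "\<alpha> > 0" "\<bar>Im w - pi\<bar> < pi / \<alpha>"
  shows "sine_factor \<alpha> w \<noteq> 0"
  unfolding sine_factor_def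
proof (rule one_plus_exp_nonzero)
  have "Im (- (of_real \<alpha> * (w - pi * \<i>))) = - (\<alpha> * (Im w - pi))" by simp
  also have "\<bar>\<dots>\<bar> = \<alpha> * \<bar>Im w - pi\<bar>"
    unfolding abs_minus_cancel abs_mult using assms by simp
  finally have "\<bar>Im (- (of_real \<alpha> * (w - pi * \<i>)))\<bar> = \<alpha> * \<bar>Im w - pi\<bar>" .
  then show "\<bar>Im (- (of_real \<alpha> * (w - pi * \<i>)))\<bar> < pi"
    using assms by (simp add: field_simps)
qed

lemma sine_factor_eq_0_iff:
  assumes "\<alpha> > 0"
  shows "sine_factor \<alpha> w = 0 \<longleftrightarrow> (\<exists>j::int. w = pi * \<i> * of_real (1 + (2 * of_int j + 1) / \<alpha>))"
proof -
  have "sine_factor \<alpha> w = 0 \<longleftrightarrow> exp (- (of_real \<alpha> * (w - pi * \<i>))) = exp (pi * \<i>)"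
    by (simp add: sine_factor_def eq_neg_iff_add_eq_0 add.commute)
  also have "\<dots> \<longleftrightarrow> (\<exists>n::int. - (of_real \<alpha> * (w - pi * \<i>)) = pi * \<i> + (of_int (2 * n) * pi) * \<i>)"
    by (rule exp_eq)
  also have "\<dots> \<longleftrightarrow> (\<exists>j::int. w = pi * \<i> * of_real (1 + (2 * of_int j + 1) / \<alpha>))"
  proof (intro iffI; elim exE)
    fix n :: int assume n: "- (of_real \<alpha> * (w - pi * \<i>)) = pi * \<i> + (of_int (2 * n) * pi) * \<i>"
    have "w = pi * \<i> * of_real (1 + (2 * of_int (- n - 1) + 1) / \<alpha>)"
      using n assms by (simp add: complex_eq_iff field_simps)
    then show "\<exists>j::int. w = pi * \<i> * of_real (1 + (2 * of_int j + 1) / \<alpha>)" by blast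
  next
    fix j :: int assume j: "w = pi * \<i> * of_real (1 + (2 * of_int j + 1) / \<alpha>)"
    have "- (of_real \<alpha> * (w - pi * \<i>)) = pi * \<i> + (of_int (2 * (- j - 1)) * pi) * \<i>"
      using assms unfolding j by (simp add: complex_eq_iff field_simps)
    then show "\<exists>n::int. - (of_real \<alpha> * (w - pi * \<i>)) = pi * \<i> + (of_int (2 * n) * pi) * \<i>" by blast
  qed
  finally show ?thesis .
qed

lemma eventually_sine_factor_nonzero:
  assumes "\<alpha> > 0"
  shows "\<forall>\<^sub>F w in at z. sine_factor \<alpha> (w + c) \<noteq> 0"
proof -
  have "(\<lambda>w. sine_factor \<alpha> (w + c)) meromorphic_on UNIV"
    by (intro analytic_on_imp_meromorphic_on analytic_intros)
  from meromorphic_imp_constant_or_avoid[OF this open_UNIV connected_UNIV, of 0]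
  have "(\<forall>w. \<forall>\<^sub>F v in at w. sine_factor \<alpha> (v + c) = 0) \<or> (\<forall>w. \<forall>\<^sub>F v in at w. sine_factor \<alpha> (v + c) \<noteq> 0)"
    by (simp add: eventually_cosparse_open_eq)
  moreover have False if ev: "\<forall>\<^sub>F v in at (pi * \<i> - c). sine_factor \<alpha> (v + c) = 0"
  proof -
    have "(\<lambda>v. sine_factor \<alpha> (v + c)) analytic_on {pi * \<i> - c}"
      by (intro analytic_intros)
    then have "isCont (\<lambda>v. sine_factor \<alpha> (v + c)) (pi * \<i> - c)"
      by (rule analytic_at_imp_isCont)
    then have "((\<lambda>v. sine_factor \<alpha> (v + c)) \<longlongrightarrow> sine_factor \<alpha> (pi * \<i>)) (at (pi * \<i> - c))"
      by (simp add: isCont_def)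
    moreover have "((\<lambda>v. sine_factor \<alpha> (v + c)) \<longlongrightarrow> 0) (at (pi * \<i> - c))"
      using ev by (rule tendsto_eventually)
    ultimately have "sine_factor \<alpha> (pi * \<i>) = 0"
      using LIM_unique by blast
    then show False by (simp add: sine_factor_def)
  qed
  ultimately show ?thesis by blast
qed

lemma zorder_sine_factor:
  assumes "\<alpha> > 0"
  shows "zorder (\<lambda>w. sine_factor \<alpha> (w + c)) z = (if sine_factor \<alpha> (z + c) = 0 then 1 else 0)"
proof (cases "sine_factor \<alpha> (z + c) = 0")
  case False
  then show ?thesis
    by (auto intro!: zorder_eq_0I analytic_intros)
next
  case True
  have "zorder (\<lambda>w. sine_factor \<alpha> (w + c)) z = 1"
  proof (rule zorder_zero_eqI')
    show "(\<lambda>w. sine_factor \<alpha> (w + c)) analytic_on {z}" by (intro analytic_intros)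
    show "(deriv ^^ i) (\<lambda>w. sine_factor \<alpha> (w + c)) z = 0" if "i < nat 1" for i
      using that True by simp
    have "((\<lambda>w. sine_factor \<alpha> (w + c)) has_field_derivative - (of_real \<alpha> * exp (- (of_real \<alpha> * (z + c - pi * \<i>))))) (at z)"
      unfolding sine_factor_def by (auto intro!: derivative_eq_intros)
    then show "(deriv ^^ nat 1) (\<lambda>w. sine_factor \<alpha> (w + c)) z \<noteq> 0"
      using assms by (simp add: DERIV_imp_deriv)
  qed auto
  then show ?thesis using True by simp
qed

definition shift_prod :: "real \<Rightarrow> int \<Rightarrow> complex \<Rightarrow> complex" where
  "shift_prod \<alpha> n w = (if n \<ge> 0 then (\<Prod>k<nat n. sine_factor \<alpha> (w - 2 * pi * \<i> * of_nat k))
                       else 1 / (\<Prod>k<nat (- n). sine_factor \<alpha> (w + 2 * pi * \<i> * of_nat (Suc k))))"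

lemma shift_prod_succ:
  assumes "sine_factor \<alpha> (w - 2 * pi * \<i> * of_int n) \<noteq> 0"
  shows "shift_prod \<alpha> (n + 1) w = shift_prod \<alpha> n w * sine_factor \<alpha> (w - 2 * pi * \<i> * of_int n)"
proof (cases "n \<ge> 0")
  case True
  then have "nat (n + 1) = Suc (nat n)" by simp
  then show ?thesis using True by (simp add: shift_prod_def)
next
  case False
  define m where "m = nat (- n - 1)"
  have m: "nat (- n) = Suc m" "nat (- (n + 1)) = m" "n = - of_nat (Suc m)"
    using False by (auto simp: m_def)
  have arg: "w - 2 * pi * \<i> * of_int n = w + 2 * pi * \<i> * of_nat (Suc m)"
    unfolding m(3) by (simp add: algebra_simps)
  have n1: "shift_prod \<alpha> (n + 1) w = 1 / (\<Prod>k<m. sine_factor \<alpha> (w + 2 * pi * \<i> * of_nat (Suc k)))"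
    using False m by (cases "n = -1") (auto simp: shift_prod_def)
  show ?thesis
    using assms False unfolding n1 arg by (simp add: shift_prod_def m(1))
qed

lemma shift_prod_shift:
  assumes "sine_factor \<alpha> w \<noteq> 0"
  shows "shift_prod \<alpha> n w = sine_factor \<alpha> w * shift_prod \<alpha> (n - 1) (w - 2 * pi * \<i>)"
proof (cases "n \<ge> 1")
  case True
  then have n: "nat n = Suc (nat (n - 1))" by simp
  show ?thesis
    using True unfolding shift_prod_def n prod.lessThan_Suc_shift by (simp add: algebra_simps)
next
  case False
  then have n: "nat (- (n - 1)) = Suc (nat (- n))" by simp
  have "shift_prod \<alpha> (n - 1) (w - 2 * pi * \<i>) =
      1 / (sine_factor \<alpha> w * (\<Prod>k<nat (- n). sine_factor \<alpha> (w + 2 * pi * \<i> * of_nat (Suc k))))"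
    using False unfolding shift_prod_def n prod.lessThan_Suc_shift by (simp add: algebra_simps)
  moreover have "shift_prod \<alpha> n w = 1 / (\<Prod>k<nat (- n). sine_factor \<alpha> (w + 2 * pi * \<i> * of_nat (Suc k)))"
    using False by (cases "n = 0") (auto simp: shift_prod_def)
  ultimately show ?thesis using assms by simp
qed

lemma shift_prod_meromorphic: "shift_prod \<alpha> n meromorphic_on A"
proof (cases "n \<ge> 0")
  case True
  then have "shift_prod \<alpha> n = (\<lambda>w. \<Prod>k<nat n. sine_factor \<alpha> (w - 2 * pi * \<i> * of_nat k))"
    by (simp add: shift_prod_def fun_eq_iff)
  then show ?thesis
    by (auto intro!: analytic_on_imp_meromorphic_on analytic_intros)
next
  case False
  then have "shift_prod \<alpha> n = (\<lambda>w. 1 / (\<Prod>k<nat (- n). sine_factor \<alpha> (w + 2 * pi * \<i> * of_nat (Suc k))))"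
    by (simp add: shift_prod_def fun_eq_iff)
  then show ?thesis
    by (simp only:) (rule meromorphic_on_divide[OF meromorphic_on_const analytic_on_imp_meromorphic_on], intro analytic_intros)
qed

lemma zorder_prod_sine_factor:
  fixes c :: "nat \<Rightarrow> complex"
  assumes "\<alpha> > 0"
  shows "\<forall>\<^sub>F w in at z. (\<Prod>k<N. sine_factor \<alpha> (w + c k)) \<noteq> 0"
    and "zorder (\<lambda>w. \<Prod>k<N. sine_factor \<alpha> (w + c k)) z = card {k. k < N \<and> sine_factor \<alpha> (z + c k) = 0}"
proof -
  have "\<forall>\<^sub>F w in at z. \<forall>k\<in>{..<N}. sine_factor \<alpha> (w + c k) \<noteq> 0"
    by (intro eventually_ball_finite ballI eventually_sine_factor_nonzero assms) auto
  then show *: "\<forall>\<^sub>F w in at z. (\<Prod>k<N. sine_factor \<alpha> (w + c k)) \<noteq> 0"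
    by eventually_elim auto
  have "zorder (\<lambda>w. \<Prod>k<N. sine_factor \<alpha> (w + c k)) z = (\<Sum>k<N. zorder (\<lambda>w. sine_factor \<alpha> (w + c k)) z)"
    by (intro zorder_prod * analytic_on_imp_meromorphic_on analytic_intros)
  also have "\<dots> = (\<Sum>k\<in>{..<N} \<inter> {k. sine_factor \<alpha> (z + c k) = 0}. 1)"
    unfolding zorder_sine_factor[OF assms] by (subst sum.inter_restrict) auto
  also have "\<dots> = card {k. k < N \<and> sine_factor \<alpha> (z + c k) = 0}"
    by (simp add: Int_def)
  finally show "zorder (\<lambda>w. \<Prod>k<N. sine_factor \<alpha> (w + c k)) z = card {k. k < N \<and> sine_factor \<alpha> (z + c k) = 0}" .
qed

lemma eventually_shift_prod_nonzero:
  assumes "\<alpha> > 0"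
  shows "\<forall>\<^sub>F w in at z. shift_prod \<alpha> n w \<noteq> 0"
  using zorder_prod_sine_factor(1)[OF assms, where N = "nat n" and c = "\<lambda>k. - (2 * pi * \<i> * of_nat k)" and z = z]
    zorder_prod_sine_factor(1)[OF assms, where N = "nat (- n)" and c = "\<lambda>k. 2 * pi * \<i> * of_nat (Suc k)" and z = z]
  by eventually_elim (auto simp: shift_prod_def)

lemma zorder_shift_prod:
  assumes "\<alpha> > 0"
  shows "zorder (shift_prod \<alpha> n) z =
    int (card {k. k < nat n \<and> sine_factor \<alpha> (z - 2 * pi * \<i> * of_nat k) = 0}) -
    int (card {k. k < nat (- n) \<and> sine_factor \<alpha> (z + 2 * pi * \<i> * of_nat (Suc k)) = 0})"
proof (cases "n \<ge> 0")
  case True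
  then have "shift_prod \<alpha> n = (\<lambda>w. \<Prod>k<nat n. sine_factor \<alpha> (w + (- (2 * pi * \<i> * of_nat k))))"
    by (simp add: shift_prod_def fun_eq_iff)
  then show ?thesis
    using zorder_prod_sine_factor(2)[OF assms, where N = "nat n" and c = "\<lambda>k. - (2 * pi * \<i> * of_nat k)" and z = z] True by simp
next
  case False
  let ?P = "\<lambda>w. \<Prod>k<nat (- n). sine_factor \<alpha> (w + 2 * pi * \<i> * of_nat (Suc k))"
  have "shift_prod \<alpha> n = (\<lambda>w. 1 / ?P w)"
    using False by (simp add: shift_prod_def fun_eq_iff)
  moreover have "zorder (\<lambda>w. 1 / ?P w) z = zorder (\<lambda>_. 1) z - zorder ?P z"
  proof (rule zorder_divide)
    show "?P meromorphic_on {z}"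
      by (intro analytic_on_imp_meromorphic_on analytic_intros)
    show "\<exists>\<^sub>F w in at z. ?P w \<noteq> 0"
      using zorder_prod_sine_factor(1)[OF assms] by (intro eventually_frequently) auto
  qed auto
  ultimately show ?thesis
    using zorder_prod_sine_factor(2)[OF assms, where N = "nat (- n)" and c = "\<lambda>k. 2 * pi * \<i> * of_nat (Suc k)" and z = z] False by simp
qed

definition strip_index :: "complex \<Rightarrow> int" where
  "strip_index w = \<lfloor>(Im w + pi) / (2 * pi)\<rfloor>"

lemma strip_index: "2 * pi * strip_index w - pi \<le> Im w" "Im w < 2 * pi * strip_index w + pi"
proof -
  have "of_int (strip_index w) \<le> (Im w + pi) / (2 * pi)" "(Im w + pi) / (2 * pi) < of_int (strip_index w) + 1"
    unfolding strip_index_def by linarith+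
  then show "2 * pi * strip_index w - pi \<le> Im w" "Im w < 2 * pi * strip_index w + pi"
    using pi_gt_zero by (simp_all add: field_simps)
qed

text \<open>
  The values in the strip \<open>|Im w| \<le> \<pi>\<close> are transported to the whole plane by the functional equation
  \<open>sine_strip_shift\<close>.
\<close>

definition double_sine :: "real \<Rightarrow> complex \<Rightarrow> complex" where
  "double_sine \<alpha> w = sine_strip \<alpha> (w - 2 * pi * \<i> * of_int (strip_index w)) * shift_prod \<alpha> (strip_index w) w"

text \<open>
  On the overlap of two neighbouring branches the functional equation of \<open>sine_strip\<close> is exactly the
  factor by which the products differ.
\<close>

lemma sine_branches_agree:
  assumes "\<alpha> > 0" "\<bar>Im w - 2 * pi * n - pi\<bar> < pi / \<alpha>"
  shows "sine_strip \<alpha> (w - 2 * pi * \<i> * of_int (n + 1)) * shift_prod \<alpha> (n + 1) w =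
    sine_strip \<alpha> (w - 2 * pi * \<i> * of_int n) * shift_prod \<alpha> n w"
proof -
  define v where "v = w - 2 * pi * \<i> * of_int n - pi * \<i>"
  have v: "\<bar>Im v\<bar> < pi / \<alpha>" using assms by (simp add: v_def)
  have eqs: "v + pi * \<i> = w - 2 * pi * \<i> * of_int n" "v - pi * \<i> = w - 2 * pi * \<i> * of_int (n + 1)"
    by (simp_all add: v_def algebra_simps)
  have fac: "1 + exp (- (of_real \<alpha> * v)) = sine_factor \<alpha> (w - 2 * pi * \<i> * of_int n)"
    by (simp add: sine_factor_def v_def)
  have "sine_factor \<alpha> (w - 2 * pi * \<i> * of_int n) \<noteq> 0"
    by (rule sine_factor_nonzero) (use assms in simp_all)
  then show ?thesis
    using sine_strip_shift[OF assms(1) v] unfolding eqs fac by (simp add: shift_prod_succ)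
qed

text \<open>
  The formula that defines \<open>double_sine\<close> on one horizontal strip of width \<open>2 \<pi>\<close> remains valid slightly
  beyond both edges. Near an edge, where the definition switches from one formula to the next, it
  can thus be replaced by a single meromorphic expression.
\<close>

lemma double_sine_eq_branch:
  assumes "\<alpha> > 0" "\<bar>Im w - 2 * pi * n\<bar> < pi + min pi (pi / \<alpha>)"
  shows "double_sine \<alpha> w = sine_strip \<alpha> (w - 2 * pi * \<i> * of_int n) * shift_prod \<alpha> n w"
proof -
  define m where "m = strip_index w"
  have m: "2 * pi * m - pi \<le> Im w" "Im w < 2 * pi * m + pi"
    using strip_index[of w] by (simp_all add: m_def)
  have "2 * pi * \<bar>real_of_int n - m\<bar> < 2 * pi * (3 / 2)"
  proof -
    have "2 * pi * \<bar>real_of_int n - m\<bar> = \<bar>2 * pi * n - 2 * pi * m\<bar>"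
      by (simp add: abs_mult flip: right_diff_distrib)
    then show ?thesis using m assms(2) by linarith
  qed
  then have "\<bar>real_of_int n - m\<bar> < 3 / 2"
    by simp
  then consider "m = n" | "m = n + 1" | "n = m + 1" by linarith
  then show ?thesis
  proof cases
    case 1 then show ?thesis by (simp add: double_sine_def m_def)
  next
    case 2
    have "\<bar>Im w - 2 * pi * n - pi\<bar> < pi / \<alpha>"
      using m(1) assms(2) unfolding 2 by (simp add: algebra_simps abs_less_iff min_def split: if_splits)
    from sine_branches_agree[OF assms(1) this] show ?thesis
      unfolding double_sine_def m_def[symmetric] 2 .
  next
    case 3
    have "\<bar>Im w - 2 * pi * m - pi\<bar> < pi / \<alpha>"
      using m(2) assms(2) unfolding 3 by (simp add: algebra_simps abs_less_iff min_def split: if_splits)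
    from sine_branches_agree[OF assms(1) this] show ?thesis
      unfolding double_sine_def m_def[symmetric] 3 by simp
  qed
qed

section \<open>Zeros and poles of the double sine function\<close>

abbreviation lattice_pt :: "real \<Rightarrow> nat \<Rightarrow> nat \<Rightarrow> complex" where
  "lattice_pt \<alpha> m k \<equiv> pi * \<i> * of_real ((2 * real m + 1) / \<alpha> + (2 * real k + 1))"

text \<open>
  If \<open>\<alpha>\<close> is rational, several pairs can give the same point. Their number will be its multiplicity as a
  zero of the double sine function.
\<close>

definition lattice_idx :: "real \<Rightarrow> complex \<Rightarrow> (nat \<times> nat) set" where
  "lattice_idx \<alpha> w = {(m, k). w = lattice_pt \<alpha> m k}"

definition lattice_mult :: "real \<Rightarrow> complex \<Rightarrow> nat" where
  "lattice_mult \<alpha> w = card (lattice_idx \<alpha> w)"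

text \<open>
  The index \<open>m\<close> is determined by \<open>k\<close>, so that the pairs may be counted by \<open>k\<close>. The bounds on \<open>Im w\<close> say
  that \<open>w\<close> lies in the \<open>N\<close>-th strip. They make \<open>k < N\<close> equivalent to \<open>m \<ge> 0\<close>, where \<open>m\<close> a priori runs
  through all integers because the sine factor is periodic.
\<close>

lemma lattice_mult_eq:
  assumes "\<alpha> > 0" and lo: "pi * (2 * real N - 1) \<le> Im w" and hi: "Im w \<le> pi * (2 * real N + 1)"
  shows "lattice_mult \<alpha> w = card {k. k < N \<and> sine_factor \<alpha> (w - 2 * pi * \<i> * of_nat k) = 0}"
proof -
  let ?P = "lattice_idx \<alpha> w"
  have inj: "inj_on snd ?P"
    using assms by (auto simp: inj_on_def lattice_idx_def complex_eq_iff field_simps)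
  have iff: "(\<exists>m::nat. (m, k) \<in> ?P) \<longleftrightarrow> k < N \<and> sine_factor \<alpha> (w - 2 * pi * \<i> * of_nat k) = 0" for k
  proof (intro iffI conjI; (elim exE conjE)?)
    fix m :: nat assume "(m, k) \<in> ?P"
    then have w: "w = lattice_pt \<alpha> m k" by (simp add: lattice_idx_def)
    have "(2 * real m + 1) / \<alpha> > 0" using assms by simp
    moreover have "pi * ((2 * real m + 1) / \<alpha> + (2 * real k + 1)) \<le> pi * (2 * real N + 1)"
      using hi unfolding w by simp
    then have "(2 * real m + 1) / \<alpha> + (2 * real k + 1) \<le> 2 * real N + 1"
      using pi_gt_zero by (simp only: mult_le_cancel_left_pos)
    ultimately have "real k < real N" by linarith
    then show "k < N" by simp
    have "w - 2 * pi * \<i> * of_nat k = pi * \<i> * of_real (1 + (2 * of_int (int m) + 1) / \<alpha>)"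
      unfolding w by (simp add: algebra_simps)
    then show "sine_factor \<alpha> (w - 2 * pi * \<i> * of_nat k) = 0"
      using sine_factor_eq_0_iff[OF assms(1)] by blast
  next
    assume k: "k < N" and "sine_factor \<alpha> (w - 2 * pi * \<i> * of_nat k) = 0"
    then obtain j :: int where j: "w - 2 * pi * \<i> * of_nat k = pi * \<i> * of_real (1 + (2 * of_int j + 1) / \<alpha>)"
      using sine_factor_eq_0_iff[OF assms(1)] by blast
    have "Im (w - 2 * pi * \<i> * of_nat k) = pi * (1 + (2 * of_int j + 1) / \<alpha>)"
      unfolding j by simp
    then have Im_w: "Im w = pi * ((2 * of_int j + 1) / \<alpha> + (2 * real k + 1))"
      by (simp add: algebra_simps)
    have "2 * real N - 1 \<ge> 2 * real k + 1" using k by linarith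
    then have "pi * (2 * real k + 1) \<le> pi * (2 * real N - 1)"
      by (intro mult_left_mono) auto
    also have "\<dots> \<le> pi * ((2 * of_int j + 1) / \<alpha> + (2 * real k + 1))"
      using lo unfolding Im_w .
    finally have "2 * real k + 1 \<le> (2 * of_int j + 1) / \<alpha> + (2 * real k + 1)"
      using pi_gt_zero by (simp only: mult_le_cancel_left_pos)
    then have "0 \<le> 2 * real_of_int j + 1"
      using assms by (simp add: zero_le_divide_iff)
    then have "j \<ge> 0" by linarith
    then obtain i :: nat where i: "j = int i" using zero_le_imp_eq_int by blast
    have "w = lattice_pt \<alpha> i k"
      using j unfolding i by (simp add: algebra_simps)
    then show "\<exists>m. (m, k) \<in> ?P" by (auto simp: lattice_idx_def)
  qed
  have "snd ` ?P = {k. k < N \<and> sine_factor \<alpha> (w - 2 * pi * \<i> * of_nat k) = 0}"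
  proof (rule set_eqI)
    fix k
    have "k \<in> snd ` ?P \<longleftrightarrow> (\<exists>m. (m, k) \<in> ?P)"
      by force
    then show "k \<in> snd ` ?P \<longleftrightarrow> k \<in> {k. k < N \<and> sine_factor \<alpha> (w - 2 * pi * \<i> * of_nat k) = 0}"
      unfolding iff by simp
  qed
  then show ?thesis
    unfolding lattice_mult_def using card_image[OF inj] by simp
qed

lemma lattice_mult_eq_0:
  assumes "\<alpha> > 0" "Im w \<le> pi"
  shows "lattice_mult \<alpha> w = 0"
proof -
  have False if "w = lattice_pt \<alpha> m k" for m k
  proof -
    have "(2 * real m + 1) / \<alpha> + (2 * real k + 1) > 1"
      using assms by (simp add: add_pos_nonneg)
    then have "pi * ((2 * real m + 1) / \<alpha> + (2 * real k + 1)) > pi * 1"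
      by (intro mult_strict_left_mono) auto
    moreover have "Im w = pi * ((2 * real m + 1) / \<alpha> + (2 * real k + 1))"
      unfolding that by simp
    ultimately show False using assms(2) by simp
  qed
  then have "lattice_idx \<alpha> w = {}"
    unfolding lattice_idx_def by blast
  then show ?thesis by (simp add: lattice_mult_def)
qed

lemma double_sine_local:
  assumes "\<alpha> > 0"
  obtains n :: int where "2 * pi * n - pi \<le> Im w" "Im w < 2 * pi * n + pi"
    "(\<lambda>v. sine_strip \<alpha> (v - 2 * pi * \<i> * of_int n)) analytic_on {w}"
    "\<forall>\<^sub>F v in at w. double_sine \<alpha> v = sine_strip \<alpha> (v - 2 * pi * \<i> * of_int n) * shift_prod \<alpha> n v"
proof
  define n where "n = strip_index w"
  show n: "2 * pi * n - pi \<le> Im w" "Im w < 2 * pi * n + pi"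
    using strip_index[of w] by (simp_all add: n_def)
  define b where "b = min pi (pi / \<alpha>)"
  have b: "b > 0" "b \<le> pi / \<alpha>" using assms by (auto simp: b_def)
  define U where "U = {v. \<bar>Im v - 2 * pi * n\<bar> < pi + b}"
  have U: "open U" "w \<in> U"
    unfolding U_def using n b by (auto intro!: open_Collect_less continuous_intros)
  have "(\<lambda>v. sine_strip \<alpha> (v - 2 * pi * \<i> * of_int n)) holomorphic_on U"
    by (rule holomorphic_on_comp[OF sine_strip_holomorphic[OF assms]])
       (use b in \<open>auto intro!: holomorphic_intros simp: U_def F_strip_def\<close>)
  then show "(\<lambda>v. sine_strip \<alpha> (v - 2 * pi * \<i> * of_int n)) analytic_on {w}"
    using U analytic_at by blast
  have "\<forall>\<^sub>F v in at w. v \<in> U"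
    using U by (rule eventually_at_in_open')
  then show "\<forall>\<^sub>F v in at w. double_sine \<alpha> v = sine_strip \<alpha> (v - 2 * pi * \<i> * of_int n) * shift_prod \<alpha> n v"
    by eventually_elim (use double_sine_eq_branch[OF assms] in \<open>auto simp: U_def b_def\<close>)
qed

lemma double_sine_meromorphic:
  assumes "\<alpha> > 0"
  shows "double_sine \<alpha> meromorphic_on UNIV"
proof -
  have "double_sine \<alpha> meromorphic_on {w}" for w
  proof -
    obtain n :: int where n: "(\<lambda>v. sine_strip \<alpha> (v - 2 * pi * \<i> * of_int n)) analytic_on {w}"
      "\<forall>\<^sub>F v in at w. double_sine \<alpha> v = sine_strip \<alpha> (v - 2 * pi * \<i> * of_int n) * shift_prod \<alpha> n v"
      using double_sine_local[OF assms] by blast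
    have "(\<lambda>v. sine_strip \<alpha> (v - 2 * pi * \<i> * of_int n) * shift_prod \<alpha> n v) meromorphic_on {w}"
      by (intro meromorphic_on_mult analytic_on_imp_meromorphic_on n(1) shift_prod_meromorphic)
    then show ?thesis
      using meromorphic_on_cong[of "{w}" "double_sine \<alpha>" _ "{w}"] n(2) by simp
  qed
  then show ?thesis
    by (subst meromorphic_on_meromorphic_at) simp
qed

lemma eventually_double_sine_nonzero:
  assumes "\<alpha> > 0"
  shows "\<forall>\<^sub>F v in at w. double_sine \<alpha> v \<noteq> 0"
proof -
  obtain n :: int where
    "\<forall>\<^sub>F v in at w. double_sine \<alpha> v = sine_strip \<alpha> (v - 2 * pi * \<i> * of_int n) * shift_prod \<alpha> n v"
    using double_sine_local[OF assms] by blast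
  then show ?thesis
    using eventually_shift_prod_nonzero[OF assms, of n w] by eventually_elim simp
qed

text \<open>
  In the strip with index \<open>n \<ge> 0\<close> the order is the number of vanishing factors in the product, which
  \<open>lattice_mult_eq\<close> identifies, while \<open>- w\<close> is too low to be a zero. For \<open>n < 0\<close> the roles of \<open>w\<close> and
  \<open>- w\<close> are exchanged, since the zeros of \<open>sine_factor\<close> are symmetric about \<open>\<pi> \<i>\<close>.
\<close>

lemma zorder_double_sine:
  assumes "\<alpha> > 0"
  shows "zorder (double_sine \<alpha>) w = int (lattice_mult \<alpha> w) - int (lattice_mult \<alpha> (- w))"
proof -
  obtain n :: int where n: "2 * pi * n - pi \<le> Im w" "Im w < 2 * pi * n + pi"
    "(\<lambda>v. sine_strip \<alpha> (v - 2 * pi * \<i> * of_int n)) analytic_on {w}"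
    "\<forall>\<^sub>F v in at w. double_sine \<alpha> v = sine_strip \<alpha> (v - 2 * pi * \<i> * of_int n) * shift_prod \<alpha> n v"
    using double_sine_local[OF assms] by blast
  have "zorder (double_sine \<alpha>) w = zorder (\<lambda>v. sine_strip \<alpha> (v - 2 * pi * \<i> * of_int n) * shift_prod \<alpha> n v) w"
    using n(4) by (rule zorder_cong) simp
  also have "\<dots> = zorder (\<lambda>v. sine_strip \<alpha> (v - 2 * pi * \<i> * of_int n)) w + zorder (shift_prod \<alpha> n) w"
    using eventually_shift_prod_nonzero[OF assms]
    by (intro zorder_mult analytic_on_imp_meromorphic_on[OF n(3)] shift_prod_meromorphic eventually_frequently) auto
  also have "zorder (\<lambda>v. sine_strip \<alpha> (v - 2 * pi * \<i> * of_int n)) w = 0"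
    by (rule zorder_eq_0I[OF n(3)]) simp
  also have "zorder (shift_prod \<alpha> n) w = int (lattice_mult \<alpha> w) - int (lattice_mult \<alpha> (- w))"
  proof (cases "n \<ge> 0")
    case True
    then have r: "real (nat n) = of_int n" by simp
    have "lattice_mult \<alpha> w = card {k. k < nat n \<and> sine_factor \<alpha> (w - 2 * pi * \<i> * of_nat k) = 0}"
      by (rule lattice_mult_eq) (use n(1,2) assms in \<open>simp_all add: r algebra_simps\<close>)
    moreover have "Im w \<ge> - pi"
    proof -
      have "2 * pi * n \<ge> 0" using True by simp
      then show ?thesis using n(1) by linarith
    qed
    then have "lattice_mult \<alpha> (- w) = 0"
      using assms by (intro lattice_mult_eq_0) auto
    ultimately show ?thesis
      unfolding zorder_shift_prod[OF assms] using True by simp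
  next
    case False
    then have r: "real (nat (- n)) = - of_int n" by simp
    have "lattice_mult \<alpha> (- w) = card {k. k < nat (- n) \<and> sine_factor \<alpha> (- w - 2 * pi * \<i> * of_nat k) = 0}"
      by (rule lattice_mult_eq) (use n(1,2) assms in \<open>simp_all add: r algebra_simps\<close>)
    moreover have "sine_factor \<alpha> (- w - 2 * pi * \<i> * of_nat k) = 0 \<longleftrightarrow> sine_factor \<alpha> (w + 2 * pi * \<i> * of_nat (Suc k)) = 0" for k
    proof -
      have refl: "sine_factor \<alpha> (2 * pi * \<i> - v) = 0" if v: "sine_factor \<alpha> v = 0" for v
      proof -
        obtain j :: int where j: "v = pi * \<i> * of_real (1 + (2 * of_int j + 1) / \<alpha>)"
          using v sine_factor_eq_0_iff[OF assms] by blast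
        have "2 * pi * \<i> - v = pi * \<i> * of_real (1 + (2 * of_int (- j - 1) + 1) / \<alpha>)"
          unfolding j using assms by (simp add: field_simps)
        then show ?thesis using sine_factor_eq_0_iff[OF assms] by blast
      qed
      have e: "- w - 2 * pi * \<i> * of_nat k = 2 * pi * \<i> - (w + 2 * pi * \<i> * of_nat (Suc k))"
        "w + 2 * pi * \<i> * of_nat (Suc k) = 2 * pi * \<i> - (- w - 2 * pi * \<i> * of_nat k)"
        by (simp_all add: algebra_simps)
      show ?thesis using refl e by metis
    qed
    moreover have "Im w \<le> pi"
    proof -
      have "2 * pi * n \<le> 0" using False by (simp add: mult_nonneg_nonpos)
      then show ?thesis using n(2) by linarith
    qed
    then have "lattice_mult \<alpha> w = 0"
      using assms by (intro lattice_mult_eq_0) auto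
    ultimately show ?thesis
      unfolding zorder_shift_prod[OF assms] using False by simp
  qed
  finally show ?thesis by simp
qed

lemma double_sine_eq_sine_strip:
  assumes "\<alpha> > 0" "\<bar>Im w\<bar> < pi + min pi (pi / \<alpha>)"
  shows "double_sine \<alpha> w = sine_strip \<alpha> w"
  using double_sine_eq_branch[of \<alpha> w 0] assms by (simp add: shift_prod_def)

lemma double_sine_shift:
  assumes "sine_factor \<alpha> w \<noteq> 0"
  shows "double_sine \<alpha> w = sine_factor \<alpha> w * double_sine \<alpha> (w - 2 * pi * \<i>)"
proof -
  have "(Im (w - 2 * pi * \<i>) + pi) / (2 * pi) = (Im w + pi) / (2 * pi) - 1"
    by (simp add: field_simps)
  then have idx: "strip_index (w - 2 * pi * \<i>) = strip_index w - 1"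
    unfolding strip_index_def by linarith
  show ?thesis
    unfolding double_sine_def idx shift_prod_shift[OF assms, of "strip_index w"] by (simp add: algebra_simps)
qed

lemma double_sine_reciprocal:
  assumes "\<alpha> > 0"
  shows "\<forall>\<^sub>F w in at v. double_sine \<alpha> w = double_sine (1 / \<alpha>) (of_real \<alpha> * w)"
proof (rule meromorphic_identity)
  show "(\<lambda>w. double_sine (1 / \<alpha>) (of_real \<alpha> * w)) meromorphic_on UNIV"
    by (rule meromorphic_on_compose[OF double_sine_meromorphic]) (use assms in \<open>auto intro!: analytic_intros\<close>)
  define U where "U = {w. \<bar>Im w\<bar> < pi \<and> \<bar>\<alpha> * Im w\<bar> < pi}"
  have "open U" unfolding U_def
    by (intro open_Collect_conj open_Collect_less continuous_intros)
  then have "\<forall>\<^sub>F w in at 0. w \<in> U"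
    by (rule eventually_at_in_open') (simp add: U_def)
  then show "\<forall>\<^sub>F w in at 0. double_sine \<alpha> w = double_sine (1 / \<alpha>) (of_real \<alpha> * w)"
  proof eventually_elim
    case (elim w)
    have p: "min pi (pi / \<alpha>) > 0" "min pi (pi / (1 / \<alpha>)) > 0" using assms by auto
    have "double_sine \<alpha> w = sine_strip \<alpha> w"
      by (rule double_sine_eq_sine_strip[OF assms]) (use elim p in \<open>unfold U_def mem_Collect_eq, linarith\<close>)
    moreover have "double_sine (1 / \<alpha>) (of_real \<alpha> * w) = sine_strip (1 / \<alpha>) (of_real \<alpha> * w)"
    proof (rule double_sine_eq_sine_strip)
      have "\<bar>\<alpha> * Im w\<bar> < pi" using elim by (simp add: U_def)
      then show "\<bar>Im (of_real \<alpha> * w)\<bar> < pi + min pi (pi / (1 / \<alpha>))"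
        using p(2) by (simp add: add_strict_increasing2 less_imp_le)
    qed (use assms in simp)
    moreover have "w \<in> F_strip \<alpha>"
    proof -
      have "pi / \<alpha> > 0" using assms by simp
      then show ?thesis using elim unfolding U_def F_strip_def mem_Collect_eq by linarith
    qed
    ultimately show ?case using sine_strip_reciprocal[OF assms] by simp
  qed
qed (rule double_sine_meromorphic[OF assms])

lemma eventually_at_translate:
  fixes c w :: complex
  assumes "\<forall>\<^sub>F v in at (w - c). P v"
  shows "\<forall>\<^sub>F v in at w. P (v - c)"
  using assms unfolding filtermap_at_shift[symmetric] eventually_filtermap .

text \<open>
  The shift by \<open>2 \<pi> \<i>/\<alpha>\<close> is the shift by \<open>2 \<pi> \<i>\<close> of \<open>double_sine (1/\<alpha>)\<close> in the variable \<open>\<alpha> w\<close>.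
\<close>

lemma double_sine_shift_reciprocal:
  assumes "\<alpha> > 0"
  shows "\<forall>\<^sub>F w in at v. double_sine \<alpha> w = sine_factor (1 / \<alpha>) (of_real \<alpha> * w) * double_sine \<alpha> (w - 2 * pi * \<i> / of_real \<alpha>)"
proof -
  let ?c = "2 * pi * \<i> / of_real \<alpha>"
  have "\<forall>\<^sub>F w in at v. double_sine \<alpha> (w - ?c) = double_sine (1 / \<alpha>) (of_real \<alpha> * (w - ?c))"
    using double_sine_reciprocal[OF assms] by (rule eventually_at_translate)
  moreover have "\<forall>\<^sub>F w in at v. sine_factor (1 / \<alpha>) (of_real \<alpha> * w) \<noteq> 0"
  proof -
    have "\<forall>\<^sub>F w in at v. sine_factor 1 (w + (pi * \<i> - pi * \<i> / of_real \<alpha>)) \<noteq> 0"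
      by (rule eventually_sine_factor_nonzero) simp
    moreover have "sine_factor 1 (w + (pi * \<i> - pi * \<i> / of_real \<alpha>)) = sine_factor (1 / \<alpha>) (of_real \<alpha> * w)" for w
      using assms by (simp add: sine_factor_def field_simps)
    ultimately show ?thesis by simp
  qed
  ultimately show ?thesis
    using double_sine_reciprocal[OF assms, of v]
  proof eventually_elim
    case (elim w)
    have "of_real \<alpha> * w - 2 * pi * \<i> = of_real \<alpha> * (w - ?c)"
      using assms by (simp add: field_simps)
    then show ?case
      using elim double_sine_shift[OF elim(2)] by simp
  qed
qed

section \<open>The function phi as a quotient of double sines\<close>

lemma set_integrable_powr_at_0:
  fixes d z :: real
  assumes "d > 0" "z > 0"
  shows "set_integrable lborel (einterval 0 (ereal z)) (\<lambda>u. u powr (d - 1))"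
proof (rule interval_integral_FTC_nonneg(1)[where F = "\<lambda>u. u powr d / d"])
  show "DERIV (\<lambda>u. u powr d / d) x :> x powr (d - 1)" if "0 < ereal x" for x
    using that assms by (auto intro!: derivative_eq_intros simp: zero_ereal_def)
  show "isCont (\<lambda>u. u powr (d - 1)) x" if "0 < ereal x" for x
    using that by (auto intro!: continuous_intros simp: zero_ereal_def)
  have "((\<lambda>u. u powr d / d) \<longlongrightarrow> 0 powr d / d) (at_right 0)"
    using assms eventually_at_right_less[of "0::real"]
    by (intro tendsto_intros) (auto elim!: eventually_mono)
  then show "(((\<lambda>u. u powr d / d) \<circ> real_of_ereal) \<longlongrightarrow> 0 powr d / d) (at_right 0)"
    unfolding zero_ereal_def ereal_tendsto_simps .
  have "((\<lambda>u. u powr d / d) \<longlongrightarrow> z powr d / d) (at_left z)"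
    using assms by (intro tendsto_intros) auto
  then show "(((\<lambda>u. u powr d / d) \<circ> real_of_ereal) \<longlongrightarrow> z powr d / d) (at_left (ereal z))"
    unfolding ereal_tendsto_simps .
qed (use assms in \<open>auto simp: zero_ereal_def\<close>)

lemma mem_F_stripI: "\<alpha> > 0 \<Longrightarrow> \<bar>Im w\<bar> \<le> pi \<Longrightarrow> w \<in> F_strip \<alpha>"
  unfolding F_strip_def mem_Collect_eq by (rule le_less_trans) auto

text \<open>
  In terms of \<open>u\<close>, the function \<open>(log_sine(B u) - log_sine(A u)) / (2 \<pi> \<i>)\<close> below is a primitive of the
  integrand. It tends to 0 for \<open>u \<rightarrow> 0\<close>, where \<open>- ln u \<rightarrow> \<infinity>\<close>. The decay of \<open>F\<close> bounds the integrand
  by a multiple of \<open>u powr (d - 1)\<close> with \<open>d > 0\<close>, which makes the improper integral absolutely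
  convergent.
\<close>

lemma phi_eq_sine_strip_quotient:
  assumes "\<alpha> > 0" "0 < \<rho>" "\<rho> < 1" "z > 0"
  shows "phi \<alpha> \<rho> z = sine_strip \<alpha> (- pi * \<i> * \<rho> - of_real (ln z)) / sine_strip \<alpha> (pi * \<i> * \<rho> - of_real (ln z))"
proof -
  define A where "A = (\<lambda>u::real. pi * \<i> * \<rho> - of_real (ln u))"
  define B where "B = (\<lambda>u::real. - pi * \<i> * \<rho> - of_real (ln u))"
  define h where "h = (\<lambda>u. 1 / (2 * pi * \<i> * of_real u) * (stable_F \<alpha> (A u) - stable_F \<alpha> (B u)))"
  define H where "H = (\<lambda>u. (log_sine \<alpha> (B u) - log_sine \<alpha> (A u)) / (2 * pi * \<i>))"
  have Im: "\<bar>pi * \<rho>\<bar> < pi" using assms by simp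
  have AB: "A u \<in> F_strip \<alpha>" "B u \<in> F_strip \<alpha>" for u
    using Im assms by (auto intro!: mem_F_stripI simp: A_def B_def less_imp_le)
  have F_eq: "stable_F \<alpha> (A u) = F_ext \<alpha> (A u)" "stable_F \<alpha> (B u) = F_ext \<alpha> (B u)" for u
    using Im assms by (auto intro!: stable_F_eq_F_ext simp: A_def B_def)
  have der: "(H has_vector_derivative h u) (at u)" if "u > 0" for u
  proof -
    have dA: "(A has_vector_derivative - of_real (1 / u)) (at u)"
      and dB: "(B has_vector_derivative - of_real (1 / u)) (at u)"
      using that unfolding A_def B_def
      by (auto intro!: derivative_eq_intros has_vector_derivative_of_real simp: has_real_derivative_iff_has_vector_derivative[symmetric])
    have "((\<lambda>u. log_sine \<alpha> (A u)) has_vector_derivative (- of_real (1 / u)) * F_ext \<alpha> (A u)) (at u)"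
      "((\<lambda>u. log_sine \<alpha> (B u)) has_vector_derivative (- of_real (1 / u)) * F_ext \<alpha> (B u)) (at u)"
      using field_vector_diff_chain_at[OF dA log_sine(1)[OF assms(1) AB(1)]]
        field_vector_diff_chain_at[OF dB log_sine(1)[OF assms(1) AB(2)]] by (simp_all add: o_def)
    from has_vector_derivative_divide[OF has_vector_derivative_diff[OF this(2,1)]]
    have "(H has_vector_derivative ((- of_real (1 / u)) * F_ext \<alpha> (B u) - (- of_real (1 / u)) * F_ext \<alpha> (A u)) / (2 * pi * \<i>)) (at u)"
      unfolding H_def .
    then show ?thesis
      using that by (simp add: h_def F_eq field_simps)
  qed
  have contF: "continuous_on {0<..} (\<lambda>u. F_ext \<alpha> (A u))" "continuous_on {0<..} (\<lambda>u. F_ext \<alpha> (B u))"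
    using AB unfolding A_def B_def
    by (auto intro!: continuous_on_compose2[OF holomorphic_on_imp_continuous_on[OF F_ext_holomorphic[OF assms(1)]]]
        continuous_intros)
  have conth: "continuous_on {0<..} h"
    unfolding h_def F_eq by (intro continuous_intros contF) auto
  obtain C where C: "C > 0" "\<And>w. \<bar>Im w\<bar> \<le> pi * \<rho> \<Longrightarrow> norm (F_ext \<alpha> w) \<le> C * exp (- decay \<alpha> * Re w)"
  proof (rule norm_F_ext_le[OF assms(1)])
    show "pi * \<rho> < pi + pi / \<alpha>"
      using add_strict_increasing2[of "pi / \<alpha>" "pi * \<rho>" pi] assms by (simp add: add.commute)
  qed blast
  have h_le: "norm (h u) \<le> C / pi * u powr (decay \<alpha> - 1)" if "u > 0" for u
  proof -
    have "norm (F_ext \<alpha> (A u)) \<le> C * u powr decay \<alpha>" "norm (F_ext \<alpha> (B u)) \<le> C * u powr decay \<alpha>"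
      using C(2)[of "A u"] C(2)[of "B u"] that assms by (simp_all add: A_def B_def powr_def)
    then have "norm (F_ext \<alpha> (A u) - F_ext \<alpha> (B u)) \<le> C * u powr decay \<alpha> + C * u powr decay \<alpha>"
      using norm_triangle_ineq4 add_mono order_trans by meson
    then have "norm (h u) \<le> 1 / (2 * pi * u) * (2 * (C * u powr decay \<alpha>))"
      unfolding h_def F_eq norm_mult using that by (intro mult_mono) (auto simp: norm_divide norm_mult)
    also have "\<dots> = C / pi * u powr (decay \<alpha> - 1)"
      using that by (simp add: powr_diff)
    finally show ?thesis .
  qed
  have int: "set_integrable lborel (einterval 0 (ereal z)) h"
  proof (rule set_integrable_bound)
    show "set_integrable lborel (einterval 0 (ereal z)) (\<lambda>u. C / pi * u powr (decay \<alpha> - 1))"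
      by (intro set_integrable_mult_right set_integrable_powr_at_0 assms decay)
    show "set_borel_measurable lborel (einterval 0 (ereal z)) h"
    proof -
      have "(\<lambda>u. indicat_real (einterval 0 (ereal z)) u *\<^sub>R h u) \<in> borel_measurable borel"
        by (intro borel_measurable_continuous_on_indicator continuous_on_subset[OF conth])
           (auto simp: einterval_def zero_ereal_def)
      then show ?thesis by (simp add: set_borel_measurable_def)
    qed
    show "AE u in lborel. u \<in> einterval 0 (ereal z) \<longrightarrow> norm (h u) \<le> norm (C / pi * u powr (decay \<alpha> - 1))"
    proof (rule AE_I2, rule impI)
      fix u assume "u \<in> einterval 0 (ereal z)"
      then have "u > 0" by (auto simp: einterval_def zero_ereal_def)
      from h_le[OF this] show "norm (h u) \<le> norm (C / pi * u powr (decay \<alpha> - 1))"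
        by (rule order_trans) (simp only: real_norm_def abs_ge_self)
    qed
  qed
  have "(LBINT u=0..ereal z. h u) = H z - 0"
  proof (rule interval_integral_FTC_integrable[OF _ _ _ int])
    show "0 < ereal z" using assms by (simp add: zero_ereal_def)
    show "(H has_vector_derivative h u) (at u)" if "0 < ereal u" for u
      using der that by (simp add: zero_ereal_def)
    show "isCont h u" if "0 < ereal u" for u
      using conth that by (auto simp: continuous_on_eq_continuous_at zero_ereal_def)
    have ln0: "filterlim (\<lambda>u::real. - ln u) at_top (at_right 0)"
      by (rule filterlim_compose[OF filterlim_uminus_at_top_at_bot ln_at_0])
    have "((\<lambda>u. log_sine \<alpha> (pi * \<i> * \<rho> + of_real (- ln u))) \<longlongrightarrow> 0) (at_right 0)"
      "((\<lambda>u. log_sine \<alpha> (- pi * \<i> * \<rho> + of_real (- ln u))) \<longlongrightarrow> 0) (at_right 0)"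
      using AB[of 1] filterlim_compose[OF log_sine(2)[OF assms(1)] ln0] unfolding A_def B_def by simp_all
    from tendsto_divide[OF tendsto_diff[OF this(2,1)] tendsto_const[of "2 * pi * \<i>"]]
    have "(H \<longlongrightarrow> 0) (at_right 0)"
      by (simp add: H_def A_def B_def)
    then show "((H \<circ> real_of_ereal) \<longlongrightarrow> 0) (at_right 0)"
      unfolding zero_ereal_def ereal_tendsto_simps .
    have "isCont H z"
      using der[OF assms(4)] has_vector_derivative_continuous by blast
    then have "(H \<longlongrightarrow> H z) (at_left z)"
      by (simp add: isCont_def filterlim_at_split)
    then show "((H \<circ> real_of_ereal) \<longlongrightarrow> H z) (at_left (ereal z))"
      unfolding ereal_tendsto_simps .
  qed
  then have "phi \<alpha> \<rho> z = exp (H z)"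
    by (simp add: phi_def h_def A_def B_def)
  then show ?thesis
    by (simp add: H_def A_def B_def sine_strip_def diff_divide_distrib exp_diff)
qed

text \<open>
  The order decides between poles, zeros and regular nonzero values, which reduces all statements on
  roots and poles to \<open>zorder_phi_log\<close>.
\<close>

lemma nicely_meromorphic_pole_zero_iff_zorder:
  assumes "f nicely_meromorphic_on UNIV" "\<forall>\<^sub>F v in at w. f v \<noteq> 0"
  shows "is_pole f w \<longleftrightarrow> zorder f w < 0" "\<not> is_pole f w \<and> f w = 0 \<longleftrightarrow> zorder f w > 0"
proof -
  have mero: "f meromorphic_on {w}"
    using assms(1) meromorphic_on_subset by (auto simp: nicely_meromorphic_on_def)
  then have "isolated_singularity_at f w" by (simp add: meromorphic_at_iff)
  then show 1: "is_pole f w \<longleftrightarrow> zorder f w < 0"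
    using isolated_pole_imp_neg_zorder zorder_neg_imp_is_pole[OF mero assms(2)] by blast
  show "\<not> is_pole f w \<and> f w = 0 \<longleftrightarrow> zorder f w > 0"
  proof (cases "is_pole f w")
    case True
    then show ?thesis using 1 by auto
  next
    case False
    then have "f analytic_on {w}"
      using nicely_meromorphic_on_imp_analytic_at[OF assms(1)] by auto
    then have "zorder f w > 0 \<longleftrightarrow> f w = 0"
      by (rule zorder_pos_iff') (use assms(2) in \<open>auto intro: eventually_frequently\<close>)
    then show ?thesis using False by simp
  qed
qed

lemma eventually_at_reflect:
  fixes c w :: complex
  assumes "\<forall>\<^sub>F u in at (c - w). P u"
  shows "\<forall>\<^sub>F v in at w. P (c - v)"
proof -
  have "filterlim (\<lambda>v. c - v) (at (c - w)) (at w)"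
    by (auto simp: filterlim_at eventually_at_filter intro!: tendsto_intros)
  with assms show ?thesis by (rule eventually_compose_filterlim)
qed

lemma zorder_reflect:
  assumes "g meromorphic_on UNIV" "\<And>w. \<forall>\<^sub>F v in at w. g v \<noteq> 0"
  shows "(\<lambda>w. g (c - w)) meromorphic_on UNIV" "\<forall>\<^sub>F v in at w. g (c - v) \<noteq> 0"
    and "zorder (\<lambda>w. g (c - w)) w = zorder g (c - w)"
proof -
  show "(\<lambda>w. g (c - w)) meromorphic_on UNIV"
    by (rule meromorphic_on_compose[OF assms(1)]) (auto intro!: analytic_intros)
  show "\<forall>\<^sub>F v in at w. g (c - v) \<noteq> 0"
    using assms(2)[of "c - w"] by (rule eventually_at_reflect)
  have "g meromorphic_on {c - w}" using assms(1) by (rule meromorphic_on_subset) auto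
  then have "zorder (g \<circ> (\<lambda>w. c - w)) w = zorder g (c - w) * zorder (\<lambda>x. (c - x) - (c - w)) w"
    using assms(2)[of "c - w"]
    by (intro zorder_compose') (auto simp: meromorphic_at_iff eventually_at_filter intro!: analytic_intros)
  also have "zorder (\<lambda>x. (c - x) - (c - w)) w = 1"
    by (rule zorder_eqI[where S = UNIV and g = "\<lambda>_. - 1"]) auto
  finally show "zorder (\<lambda>w. g (c - w)) w = zorder g (c - w)" by (simp add: o_def)
qed

definition phi_quot :: "real \<Rightarrow> real \<Rightarrow> complex \<Rightarrow> complex" where
  "phi_quot \<alpha> \<rho> w = double_sine \<alpha> (- pi * \<i> * \<rho> - w) / double_sine \<alpha> (pi * \<i> * \<rho> - w)"

text \<open>
  Removing the removable singularities is needed because zeros of numerator and denominator may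
  cancel.
\<close>

definition phi_log :: "real \<Rightarrow> real \<Rightarrow> complex \<Rightarrow> complex" where
  "phi_log \<alpha> \<rho> = remove_sings (phi_quot \<alpha> \<rho>)"

lemma phi_quot_meromorphic:
  assumes "\<alpha> > 0"
  shows "phi_quot \<alpha> \<rho> meromorphic_on UNIV"
  unfolding phi_quot_def
  by (intro meromorphic_on_divide zorder_reflect double_sine_meromorphic eventually_double_sine_nonzero assms)

lemma phi_log_nicely_meromorphic: "\<alpha> > 0 \<Longrightarrow> phi_log \<alpha> \<rho> nicely_meromorphic_on UNIV"
  unfolding phi_log_def by (intro remove_sings_nicely_meromorphic phi_quot_meromorphic)

lemma eventually_phi_log_eq: "\<alpha> > 0 \<Longrightarrow> \<forall>\<^sub>F v in at w. phi_log \<alpha> \<rho> v = phi_quot \<alpha> \<rho> v"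
  unfolding phi_log_def using eventually_remove_sings_eq[OF phi_quot_meromorphic]
  by (simp add: eventually_cosparse_open_eq)

lemma eventually_phi_log_nonzero:
  assumes "\<alpha> > 0"
  shows "\<forall>\<^sub>F v in at w. phi_log \<alpha> \<rho> v \<noteq> 0"
proof -
  note nz = zorder_reflect(2)[OF double_sine_meromorphic[OF assms] eventually_double_sine_nonzero[OF assms]]
  show ?thesis
    using eventually_phi_log_eq[OF assms, where w = w and \<rho> = \<rho>] nz[where c = "- pi * \<i> * \<rho>" and w = w] nz[where c = "pi * \<i> * \<rho>" and w = w]
    by eventually_elim (simp add: phi_quot_def)
qed

lemma zorder_phi_log:
  assumes "\<alpha> > 0"
  shows "zorder (phi_log \<alpha> \<rho>) w =
    int (lattice_mult \<alpha> (w - pi * \<i> * \<rho>) + lattice_mult \<alpha> (- w - pi * \<i> * \<rho>)) -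
    int (lattice_mult \<alpha> (w + pi * \<i> * \<rho>) + lattice_mult \<alpha> (- w + pi * \<i> * \<rho>))"
proof -
  note refl = zorder_reflect[OF double_sine_meromorphic[OF assms] eventually_double_sine_nonzero[OF assms]]
  have "phi_quot \<alpha> \<rho> meromorphic_on {w}"
    using phi_quot_meromorphic[OF assms] by (rule meromorphic_on_subset) auto
  then have "zorder (phi_log \<alpha> \<rho>) w = zorder (phi_quot \<alpha> \<rho>) w"
    by (simp add: phi_log_def meromorphic_at_iff)
  also have "\<dots> = zorder (\<lambda>w. double_sine \<alpha> (- pi * \<i> * \<rho> - w)) w - zorder (\<lambda>w. double_sine \<alpha> (pi * \<i> * \<rho> - w)) w"
    unfolding phi_quot_def
    by (intro zorder_divide meromorphic_on_subset[OF refl(1)] eventually_frequently refl(2)) auto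
  also have "\<dots> = zorder (double_sine \<alpha>) (- pi * \<i> * \<rho> - w) - zorder (double_sine \<alpha>) (pi * \<i> * \<rho> - w)"
    by (simp only: refl(3))
  finally have "zorder (phi_log \<alpha> \<rho>) w = zorder (double_sine \<alpha>) (- pi * \<i> * \<rho> - w) - zorder (double_sine \<alpha>) (pi * \<i> * \<rho> - w)" .
  moreover have "- pi * \<i> * \<rho> - w = - w - pi * \<i> * \<rho>" "pi * \<i> * \<rho> - w = - w + pi * \<i> * \<rho>"
    by simp_all
  moreover have "- (- w - pi * \<i> * \<rho>) = w + pi * \<i> * \<rho>" "- (- w + pi * \<i> * \<rho>) = w - pi * \<i> * \<rho>"
    by simp_all
  ultimately show ?thesis
    by (simp only: zorder_double_sine[OF assms])
qed

section \<open>Counting the index pairs\<close>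

lemma finite_lattice_idx:
  assumes "\<alpha> > 0"
  shows "finite (lattice_idx \<alpha> w)"
proof -
  have inj: "inj_on snd (lattice_idx \<alpha> w)"
    using assms by (auto simp: inj_on_def lattice_idx_def complex_eq_iff field_simps)
  have "snd ` lattice_idx \<alpha> w \<subseteq> {..nat \<lceil>Im w\<rceil>}"
  proof (rule image_subsetI)
    fix p assume "p \<in> lattice_idx \<alpha> w"
    then obtain m k where p: "p = (m, k)" "(m, k) \<in> lattice_idx \<alpha> w" by (cases p) auto
    from p(2) have "Im w = pi * ((2 * real m + 1) / \<alpha> + (2 * real k + 1))"
      by (auto simp: lattice_idx_def)
    moreover have "(2 * real m + 1) / \<alpha> \<ge> 0" using assms by simp
    then have "real k \<le> (2 * real m + 1) / \<alpha> + (2 * real k + 1)" by linarith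
    then have "1 * real k \<le> pi * ((2 * real m + 1) / \<alpha> + (2 * real k + 1))"
      using pi_ge_two by (intro mult_mono) simp_all
    ultimately have "real k \<le> Im w" by simp
    then show "snd p \<in> {..nat \<lceil>Im w\<rceil>}" unfolding p by simp linarith
  qed
  then show ?thesis
    using inj finite_imageD finite_subset by blast
qed

lemma lattice_mult_pos_iff: "\<alpha> > 0 \<Longrightarrow> lattice_mult \<alpha> w > 0 \<longleftrightarrow> lattice_idx \<alpha> w \<noteq> {}"
  using finite_lattice_idx[of \<alpha> w] by (simp add: lattice_mult_def card_gt_0_iff)

lemma w_pt_neg:
  "w_pt \<alpha> (- int i - 1) (- int k - 1) = - lattice_pt \<alpha> i k"
proof -
  have "(2 * real_of_int (- int i - 1) + 1) / \<alpha> + (2 * real_of_int (- int k - 1) + 1) =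
      (- (2 * real i + 1)) / \<alpha> + (- (2 * real k + 1))"
    by (intro arg_cong2[of _ _ _ _ "(+)"] arg_cong2[of _ _ _ _ "(/)"]) simp_all
  also have "\<dots> = - ((2 * real i + 1) / \<alpha> + (2 * real k + 1))"
    by (simp only: minus_divide_left[symmetric] minus_add_distrib[of "(2 * real i + 1) / \<alpha>"])
  finally show ?thesis
    by (simp only: w_pt_def of_real_minus mult_minus_right)
qed

abbreviation index_pairs :: "real \<Rightarrow> complex \<Rightarrow> complex \<Rightarrow> (int \<times> int) set" where
  "index_pairs \<alpha> c w \<equiv> {(m, n). (m \<ge> 0 \<and> n \<ge> 0 \<and> w = w_pt \<alpha> m n + c) \<or> (m < 0 \<and> n < 0 \<and> w = w_pt \<alpha> m n - c)}"

text \<open>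
  The pairs of nonnegative indices and the pairs of negative indices are both in bijection with
  lattice indices, the latter through \<open>(m, n) \<mapsto> (- m - 1, - n - 1)\<close>, which changes the sign of
  \<open>w_pt\<close>. With \<open>c = \<pi> \<i> \<rho>\<close> this describes the roots and with \<open>c = - \<pi> \<i> \<rho>\<close> the poles.
\<close>

lemma index_pairs_eq:
  "index_pairs \<alpha> c w = (\<lambda>(m, k). (int m, int k)) ` lattice_idx \<alpha> (w - c) \<union> (\<lambda>(m, k). (- int m - 1, - int k - 1)) ` lattice_idx \<alpha> (- w - c)"
    (is "_ = ?A \<union> ?B")
proof (rule set_eqI, clarify)
  fix m n :: int
  have A: "(m, n) \<in> ?A \<longleftrightarrow> m \<ge> 0 \<and> n \<ge> 0 \<and> w = w_pt \<alpha> m n + c"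
  proof
    assume "m \<ge> 0 \<and> n \<ge> 0 \<and> w = w_pt \<alpha> m n + c"
    moreover from this obtain i k :: nat where ik: "m = int i" "n = int k"
      using zero_le_imp_eq_int by blast
    ultimately have "(i, k) \<in> lattice_idx \<alpha> (w - c)"
      by (simp add: lattice_idx_def w_pt_def)
    then show "(m, n) \<in> ?A" using ik by (auto intro!: rev_image_eqI)
  qed (auto simp: lattice_idx_def w_pt_def algebra_simps)
  have B: "(m, n) \<in> ?B \<longleftrightarrow> m < 0 \<and> n < 0 \<and> w = w_pt \<alpha> m n - c"
  proof
    assume *: "m < 0 \<and> n < 0 \<and> w = w_pt \<alpha> m n - c"
    then have "0 \<le> - m - 1" "0 \<le> - n - 1" by auto
    then obtain i k :: nat where ik: "- m - 1 = int i" "- n - 1 = int k"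
      using zero_le_imp_eq_int by blast
    then have mn: "m = - int i - 1" "n = - int k - 1" by auto
    have "- w - c = - w_pt \<alpha> m n" using * by simp
    also have "\<dots> = lattice_pt \<alpha> i k"
      unfolding mn w_pt_neg by simp
    finally have "(i, k) \<in> lattice_idx \<alpha> (- w - c)"
      by (simp add: lattice_idx_def)
    then show "(m, n) \<in> ?B" using mn by (auto intro!: rev_image_eqI)
  next
    assume "(m, n) \<in> ?B"
    then obtain i k where ik: "m = - int i - 1" "n = - int k - 1" "(i, k) \<in> lattice_idx \<alpha> (- w - c)"
      by auto
    have "w_pt \<alpha> m n = - lattice_pt \<alpha> i k"
      unfolding ik(1,2) w_pt_neg ..
    also have "\<dots> = - (- w - c)"
      using ik(3) by (simp add: lattice_idx_def)
    finally show "m < 0 \<and> n < 0 \<and> w = w_pt \<alpha> m n - c"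
      using ik by simp
  qed
  show "(m, n) \<in> index_pairs \<alpha> c w \<longleftrightarrow> (m, n) \<in> ?A \<union> ?B"
    unfolding Un_iff A B by simp
qed

lemma card_index_pairs:
  fixes c w :: complex
  assumes "\<alpha> > 0"
  shows "card (index_pairs \<alpha> c w) =
    lattice_mult \<alpha> (w - c) + lattice_mult \<alpha> (- w - c)"
proof -
  have "inj_on (\<lambda>(m, k). (int m, int k)) A" "inj_on (\<lambda>(m, k). (- int m - 1, - int k - 1)) A" for A
    by (auto simp: inj_on_def)
  note card = this[THEN card_image]
  show ?thesis
    unfolding index_pairs_eq
    by (subst card_Un_disjoint) (auto simp: finite_lattice_idx[OF assms] lattice_mult_def card)
qed

lemma root_mult_eq:
  "\<alpha> > 0 \<Longrightarrow> root_mult \<alpha> \<rho> w = lattice_mult \<alpha> (w - pi * \<i> * \<rho>) + lattice_mult \<alpha> (- w - pi * \<i> * \<rho>)"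
  unfolding root_mult_def by (rule card_index_pairs)

lemma pole_mult_eq:
  "\<alpha> > 0 \<Longrightarrow> pole_mult \<alpha> \<rho> w = lattice_mult \<alpha> (w + pi * \<i> * \<rho>) + lattice_mult \<alpha> (- w + pi * \<i> * \<rho>)"
  unfolding pole_mult_def using card_index_pairs[of \<alpha> w "- (pi * \<i> * \<rho>)"] by simp

lemma index_pairs_nonempty:
  fixes c w :: complex
  assumes "\<alpha> > 0"
  shows "lattice_mult \<alpha> (w - c) + lattice_mult \<alpha> (- w - c) > 0 \<longleftrightarrow>
    w \<in> {w_pt \<alpha> m n + c |m n. m \<ge> 0 \<and> n \<ge> 0} \<union> {w_pt \<alpha> m n - c |m n. m < 0 \<and> n < 0}"
proof -
  have "lattice_mult \<alpha> (w - c) + lattice_mult \<alpha> (- w - c) > 0 \<longleftrightarrow>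
      lattice_idx \<alpha> (w - c) \<noteq> {} \<or> lattice_idx \<alpha> (- w - c) \<noteq> {}"
    using lattice_mult_pos_iff[OF assms] by simp
  also have "\<dots> \<longleftrightarrow> index_pairs \<alpha> c w \<noteq> {}"
    unfolding index_pairs_eq by simp
  also have "\<dots> \<longleftrightarrow> w \<in> {w_pt \<alpha> m n + c |m n. m \<ge> 0 \<and> n \<ge> 0} \<union> {w_pt \<alpha> m n - c |m n. m < 0 \<and> n < 0}"
    by blast
  finally show ?thesis .
qed

lemma root_mult_pos_iff: "\<alpha> > 0 \<Longrightarrow> root_mult \<alpha> \<rho> w > 0 \<longleftrightarrow> w \<in> root_set \<alpha> \<rho>"
  unfolding root_mult_eq root_set_def by (rule index_pairs_nonempty)

lemma pole_mult_pos_iff: "\<alpha> > 0 \<Longrightarrow> pole_mult \<alpha> \<rho> w > 0 \<longleftrightarrow> w \<in> pole_set \<alpha> \<rho>"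
  unfolding pole_mult_eq pole_set_def using index_pairs_nonempty[of \<alpha> w "- (pi * \<i> * \<rho>)"] by simp

lemma lattice_mult_le_1_irrational:
  assumes "\<alpha> > 0" "\<alpha> \<notin> \<rat>"
  shows "lattice_mult \<alpha> w \<le> 1"
proof -
  have "p = q" if "p \<in> lattice_idx \<alpha> w" "q \<in> lattice_idx \<alpha> w" for p q
  proof -
    obtain m k m' k' where pq: "p = (m, k)" "q = (m', k')" by fastforce
    have "(2 * real m + 1) / \<alpha> + (2 * real k + 1) = (2 * real m' + 1) / \<alpha> + (2 * real k' + 1)"
      using that unfolding pq lattice_idx_def by (auto simp: complex_eq_iff)
    then have eq: "real m - real m' = \<alpha> * (real k' - real k)"
      using assms(1) by (simp add: field_simps)
    have "k = k'"
    proof (rule ccontr)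
      assume "k \<noteq> k'"
      then have "\<alpha> = (real m - real m') / (real k' - real k)" using eq by simp
      also have "\<dots> \<in> \<rat>" by simp
      finally show False using assms(2) by simp
    qed
    then show ?thesis using eq pq by simp
  qed
  then show ?thesis
    using card_le_Suc0_iff_eq[OF finite_lattice_idx[OF assms(1)]] by (simp add: lattice_mult_def)
qed

text \<open>
  Both summands being positive would require \<open>Im (w - c) > \<pi>\<close> and \<open>Im (- w - c) > \<pi>\<close>, hence
  \<open>- Im c > \<pi>\<close>.
\<close>

lemma index_pairs_le_1_irrational:
  fixes c w :: complex
  assumes "\<alpha> > 0" "\<alpha> \<notin> \<rat>" "\<bar>Im c\<bar> < pi"
  shows "lattice_mult \<alpha> (w - c) + lattice_mult \<alpha> (- w - c) \<le> 1"
proof -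
  have "Im (w - c) \<le> pi \<or> Im (- w - c) \<le> pi"
    using assms(3) by simp linarith
  then show ?thesis
  proof
    assume "Im (w - c) \<le> pi"
    then show ?thesis
      using lattice_mult_eq_0[OF assms(1)] lattice_mult_le_1_irrational[OF assms(1,2)] by simp
  next
    assume "Im (- w - c) \<le> pi"
    then have "lattice_mult \<alpha> (- w - c) = 0"
      by (rule lattice_mult_eq_0[OF assms(1)])
    then show ?thesis
      using lattice_mult_le_1_irrational[OF assms(1,2), of "w - c"] by simp
  qed
qed

section \<open>Values and quasi-periods of phi in the logarithmic variable\<close>

lemma phi_log_analytic:
  assumes "\<alpha> > 0" "\<not> is_pole (phi_log \<alpha> \<rho>) w"
  shows "phi_log \<alpha> \<rho> analytic_on {w}"
  using nicely_meromorphic_on_imp_analytic_at[OF phi_log_nicely_meromorphic] assms by auto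

lemma phi_log_of_real:
  assumes "\<alpha> > 0" "0 < \<rho>" "\<rho> < 1"
  shows "phi_log \<alpha> \<rho> (of_real x) = phi \<alpha> \<rho> (exp x)"
proof -
  have small: "0 < pi * \<rho>" "pi * \<rho> < pi" using assms by auto
  define U where "U = {w. \<bar>Im w\<bar> < pi - pi * \<rho>}"
  have U: "open U" "of_real x \<in> U"
    using small unfolding U_def by (auto intro!: open_Collect_less continuous_intros)
  have sub: "- pi * \<i> * \<rho> - w \<in> F_strip \<alpha>" "pi * \<i> * \<rho> - w \<in> F_strip \<alpha>"
    and S_eq: "double_sine \<alpha> (- pi * \<i> * \<rho> - w) = sine_strip \<alpha> (- pi * \<i> * \<rho> - w)"
      "double_sine \<alpha> (pi * \<i> * \<rho> - w) = sine_strip \<alpha> (pi * \<i> * \<rho> - w)" if "w \<in> U" for w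
  proof -
    have b: "\<bar>Im (- pi * \<i> * \<rho> - w)\<bar> \<le> pi" "\<bar>Im (pi * \<i> * \<rho> - w)\<bar> \<le> pi"
      using that small unfolding U_def mem_Collect_eq abs_le_iff abs_less_iff by simp_all
    then show "- pi * \<i> * \<rho> - w \<in> F_strip \<alpha>" "pi * \<i> * \<rho> - w \<in> F_strip \<alpha>"
      using assms by (auto intro: mem_F_stripI)
    have p: "pi < pi + min pi (pi / \<alpha>)" using assms by simp
    show "double_sine \<alpha> (- pi * \<i> * \<rho> - w) = sine_strip \<alpha> (- pi * \<i> * \<rho> - w)"
      "double_sine \<alpha> (pi * \<i> * \<rho> - w) = sine_strip \<alpha> (pi * \<i> * \<rho> - w)"
      by (rule double_sine_eq_sine_strip[OF assms(1) order_le_less_trans[OF b(1) p]])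
         (rule double_sine_eq_sine_strip[OF assms(1) order_le_less_trans[OF b(2) p]])
  qed
  have "(\<lambda>w. sine_strip \<alpha> (- pi * \<i> * \<rho> - w) / sine_strip \<alpha> (pi * \<i> * \<rho> - w)) holomorphic_on U"
    by (intro holomorphic_on_divide holomorphic_on_comp[OF sine_strip_holomorphic[OF assms(1)]] holomorphic_intros sub)
       auto
  then have "phi_quot \<alpha> \<rho> holomorphic_on U"
    by (rule holomorphic_transform) (simp only: phi_quot_def S_eq)
  then have "phi_quot \<alpha> \<rho> analytic_on {of_real x}"
    using U analytic_at by blast
  then have "phi_log \<alpha> \<rho> (of_real x) = phi_quot \<alpha> \<rho> (of_real x)"
    unfolding phi_log_def by (rule remove_sings_at_analytic)
  also have "\<dots> = phi \<alpha> \<rho> (exp x)"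
    using phi_eq_sine_strip_quotient[OF assms, of "exp x"] S_eq[OF U(2)] by (simp add: phi_quot_def)
  finally show ?thesis .
qed

text \<open>
  A relation that holds near \<open>w\<close> persists at \<open>w\<close> itself: its right-hand side has a finite limit, so
  \<open>w + c\<close> is no pole either, and a nicely meromorphic function is continuous off its poles.
\<close>

lemma nicely_meromorphic_shift_eqI:
  assumes f: "f nicely_meromorphic_on UNIV" and "\<not> is_pole f w"
    and R: "(R \<longlongrightarrow> r) (at w)" and ev: "\<forall>\<^sub>F v in at w. f (v + c) = f v * R v"
  shows "f (w + c) = f w * r"
proof -
  have "isCont f w"
    using nicely_meromorphic_on_imp_analytic_at[OF f _ assms(2)] analytic_at_imp_isCont by auto
  then have "((\<lambda>v. f v * R v) \<longlongrightarrow> f w * r) (at w)"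
    using R by (auto simp: isCont_def intro!: tendsto_intros)
  then have "((\<lambda>v. f (v + c)) \<longlongrightarrow> f w * r) (at w)"
    by (rule Lim_transform_eventually) (use ev in \<open>auto elim!: eventually_mono\<close>)
  then have lim: "(f \<longlongrightarrow> f w * r) (at (w + c))"
    unfolding filterlim_def filtermap_at_shift[of "- c" w, simplified, symmetric] filtermap_filtermap by simp
  have "\<not> is_pole f (w + c)"
    using lim unfolding is_pole_def using not_tendsto_and_filterlim_at_infinity at_neq_bot by blast
  then have "(f \<longlongrightarrow> f (w + c)) (at (w + c))"
    using f unfolding nicely_meromorphic_on_def by auto
  then show ?thesis using lim LIM_unique by blast
qed

lemma phi_log_shift:
  assumes "\<alpha> > 0" "\<not> is_pole (phi_log \<alpha> \<rho>) w"
    and "1 + exp (\<alpha> * w + pi * \<i> * \<alpha> * (1 + \<rho>)) \<noteq> 0"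
  shows "phi_log \<alpha> \<rho> (w + 2 * pi * \<i>) = phi_log \<alpha> \<rho> w *
    ((1 + exp (\<alpha> * w + pi * \<i> * \<alpha> * (1 - \<rho>))) / (1 + exp (\<alpha> * w + pi * \<i> * \<alpha> * (1 + \<rho>))))"
proof -
  define R where "R = (\<lambda>w::complex. (1 + exp (\<alpha> * w + pi * \<i> * \<alpha> * (1 - \<rho>))) / (1 + exp (\<alpha> * w + pi * \<i> * \<alpha> * (1 + \<rho>))))"
  let ?a = "- pi * \<i> * \<rho>" and ?b = "pi * \<i> * \<rho>"
  have fac: "sine_factor \<alpha> (?a - v) = 1 + exp (\<alpha> * v + pi * \<i> * \<alpha> * (1 + \<rho>))"
    "sine_factor \<alpha> (?b - v) = 1 + exp (\<alpha> * v + pi * \<i> * \<alpha> * (1 - \<rho>))" for v :: complex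
    by (simp_all add: sine_factor_def algebra_simps)
  have ev_fac: "\<forall>\<^sub>F v in at w. sine_factor \<alpha> (c - v) \<noteq> 0" for c
    using eventually_sine_factor_nonzero[OF assms(1), where c = 0]
    by (intro eventually_at_reflect) simp
  have "\<forall>\<^sub>F v in at w. phi_log \<alpha> \<rho> (v + 2 * pi * \<i>) = phi_quot \<alpha> \<rho> (v + 2 * pi * \<i>)"
    using eventually_at_translate[of "\<lambda>v. phi_log \<alpha> \<rho> v = phi_quot \<alpha> \<rho> v" w "- (2 * pi * \<i>)"]
      eventually_phi_log_eq[OF assms(1)] by simp
  then have ev_shift: "\<forall>\<^sub>F v in at w. phi_log \<alpha> \<rho> (v + 2 * pi * \<i>) = phi_log \<alpha> \<rho> v * R v"
    using eventually_phi_log_eq[OF assms(1), where w = w and \<rho> = \<rho>] ev_fac[of ?a] ev_fac[of ?b]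
  proof eventually_elim
    case (elim v)
    have s: "c - (v + 2 * pi * \<i>) = (c - v) - 2 * pi * \<i>" for c :: complex by simp
    have "phi_log \<alpha> \<rho> (v + 2 * pi * \<i>) = double_sine \<alpha> (?a - v - 2 * pi * \<i>) / double_sine \<alpha> (?b - v - 2 * pi * \<i>)"
      by (simp only: elim(1) phi_quot_def s)
    moreover have "phi_log \<alpha> \<rho> v = (sine_factor \<alpha> (?a - v) * double_sine \<alpha> (?a - v - 2 * pi * \<i>)) /
        (sine_factor \<alpha> (?b - v) * double_sine \<alpha> (?b - v - 2 * pi * \<i>))"
      by (simp only: elim(2) phi_quot_def double_sine_shift[OF elim(3)] double_sine_shift[OF elim(4)])
    ultimately show ?case
      using elim(3,4) fac[of v] by (simp add: R_def)
  qed
  have "(R \<longlongrightarrow> R w) (at w)"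
    unfolding R_def using assms(3) by (intro tendsto_intros) auto
  from nicely_meromorphic_shift_eqI[OF phi_log_nicely_meromorphic[OF assms(1)] assms(2) this ev_shift]
  show ?thesis by (simp add: R_def)
qed

lemma phi_log_shift_reciprocal:
  assumes "\<alpha> > 0" "\<not> is_pole (phi_log \<alpha> \<rho>) w"
    and "1 + exp (w + pi * \<i> * (1 / \<alpha> + \<rho>)) \<noteq> 0"
  shows "phi_log \<alpha> \<rho> (w + 2 * pi * \<i> / \<alpha>) = phi_log \<alpha> \<rho> w *
    ((1 + exp (w + pi * \<i> * (1 / \<alpha> - \<rho>))) / (1 + exp (w + pi * \<i> * (1 / \<alpha> + \<rho>))))"
proof -
  define R where "R = (\<lambda>w::complex. (1 + exp (w + pi * \<i> * (1 / \<alpha> - \<rho>))) / (1 + exp (w + pi * \<i> * (1 / \<alpha> + \<rho>))))"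
  let ?a = "- pi * \<i> * \<rho>" and ?b = "pi * \<i> * \<rho>"
  have fac: "sine_factor (1 / \<alpha>) (of_real \<alpha> * (?a - v)) = 1 + exp (v + pi * \<i> * (1 / \<alpha> + \<rho>))"
    "sine_factor (1 / \<alpha>) (of_real \<alpha> * (?b - v)) = 1 + exp (v + pi * \<i> * (1 / \<alpha> - \<rho>))" for v :: complex
  proof -
    have arg: "of_real (1 / \<alpha>) * (of_real \<alpha> * u - pi * \<i>) = u - pi * \<i> / of_real \<alpha>" for u :: complex
      using assms(1) by (simp add: field_simps)
    show "sine_factor (1 / \<alpha>) (of_real \<alpha> * (?a - v)) = 1 + exp (v + pi * \<i> * (1 / \<alpha> + \<rho>))"
      "sine_factor (1 / \<alpha>) (of_real \<alpha> * (?b - v)) = 1 + exp (v + pi * \<i> * (1 / \<alpha> - \<rho>))"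
      unfolding sine_factor_def arg by (simp_all add: algebra_simps)
  qed
  have ev: "\<forall>\<^sub>F v in at w. double_sine \<alpha> (c - v) = sine_factor (1 / \<alpha>) (of_real \<alpha> * (c - v)) * double_sine \<alpha> ((c - v) - 2 * pi * \<i> / of_real \<alpha>)" for c
    by (rule eventually_at_reflect[OF double_sine_shift_reciprocal[OF assms(1)]])
  have nz: "\<forall>\<^sub>F v in at w. double_sine \<alpha> (c - v) \<noteq> 0" for c
    by (rule eventually_at_reflect[OF eventually_double_sine_nonzero[OF assms(1)]])
  have "\<forall>\<^sub>F v in at w. phi_log \<alpha> \<rho> (v + 2 * pi * \<i> / \<alpha>) = phi_quot \<alpha> \<rho> (v + 2 * pi * \<i> / \<alpha>)"
    using eventually_at_translate[of "\<lambda>v. phi_log \<alpha> \<rho> v = phi_quot \<alpha> \<rho> v" w "- (2 * pi * \<i> / \<alpha>)"]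
      eventually_phi_log_eq[OF assms(1)] by simp
  then have ev_shift: "\<forall>\<^sub>F v in at w. phi_log \<alpha> \<rho> (v + 2 * pi * \<i> / \<alpha>) = phi_log \<alpha> \<rho> v * R v"
    using eventually_phi_log_eq[OF assms(1), where w = w and \<rho> = \<rho>] ev[of ?a] ev[of ?b] nz[of ?a] nz[of ?b]
  proof eventually_elim
    case (elim v)
    have s: "c - (v + 2 * pi * \<i> / \<alpha>) = (c - v) - 2 * pi * \<i> / \<alpha>" for c :: complex by simp
    have "sine_factor (1 / \<alpha>) (of_real \<alpha> * (?a - v)) \<noteq> 0" "sine_factor (1 / \<alpha>) (of_real \<alpha> * (?b - v)) \<noteq> 0"
      using elim(3-6) by auto
    moreover have "phi_log \<alpha> \<rho> (v + 2 * pi * \<i> / \<alpha>) = double_sine \<alpha> (?a - v - 2 * pi * \<i> / \<alpha>) / double_sine \<alpha> (?b - v - 2 * pi * \<i> / \<alpha>)"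
      by (simp only: elim(1) phi_quot_def s)
    moreover have "phi_log \<alpha> \<rho> v = (sine_factor (1 / \<alpha>) (of_real \<alpha> * (?a - v)) * double_sine \<alpha> (?a - v - 2 * pi * \<i> / \<alpha>)) /
        (sine_factor (1 / \<alpha>) (of_real \<alpha> * (?b - v)) * double_sine \<alpha> (?b - v - 2 * pi * \<i> / \<alpha>))"
      unfolding elim(2) phi_quot_def by (intro arg_cong2[of _ _ _ _ "(/)"] elim(3,4))
    ultimately show ?case
      using fac[of v] by (simp add: R_def)
  qed
  have "(R \<longlongrightarrow> R w) (at w)"
    unfolding R_def using assms(3) by (intro tendsto_intros) auto
  from nicely_meromorphic_shift_eqI[OF phi_log_nicely_meromorphic[OF assms(1)] assms(2) this ev_shift]
  show ?thesis by (simp add: R_def)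
qed

section \<open>The slit plane and the branch point\<close>

text \<open>
  All lattice points are purely imaginary.
\<close>

lemma phi_log_regular_off_imaginary_axis:
  assumes "\<alpha> > 0" "Re w \<noteq> 0"
  shows "phi_log \<alpha> \<rho> analytic_on {w}" "phi_log \<alpha> \<rho> w \<noteq> 0"
proof -
  have "lattice_mult \<alpha> v = 0" if "Re v \<noteq> 0" for v
  proof -
    have "lattice_idx \<alpha> v = {}" using that by (auto simp: lattice_idx_def)
    then show ?thesis by (simp add: lattice_mult_def)
  qed
  then have 0: "zorder (phi_log \<alpha> \<rho>) w = 0"
    using assms by (simp add: zorder_phi_log)
  note iff = nicely_meromorphic_pole_zero_iff_zorder[OF phi_log_nicely_meromorphic[OF assms(1)] eventually_phi_log_nonzero[OF assms(1)]]
  show "phi_log \<alpha> \<rho> analytic_on {w}"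
    using 0 iff(1)[of \<rho> w] phi_log_analytic[OF assms(1)] by simp
  show "phi_log \<alpha> \<rho> w \<noteq> 0"
    using 0 iff(1,2)[of \<rho> w] by simp
qed

text \<open>
  The sign \<open>s\<close> distinguishes the two points of a conjugate pair, and the exponent is the principal
  logarithm because of the last two bounds.
\<close>

lemma slit_poleE:
  assumes "\<alpha> > 0" "0 < \<rho>" "\<rho> < 1" "z \<in> slit_poles \<alpha> \<rho>"
  obtains m :: nat and s :: real where "2 * real m + 1 < \<alpha> * \<rho>" "s = 1 \<or> s = -1"
    "z = exp (\<i> * of_real (s * pi * (1 + (2 * real m + 1) / \<alpha> - \<rho>)))"
    "0 < 1 + (2 * real m + 1) / \<alpha> - \<rho>" "1 + (2 * real m + 1) / \<alpha> - \<rho> < 1"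
proof -
  from assms(4) obtain m :: nat where m: "2 * real m + 1 < \<alpha> * \<rho>"
    and z: "z = - exp (pi * \<i> * of_real (\<rho> - (2 * real m + 1) / \<alpha>)) \<or> z = - exp (- pi * \<i> * of_real (\<rho> - (2 * real m + 1) / \<alpha>))"
    by (auto simp: slit_poles_def)
  define x where "x = (2 * real m + 1) / \<alpha>"
  define t where "t = 1 + x - \<rho>"
  have "x < \<rho>" using m assms(1) by (simp add: x_def field_simps)
  moreover have "x > 0" using assms(1) by (simp add: x_def)
  ultimately have t: "0 < t" "t < 1" unfolding t_def using assms(3) by linarith+
  have e: "pi * \<i> * of_real (\<rho> - x) = \<i> * of_real (- 1 * pi * t) + pi * \<i>"
    "- pi * \<i> * of_real (\<rho> - x) = \<i> * of_real (1 * pi * t) - pi * \<i>"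
    by (simp_all add: t_def algebra_simps)
  have "- exp (pi * \<i> * of_real (\<rho> - x)) = exp (\<i> * of_real (- 1 * pi * t))"
    "- exp (- pi * \<i> * of_real (\<rho> - x)) = exp (\<i> * of_real (1 * pi * t))"
    unfolding e by (simp_all only: exp_add exp_diff exp_pi_i) simp_all
  then have "z = exp (\<i> * of_real (- 1 * pi * t)) \<or> z = exp (\<i> * of_real (1 * pi * t))"
    using z unfolding x_def[symmetric] by presburger
  then show ?thesis
    using that[of m "-1"] that[of m 1] m t unfolding t_def x_def by blast
qed

lemma slit_plane_altdef: "slit_plane = - \<real>\<^sub>\<le>\<^sub>0"
proof -
  have "z \<noteq> 0 \<and> \<bar>Arg z\<bar> < pi \<longleftrightarrow> z \<notin> \<real>\<^sub>\<le>\<^sub>0" for z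
  proof (cases "z = 0")
    case False
    have "\<bar>Arg z\<bar> < pi \<longleftrightarrow> Arg z \<noteq> pi"
      using Arg_le_pi[of z] mpi_less_Arg[of z] by linarith
    also have "\<dots> \<longleftrightarrow> z \<notin> \<real>\<^sub>\<le>\<^sub>0"
      using False by (auto simp: Arg_eq_pi complex_nonpos_Reals_iff complex_eq_iff)
    finally show ?thesis using False by simp
  qed auto
  then show ?thesis by (auto simp: slit_plane_def)
qed

lemma Ln_exp_imaginary:
  assumes "\<bar>s\<bar> < 1" "z = exp (\<i> * of_real (s * pi))"
  shows "Ln z = \<i> * of_real (s * pi)" "z \<in> slit_plane"
proof -
  have b: "\<bar>s * pi\<bar> < pi" using assms(1) by (simp add: abs_mult)
  then show Ln: "Ln z = \<i> * of_real (s * pi)"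
    using assms by (intro Ln_unique) (auto simp: abs_less_iff)
  have z: "z \<noteq> 0" using assms(2) by simp
  have "Arg z = s * pi"
    using Arg_eq_Im_Ln[OF z] Ln by simp
  then show "z \<in> slit_plane"
    using b z by (simp add: slit_plane_def)
qed

lemma lattice_mult_le_1:
  assumes "\<alpha> > 0" "Im w \<le> 3 * pi"
  shows "lattice_mult \<alpha> w \<le> 1"
proof (cases "Im w \<le> pi")
  case True
  then show ?thesis using lattice_mult_eq_0[OF assms(1)] by simp
next
  case False
  have "lattice_mult \<alpha> w = card {k. k < 1 \<and> sine_factor \<alpha> (w - 2 * pi * \<i> * of_nat k) = 0}"
    by (rule lattice_mult_eq) (use assms False in auto)
  also have "\<dots> \<le> card {0::nat}"
    by (intro card_mono) auto
  finally show ?thesis by simp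
qed

text \<open>
  For roots, one of \<open>\<plusminus>w - \<pi> \<i> \<rho>\<close> would be a lattice point, but these have imaginary part below \<open>\<pi>\<close>. For poles,
  one of \<open>\<plusminus>w + \<pi> \<i> \<rho>\<close> is a lattice point with imaginary part between \<open>\<pi>\<close> and \<open>3 \<pi>\<close>, which forces
  \<open>k = 0\<close> and leaves one choice of \<open>m\<close>.
\<close>

lemma zorder_phi_log_strip:
  assumes "\<alpha> > 0" "0 < \<rho>" "\<rho> < 1" "\<bar>Im w\<bar> < pi"
  shows "zorder (phi_log \<alpha> \<rho>) w = - int (pole_mult \<alpha> \<rho> w)" "pole_mult \<alpha> \<rho> w \<le> 1"
proof -
  have r: "0 < pi * \<rho>" "pi * \<rho> < pi" using assms by auto
  have "Im (w - pi * \<i> * \<rho>) \<le> pi" "Im (- w - pi * \<i> * \<rho>) \<le> pi"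
    using assms(4) r by (simp_all add: abs_less_iff)
  then have "lattice_mult \<alpha> (w - pi * \<i> * \<rho>) = 0" "lattice_mult \<alpha> (- w - pi * \<i> * \<rho>) = 0"
    using lattice_mult_eq_0[OF assms(1)] by auto
  then show "zorder (phi_log \<alpha> \<rho>) w = - int (pole_mult \<alpha> \<rho> w)"
    unfolding zorder_phi_log[OF assms(1)] pole_mult_eq[OF assms(1)] by (simp only:)
  have "Im w + pi * \<rho> \<le> 3 * pi" "- Im w + pi * \<rho> \<le> 3 * pi"
    using assms(4) r by linarith+
  then have le: "lattice_mult \<alpha> (w + pi * \<i> * \<rho>) \<le> 1" "lattice_mult \<alpha> (- w + pi * \<i> * \<rho>) \<le> 1"
    using lattice_mult_le_1[OF assms(1), of "w + pi * \<i> * \<rho>"]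
      lattice_mult_le_1[OF assms(1), of "- w + pi * \<i> * \<rho>"] by simp_all
  have "Im w + pi * \<rho> \<le> pi \<or> - Im w + pi * \<rho> \<le> pi"
    using r by linarith
  then have "Im (w + pi * \<i> * \<rho>) \<le> pi \<or> Im (- w + pi * \<i> * \<rho>) \<le> pi"
    by simp
  then show "pole_mult \<alpha> \<rho> w \<le> 1"
  proof
    assume "Im (w + pi * \<i> * \<rho>) \<le> pi"
    then have "lattice_mult \<alpha> (w + pi * \<i> * \<rho>) = 0"
      by (rule lattice_mult_eq_0[OF assms(1)])
    then show ?thesis using le(2) by (simp add: pole_mult_eq[OF assms(1)])
  next
    assume "Im (- w + pi * \<i> * \<rho>) \<le> pi"
    then have "lattice_mult \<alpha> (- w + pi * \<i> * \<rho>) = 0"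
      by (rule lattice_mult_eq_0[OF assms(1)])
    then show ?thesis using le(1) by (simp add: pole_mult_eq[OF assms(1)])
  qed
qed

text \<open>
  The bound \<open>Im w < \<pi>\<close> on a pole forces \<open>k = 0\<close>, and then it says precisely \<open>2 m + 1 < \<alpha> \<rho>\<close>.
\<close>

lemma exp_pole_in_slit_poles:
  assumes "\<alpha> > 0" "0 < \<rho>" "\<rho> < 1" "\<bar>Im w\<bar> < pi" "pole_mult \<alpha> \<rho> w > 0"
  shows "exp w \<in> slit_poles \<alpha> \<rho>"
proof -
  have *: "2 * real m + 1 < \<alpha> * \<rho> \<and> v = pi * \<i> * of_real (1 + (2 * real m + 1) / \<alpha> - \<rho>)"
    if mk: "(m, k) \<in> lattice_idx \<alpha> (v + pi * \<i> * \<rho>)" and v: "Im v < pi" for m k v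
  proof -
    have eq: "v + pi * \<i> * \<rho> = pi * \<i> * of_real ((2 * real m + 1) / \<alpha> + (2 * real k + 1))"
      using mk by (simp add: lattice_idx_def)
    from arg_cong[OF eq, of Im] have "Im v = pi * ((2 * real m + 1) / \<alpha> + (2 * real k + 1) - \<rho>)"
      by (simp add: algebra_simps)
    then have "pi * ((2 * real m + 1) / \<alpha> + (2 * real k + 1) - \<rho>) < pi * 1" using v by simp
    then have less: "(2 * real m + 1) / \<alpha> + 2 * real k < \<rho>"
      by (simp only: mult_less_cancel_left_pos[OF pi_gt_zero])
    moreover have "(2 * real m + 1) / \<alpha> > 0" using assms(1) by simp
    ultimately have "2 * real k < 1" using assms(3) by linarith
    then have k: "k = 0" by simp
    have "2 * real m + 1 < \<alpha> * \<rho>"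
      using less k assms(1) by (simp add: field_simps)
    moreover have "v = pi * \<i> * of_real (1 + (2 * real m + 1) / \<alpha> - \<rho>)"
      using eq k by (simp add: algebra_simps)
    ultimately show ?thesis by blast
  qed
  have e: "exp (pi * \<i> * of_real (1 + x - \<rho>)) = - exp (- pi * \<i> * of_real (\<rho> - x))"
    "exp (- (pi * \<i> * of_real (1 + x - \<rho>))) = - exp (pi * \<i> * of_real (\<rho> - x))" for x
  proof -
    have "pi * \<i> * of_real (1 + x - \<rho>) = - pi * \<i> * of_real (\<rho> - x) + pi * \<i>"
      "- (pi * \<i> * of_real (1 + x - \<rho>)) = pi * \<i> * of_real (\<rho> - x) - pi * \<i>"
      by (simp_all add: algebra_simps)
    then show "exp (pi * \<i> * of_real (1 + x - \<rho>)) = - exp (- pi * \<i> * of_real (\<rho> - x))"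
      "exp (- (pi * \<i> * of_real (1 + x - \<rho>))) = - exp (pi * \<i> * of_real (\<rho> - x))"
      by (simp_all only: exp_add exp_diff exp_pi_i) simp_all
  qed
  from assms(5) have "lattice_mult \<alpha> (w + pi * \<i> * \<rho>) > 0 \<or> lattice_mult \<alpha> (- w + pi * \<i> * \<rho>) > 0"
    unfolding pole_mult_eq[OF assms(1)] by simp
  then show ?thesis
  proof
    assume "lattice_mult \<alpha> (w + pi * \<i> * \<rho>) > 0"
    then obtain m k where "(m, k) \<in> lattice_idx \<alpha> (w + pi * \<i> * \<rho>)"
      using lattice_mult_pos_iff[OF assms(1)] by fastforce
    from *[OF this] assms(4) have m: "2 * real m + 1 < \<alpha> * \<rho>" "w = pi * \<i> * of_real (1 + (2 * real m + 1) / \<alpha> - \<rho>)"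
      by auto
    show ?thesis
      unfolding slit_poles_def using m(1) unfolding m(2) e by blast
  next
    assume "lattice_mult \<alpha> (- w + pi * \<i> * \<rho>) > 0"
    then obtain m k where "(m, k) \<in> lattice_idx \<alpha> (- w + pi * \<i> * \<rho>)"
      using lattice_mult_pos_iff[OF assms(1)] by fastforce
    from *[OF this] assms(4) have m: "2 * real m + 1 < \<alpha> * \<rho>" "- w = pi * \<i> * of_real (1 + (2 * real m + 1) / \<alpha> - \<rho>)"
      by auto
    from m(2) have w: "w = - (pi * \<i> * of_real (1 + (2 * real m + 1) / \<alpha> - \<rho>))"
      by (metis minus_minus)
    show ?thesis
      unfolding slit_poles_def using m(1) unfolding w e by blast
  qed
qed

lemma Ln_slit_pole:
  assumes "\<alpha> > 0" "0 < \<rho>" "\<rho> < 1" "z \<in> slit_poles \<alpha> \<rho>"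
  shows "z \<in> slit_plane" "pole_mult \<alpha> \<rho> (Ln z) > 0"
proof -
  obtain m :: nat and s :: real where m: "2 * real m + 1 < \<alpha> * \<rho>" and s: "s = 1 \<or> s = -1"
    and z: "z = exp (\<i> * of_real (s * pi * (1 + (2 * real m + 1) / \<alpha> - \<rho>)))"
    and t: "0 < 1 + (2 * real m + 1) / \<alpha> - \<rho>" "1 + (2 * real m + 1) / \<alpha> - \<rho> < 1"
    using slit_poleE[OF assms] by blast
  define t where "t = 1 + (2 * real m + 1) / \<alpha> - \<rho>"
  have st: "\<bar>s * t\<bar> < 1" using s t by (auto simp: t_def)
  have z': "z = exp (\<i> * of_real ((s * t) * pi))"
    unfolding z t_def by (simp only: mult_ac)
  note Ln = Ln_exp_imaginary[OF st z']
  show "z \<in> slit_plane" by (rule Ln(2))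
  have idx: "pi * \<i> * of_real t + pi * \<i> * \<rho> = pi * \<i> * of_real ((2 * real m + 1) / \<alpha> + (2 * real 0 + 1))"
    by (simp add: t_def algebra_simps)
  then have "(m, 0) \<in> lattice_idx \<alpha> (pi * \<i> * of_real t + pi * \<i> * \<rho>)"
    by (simp add: lattice_idx_def)
  then have pos: "lattice_mult \<alpha> (pi * \<i> * of_real t + pi * \<i> * \<rho>) > 0"
    using lattice_mult_pos_iff[OF assms(1)] by blast
  have "Ln z = pi * \<i> * of_real t \<or> - Ln z = pi * \<i> * of_real t"
    using s unfolding Ln(1) by auto
  then show "pole_mult \<alpha> \<rho> (Ln z) > 0"
    unfolding pole_mult_eq[OF assms(1)] using pos by (elim disjE) simp_all
qed

lemma simple_pole_compose_Ln:
  assumes "f meromorphic_on UNIV" "\<forall>\<^sub>F v in at (Ln z). f v \<noteq> 0" "z \<notin> \<real>\<^sub>\<le>\<^sub>0" "zorder f (Ln z) = -1"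
  shows "simple_pole (\<lambda>z. f (Ln z)) z"
proof -
  have z: "z \<noteq> 0" using assms(3) by auto
  have Ln: "Ln analytic_on {z}" using assms(3) by (intro analytic_intros) auto
  have der: "(Ln has_field_derivative inverse z) (at z)"
    using assms(3) by (rule has_field_derivative_Ln)
  have ord: "zorder (\<lambda>x. Ln x - Ln z) z = 1"
  proof (rule zorder_zero_eqI')
    show "(\<lambda>x. Ln x - Ln z) analytic_on {z}" by (intro analytic_on_diff Ln analytic_on_const)
    have "((\<lambda>x. Ln x - Ln z) has_field_derivative inverse z - 0) (at z)"
      by (intro DERIV_diff der DERIV_const)
    then show "(deriv ^^ nat 1) (\<lambda>x. Ln x - Ln z) z \<noteq> 0"
      using z by (simp add: DERIV_imp_deriv)
  qed auto
  have ne: "\<forall>\<^sub>F x in at z. Ln x \<noteq> Ln z"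
  proof -
    have "\<forall>\<^sub>F x in at z. x \<noteq> 0" using z eventually_neq_at_within by blast
    moreover have "\<forall>\<^sub>F x in at z. x \<noteq> z" by (simp add: eventually_at_filter)
    ultimately show ?thesis by eventually_elim (use z in \<open>metis exp_Ln\<close>)
  qed
  have mero: "f meromorphic_on {Ln z}" using assms(1) by (rule meromorphic_on_subset) auto
  have pole: "is_pole f (Ln z)"
    using zorder_neg_imp_is_pole[OF mero assms(2)] assms(4) by simp
  have "is_pole (\<lambda>z. f (Ln z)) z"
    by (rule is_pole_compose[OF pole _ ne]) (use Ln analytic_at_imp_isCont isContD in blast)
  moreover have "zorder (f \<circ> Ln) z = zorder f (Ln z) * zorder (\<lambda>x. Ln x - Ln z) z"
    using mero by (intro zorder_compose' Ln assms(2) ne) (auto simp: meromorphic_at_iff)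
  then have "zorder (\<lambda>z. f (Ln z)) z = -1"
    using ord assms(4) by (simp add: o_def)
  ultimately show ?thesis by (simp add: simple_pole_def)
qed

lemma phi_log_Ln_holomorphic:
  assumes "\<alpha> > 0" "0 < \<rho>" "\<rho> < 1"
  shows "(\<lambda>z. phi_log \<alpha> \<rho> (Ln z)) holomorphic_on slit_plane - slit_poles \<alpha> \<rho>"
proof -
  have "(\<lambda>z. phi_log \<alpha> \<rho> (Ln z)) analytic_on {z}" if z: "z \<in> slit_plane - slit_poles \<alpha> \<rho>" for z
  proof -
    have z0: "z \<notin> \<real>\<^sub>\<le>\<^sub>0" "z \<noteq> 0" using z by (auto simp: slit_plane_altdef)
    have Im: "\<bar>Im (Ln z)\<bar> < pi"
      using Im_Ln_less_pi[OF z0(1)] mpi_less_Im_Ln[OF z0(2)] by linarith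
    have "pole_mult \<alpha> \<rho> (Ln z) = 0"
      using exp_pole_in_slit_poles[OF assms Im] z z0 by auto
    then have "zorder (phi_log \<alpha> \<rho>) (Ln z) = 0"
      using zorder_phi_log_strip(1)[OF assms Im] by simp
    then have "\<not> is_pole (phi_log \<alpha> \<rho>) (Ln z)"
      using nicely_meromorphic_pole_zero_iff_zorder(1)[OF phi_log_nicely_meromorphic eventually_phi_log_nonzero, OF assms(1) assms(1)] by simp
    then have "phi_log \<alpha> \<rho> analytic_on {Ln z}" by (rule phi_log_analytic[OF assms(1)])
    moreover have "Ln analytic_on {z}" using z0 by (intro analytic_intros) auto
    ultimately have "phi_log \<alpha> \<rho> \<circ> Ln analytic_on {z}"
      by (intro analytic_on_compose) auto
    then show ?thesis by (simp add: o_def)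
  qed
  then show ?thesis
    by (meson analytic_imp_holomorphic analytic_on_analytic_at)
qed

lemma exp_eq_1_iff_Ints: "exp (2 * pi * \<i> * of_real x) = 1 \<longleftrightarrow> x \<in> \<int>"
proof
  assume "exp (2 * pi * \<i> * of_real x) = 1"
  then obtain n :: int where "2 * pi * x = of_int (2 * n) * pi"
    unfolding exp_eq_1 by auto
  then have "x = of_int n" by simp
  then show "x \<in> \<int>" by simp
next
  assume "x \<in> \<int>"
  then obtain n where "x = of_int n" by (auto elim: Ints_cases)
  then show "exp (2 * pi * \<i> * of_real x) = 1"
    unfolding exp_eq_1 by auto
qed

text \<open>
  The multiplier is \<open>(1 + N) / (1 + D)\<close> with \<open>D = N exp (2 \<pi> \<i> \<alpha> \<rho>)\<close>. The denominator does not vanish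
  because \<open>|D| < 1\<close> in the left half-plane, and \<open>phi_log\<close> has no zeros there.
\<close>

lemma phi_log_monodromy:
  assumes "\<alpha> > 0" "Re w < 0"
  shows "phi_log \<alpha> \<rho> (w + 2 * pi * \<i>) = phi_log \<alpha> \<rho> w \<longleftrightarrow> \<alpha> * \<rho> \<in> \<int>"
proof -
  define N where "N = exp (\<alpha> * w + pi * \<i> * \<alpha> * (1 - \<rho>))"
  define D where "D = exp (\<alpha> * w + pi * \<i> * \<alpha> * (1 + \<rho>))"
  have "norm D = exp (\<alpha> * Re w)" by (simp add: D_def)
  also have "\<dots> < 1" using assms by (simp add: mult_pos_neg)
  finally have D: "1 + D \<noteq> 0"
    by (metis add.inverse_unique norm_minus_cancel norm_one less_irrefl)
  have "D = N * exp (2 * pi * \<i> * of_real (\<alpha> * \<rho>))"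
    unfolding D_def N_def exp_add[symmetric] by (simp add: algebra_simps)
  moreover have "N \<noteq> 0" by (simp add: N_def)
  ultimately have ND: "N = D \<longleftrightarrow> \<alpha> * \<rho> \<in> \<int>"
    unfolding exp_eq_1_iff_Ints[symmetric] by simp
  note reg = phi_log_regular_off_imaginary_axis[OF assms(1), of w \<rho>]
  have "\<not> is_pole (phi_log \<alpha> \<rho>) w"
    using reg(1) assms(2) analytic_at_imp_no_pole by auto
  then have shift: "phi_log \<alpha> \<rho> (w + 2 * pi * \<i>) = phi_log \<alpha> \<rho> w * ((1 + N) / (1 + D))"
    using phi_log_shift[OF assms(1), of \<rho> w] D by (simp add: N_def D_def)
  have "phi_log \<alpha> \<rho> (w + 2 * pi * \<i>) = phi_log \<alpha> \<rho> w \<longleftrightarrow> (1 + N) / (1 + D) = 1"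
    unfolding shift mult_cancel_left2 using reg(2) assms(2) by simp
  also have "\<dots> \<longleftrightarrow> N = D" using D by (simp add: field_simps)
  finally show ?thesis using ND by simp
qed

text \<open>
  Any continuation \<open>g\<close> as in the definition of a branch point agrees with \<open>phi_log\<close> on a left
  half-plane, by the identity theorem. Hence its monodromy is the one of \<open>phi_log\<close>.
\<close>

lemma branch_point_phi_log_Ln:
  assumes "\<alpha> > 0"
  shows "branch_point (\<lambda>z. phi_log \<alpha> \<rho> (Ln z)) 0 \<longleftrightarrow> \<alpha> * \<rho> \<notin> \<int>"
proof
  assume *: "\<alpha> * \<rho> \<notin> \<int>"
  have "phi_log \<alpha> \<rho> analytic_on {w. Re w < 0}"
    using phi_log_regular_off_imaginary_axis(1)[OF assms] by (subst analytic_on_analytic_at) auto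
  then have "phi_log \<alpha> \<rho> holomorphic_on {w. Re w < 0}" by (rule analytic_imp_holomorphic)
  moreover have "phi_log \<alpha> \<rho> (-1 + 2 * pi * \<i>) \<noteq> phi_log \<alpha> \<rho> (-1)"
    using phi_log_monodromy[OF assms, of "-1"] * by simp
  ultimately show "branch_point (\<lambda>z. phi_log \<alpha> \<rho> (Ln z)) 0"
    unfolding branch_point_def
    by (intro exI[of _ "0::real"] exI[of _ "phi_log \<alpha> \<rho>"]) (auto intro!: exI[of _ "-1::complex"])
next
  assume "branch_point (\<lambda>z. phi_log \<alpha> \<rho> (Ln z)) 0"
  then obtain c :: real and g where g: "g holomorphic_on {w. Re w < c}"
    "\<And>w. Re w < c \<Longrightarrow> \<bar>Im w\<bar> < pi \<Longrightarrow> phi_log \<alpha> \<rho> (Ln (0 + exp w)) = g w"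
    and ne: "\<exists>w. Re w < c \<and> g (w + 2 * pi * \<i>) \<noteq> g w"
    unfolding branch_point_def by blast
  show "\<alpha> * \<rho> \<notin> \<int>"
  proof
    assume int: "\<alpha> * \<rho> \<in> \<int>"
    define c' where "c' = min c 0"
    have half: "open {w. Re w < x}" "connected {w. Re w < x}" for x
      by (auto intro!: open_halfspace_Re_lt convex_connected convex_halfspace_Re_lt)
    have g_eq: "g w = phi_log \<alpha> \<rho> w" if "Re w < c'" for w
    proof -
      let ?U = "{w. Re w < c'} \<inter> {w. Im w > - pi} \<inter> {w. Im w < pi}"
      have "g w - phi_log \<alpha> \<rho> w = 0"
      proof (rule analytic_continuation_open[where s = ?U and
            s' = "{w. Re w < c'}" and f = "\<lambda>w. g w - phi_log \<alpha> \<rho> w" and g = "\<lambda>_. 0"])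
        show "open (?U)"
          by (intro open_Int half open_halfspace_Im_lt open_halfspace_Im_gt)
        have "of_real (c' - 1) \<in> ?U" by simp
        then show "?U \<noteq> {}" by blast
        have "phi_log \<alpha> \<rho> analytic_on {w. Re w < c'}"
          using phi_log_regular_off_imaginary_axis(1)[OF assms] by (subst analytic_on_analytic_at) (auto simp: c'_def)
        then have "phi_log \<alpha> \<rho> holomorphic_on {w. Re w < c'}" by (rule analytic_imp_holomorphic)
        moreover have "g holomorphic_on {w. Re w < c'}"
          by (rule holomorphic_on_subset[OF g(1)]) (auto simp: c'_def)
        ultimately show "(\<lambda>w. g w - phi_log \<alpha> \<rho> w) holomorphic_on {w. Re w < c'}"
          by (intro holomorphic_intros)
        show "g z - phi_log \<alpha> \<rho> z = 0" if "z \<in> ?U" for z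
          using g(2)[of z] that by (simp add: c'_def abs_less_iff)
      qed (use half that in auto)
      then show ?thesis by simp
    qed
    have "g (w + 2 * pi * \<i>) - g w = 0" if "Re w < c" for w
    proof (rule analytic_continuation_open[where s = "{w. Re w < c'}" and
          s' = "{w. Re w < c}" and f = "\<lambda>w. g (w + 2 * pi * \<i>) - g w" and g = "\<lambda>_. 0"])
      have "of_real (c' - 1) \<in> {w. Re w < c'}" by simp
      then show "{w. Re w < c'} \<noteq> {}" by blast
      show "(\<lambda>w. g (w + 2 * pi * \<i>) - g w) holomorphic_on {w. Re w < c}"
        by (intro holomorphic_on_diff g(1) holomorphic_on_comp[OF g(1)] holomorphic_intros) auto
      show "g (z + 2 * pi * \<i>) - g z = 0" if "z \<in> {w. Re w < c'}" for z
        using that g_eq[of z] g_eq[of "z + 2 * pi * \<i>"] phi_log_monodromy[OF assms, of z \<rho>] int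
        by (auto simp: c'_def)
    qed (use half[of c] half[of c'] that in \<open>auto simp: c'_def\<close>)
    then show False using ne by auto
  qed
qed

lemma slit_poles_eq_empty: "\<alpha> * \<rho> \<le> 1 \<Longrightarrow> slit_poles \<alpha> \<rho> = {}"
  by (auto simp: slit_poles_def)

lemma slit_poles_eq_two_poles:
  assumes "1 < \<alpha> * \<rho>" "\<alpha> * \<rho> \<le> 3"
  shows "slit_poles \<alpha> \<rho> = two_poles \<alpha> \<rho>"
proof -
  have "{m::nat. 2 * real m + 1 < \<alpha> * \<rho>} = {0}"
  proof (intro equalityI subsetI)
    fix m assume "m \<in> {m::nat. 2 * real m + 1 < \<alpha> * \<rho>}"
    then have "2 * real m < 2" using assms by simp
    then show "m \<in> {0}" by simp
  qed (use assms in auto)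
  then show ?thesis by (simp add: slit_poles_def two_poles_def)
qed

lemma two_poles_subset_slit_poles: "1 < \<alpha> * \<rho> \<Longrightarrow> two_poles \<alpha> \<rho> \<subseteq> slit_poles \<alpha> \<rho>"
  unfolding two_poles_def slit_poles_def by (intro order_trans[OF _ UN_upper[of 0]]) auto

theorem corollary2:
  fixes \<alpha> \<rho> :: real
  assumes "\<alpha> > 0" and "0 < \<rho>" and "\<rho> < 1"
  shows
    "(\<exists>\<Phi>. (\<forall>z::real. z > 0 \<longrightarrow> \<Phi> (of_real z) = phi \<alpha> \<rho> z)
        \<and> (\<alpha> * \<rho> \<le> 1 \<longrightarrow> \<Phi> holomorphic_on slit_plane)
        \<and> (1 < \<alpha> * \<rho> \<and> \<alpha> * \<rho> \<le> 3 \<longrightarrow> \<Phi> holomorphic_on slit_plane - two_poles \<alpha> \<rho>)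
        \<and> (1 < \<alpha> * \<rho> \<longrightarrow> two_poles \<alpha> \<rho> \<subseteq> slit_plane \<and> (\<forall>z\<in>two_poles \<alpha> \<rho>. simple_pole \<Phi> z))
        \<and> \<Phi> holomorphic_on slit_plane - slit_poles \<alpha> \<rho>
        \<and> (\<forall>z\<in>slit_poles \<alpha> \<rho>. simple_pole \<Phi> z)
        \<and> (branch_point \<Phi> 0 \<longleftrightarrow> \<alpha> * \<rho> \<notin> \<int>))
   \<and> (\<exists>f. f nicely_meromorphic_on UNIV
        \<and> (\<forall>x::real. f (of_real x) = phi \<alpha> \<rho> (exp x))
        \<and> (\<forall>w::complex. \<not> is_pole f w \<and> 1 + exp (\<alpha> * w + pi * \<i> * \<alpha> * (1 + \<rho>)) \<noteq> 0 \<longrightarrow>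
              f (w + 2 * pi * \<i>) =
              f w * ((1 + exp (\<alpha> * w + pi * \<i> * \<alpha> * (1 - \<rho>))) / (1 + exp (\<alpha> * w + pi * \<i> * \<alpha> * (1 + \<rho>)))))
        \<and> (\<forall>w::complex. \<not> is_pole f w \<and> 1 + exp (w + pi * \<i> * (1 / \<alpha> + \<rho>)) \<noteq> 0 \<longrightarrow>
              f (w + 2 * pi * \<i> / \<alpha>) =
              f w * ((1 + exp (w + pi * \<i> * (1 / \<alpha> - \<rho>))) / (1 + exp (w + pi * \<i> * (1 / \<alpha> + \<rho>)))))
        \<and> (\<forall>w::complex. zorder f w = int (root_mult \<alpha> \<rho> w) - int (pole_mult \<alpha> \<rho> w))
        \<and> {w. \<not> is_pole f w \<and> f w = 0} \<subseteq> root_set \<alpha> \<rho>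
        \<and> root_set \<alpha> \<rho> - pole_set \<alpha> \<rho> \<subseteq> {w. \<not> is_pole f w \<and> f w = 0}
        \<and> {w. is_pole f w} \<subseteq> pole_set \<alpha> \<rho>
        \<and> pole_set \<alpha> \<rho> - root_set \<alpha> \<rho> \<subseteq> {w. is_pole f w}
        \<and> (\<alpha> \<notin> \<rat> \<longrightarrow> (\<forall>w::complex. (\<not> is_pole f w \<and> f w = 0 \<longrightarrow> simple_root f w)
                           \<and> (is_pole f w \<longrightarrow> simple_pole f w))))"
proof (intro conjI, goal_cases)
  case 1
  have slit: "two_poles \<alpha> \<rho> \<subseteq> slit_plane" if "1 < \<alpha> * \<rho>"
    using Ln_slit_pole(1)[OF assms] two_poles_subset_slit_poles[OF that] by blast
  have simple: "simple_pole (\<lambda>z. phi_log \<alpha> \<rho> (Ln z)) z" if z: "z \<in> slit_poles \<alpha> \<rho>" for z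
  proof (rule simple_pole_compose_Ln)
    show "phi_log \<alpha> \<rho> meromorphic_on UNIV"
      using phi_log_nicely_meromorphic[OF assms(1)] by (simp add: nicely_meromorphic_on_def)
    show z0: "z \<notin> \<real>\<^sub>\<le>\<^sub>0"
      using Ln_slit_pole(1)[OF assms z] by (simp add: slit_plane_altdef)
    have "z \<noteq> 0" using z0 by auto
    then have "\<bar>Im (Ln z)\<bar> < pi"
      using Im_Ln_less_pi[OF z0] mpi_less_Im_Ln[of z] by linarith
    then show "zorder (phi_log \<alpha> \<rho>) (Ln z) = -1"
      using zorder_phi_log_strip[OF assms, of "Ln z"] Ln_slit_pole(2)[OF assms z] by simp
  qed (rule eventually_phi_log_nonzero[OF assms(1)])
  show ?case
  proof (rule exI[of _ "\<lambda>z. phi_log \<alpha> \<rho> (Ln z)"], intro conjI allI impI ballI)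
    show "phi_log \<alpha> \<rho> (Ln (of_real z)) = phi \<alpha> \<rho> z" if "z > 0" for z :: real
      using phi_log_of_real[OF assms, of "ln z"] that by (simp add: Ln_of_real)
    show "(\<lambda>z. phi_log \<alpha> \<rho> (Ln z)) holomorphic_on slit_plane" if "\<alpha> * \<rho> \<le> 1"
      using phi_log_Ln_holomorphic[OF assms] slit_poles_eq_empty[OF that] by simp
    show "(\<lambda>z. phi_log \<alpha> \<rho> (Ln z)) holomorphic_on slit_plane - two_poles \<alpha> \<rho>" if "1 < \<alpha> * \<rho> \<and> \<alpha> * \<rho> \<le> 3"
      using phi_log_Ln_holomorphic[OF assms] slit_poles_eq_two_poles that by simp
    show "two_poles \<alpha> \<rho> \<subseteq> slit_plane" if "1 < \<alpha> * \<rho>"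
      by (rule slit[OF that])
    show "simple_pole (\<lambda>z. phi_log \<alpha> \<rho> (Ln z)) z" if "1 < \<alpha> * \<rho>" "z \<in> two_poles \<alpha> \<rho>" for z
      using simple two_poles_subset_slit_poles that by blast
    show "branch_point (\<lambda>z. phi_log \<alpha> \<rho> (Ln z)) 0 \<longleftrightarrow> \<alpha> * \<rho> \<notin> \<int>"
      by (rule branch_point_phi_log_Ln[OF assms(1)])
  qed (use phi_log_Ln_holomorphic[OF assms] simple in auto)
next
  case 2
  define f where "f = phi_log \<alpha> \<rho>"
  have nice: "f nicely_meromorphic_on UNIV"
    unfolding f_def by (rule phi_log_nicely_meromorphic[OF assms(1)])
  have nz: "\<forall>\<^sub>F v in at w. f v \<noteq> 0" for w
    unfolding f_def by (rule eventually_phi_log_nonzero[OF assms(1)])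
  have ord: "zorder f w = int (root_mult \<alpha> \<rho> w) - int (pole_mult \<alpha> \<rho> w)" for w
    unfolding f_def root_mult_eq[OF assms(1)] pole_mult_eq[OF assms(1)] by (rule zorder_phi_log[OF assms(1)])
  note pole_iff = nicely_meromorphic_pole_zero_iff_zorder(1)[OF nice nz]
  note zero_iff = nicely_meromorphic_pole_zero_iff_zorder(2)[OF nice nz]
  note mem_root = root_mult_pos_iff[OF assms(1), of \<rho>] and mem_pole = pole_mult_pos_iff[OF assms(1), of \<rho>]
  have le_1: "root_mult \<alpha> \<rho> w \<le> 1" "pole_mult \<alpha> \<rho> w \<le> 1" if "\<alpha> \<notin> \<rat>" for w
    using index_pairs_le_1_irrational[OF assms(1) that, of "pi * \<i> * \<rho>" w]
      index_pairs_le_1_irrational[OF assms(1) that, of "- (pi * \<i> * \<rho>)" w] assms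
    by (simp_all add: root_mult_eq pole_mult_eq)
  show ?case
  proof (rule exI[of _ f], intro conjI allI impI)
    show "f (of_real x) = phi \<alpha> \<rho> (exp x)" for x
      unfolding f_def by (rule phi_log_of_real[OF assms])
    show "{w. \<not> is_pole f w \<and> f w = 0} \<subseteq> root_set \<alpha> \<rho>"
      unfolding zero_iff ord by (auto simp flip: mem_root)
    show "root_set \<alpha> \<rho> - pole_set \<alpha> \<rho> \<subseteq> {w. \<not> is_pole f w \<and> f w = 0}"
      unfolding zero_iff ord by (auto simp flip: mem_root mem_pole)
    show "{w. is_pole f w} \<subseteq> pole_set \<alpha> \<rho>"
      unfolding pole_iff ord by (auto simp flip: mem_pole)
    show "pole_set \<alpha> \<rho> - root_set \<alpha> \<rho> \<subseteq> {w. is_pole f w}"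
      unfolding pole_iff ord by (auto simp flip: mem_root mem_pole)
    show "simple_root f w" if "\<alpha> \<notin> \<rat>" "\<not> is_pole f w \<and> f w = 0" for w
    proof -
      have "zorder f w > 0" using that zero_iff by blast
      then have "zorder f w = 1" using ord[of w] le_1[OF that(1), of w] by linarith
      then show ?thesis using that by (simp add: simple_root_def)
    qed
    show "simple_pole f w" if "\<alpha> \<notin> \<rat>" "is_pole f w" for w
    proof -
      have "zorder f w < 0" using that pole_iff by blast
      then have "zorder f w = -1" using ord[of w] le_1[OF that(1), of w] by linarith
      then show ?thesis using that by (simp add: simple_pole_def)
    qed
  qed (use nice ord phi_log_shift[OF assms(1), of \<rho>] phi_log_shift_reciprocal[OF assms(1), of \<rho>] in
      \<open>auto simp: f_def\<close>)
qed

end
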